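(* Let $f\in K((x))[y]$ be a monic reduced polynomial and let $P_i^M$ be a point of the tree $T(f)$ with $P_i^M\notin\mathrm{Top}(f)$. Let $P_{i_1}^{N_1},\dots,P_{i_t}^{N_t}$ be the points that strictly dominate $P_i^M$, let $\theta$ be the smallest integer such that $M\le m_\theta^F/n_F$ for all $F\in P_i^M$, and fix $F_l\in P_{i_l}^{N_l}$ for all $1\le l\le t$. Then $$\deg_yQ_{f_y}(M,i)=\sum_{F\in D_i^M}n_F+\sum_{l=2}^t\Big[n_{F_l}-\sum_{j:\,M<m_j^{F_l}/n_{F_l}}(e_j^{F_l}-1)\frac{n_{F_l}}{d_j^{F_l}}\Big]\quad\text{if } M\ne\frac{m_\theta^{F_1}}{n_{F_1}},$$ $$\deg_yQ_{f_y}(M,i)=\sum_{F\in D_i^M}n_F+\sum_{l=2}^t\Big[n_{F_l}-\sum_{j:\,M<m_j^{F_l}/n_{F_l}}(e_j^{F_l}-1)\frac{n_{F_l}}{d_j^{F_l}}\Big]+(e_\theta^{F_1}-1)\frac{n_{F_1}}{d_\theta^{F_1}}\quad\text{if } M=\frac{m_\theta^{F_1}}{n_{F_1}},$$ where the inner sums run over $1\le j\le h_{F_l}$.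
   Context: $K$ is an algebraically closed field of characteristic $0$. $O_x$ denotes the order in $x$ of a series in $K((x^{1/p}))$. $f_y$ is the $y$-derivative of $f$; "irreducible components" are the monic irreducible factors in $K((x))[y]$. Characteristic sequences. Let $F\in K((x))[y]$ be monic irreducible of degree $n_F$ in $y$. By Newton's theorem its roots are $y(w^kx^{1/n_F})$, $1\le k\le n_F$, where $w$ is a primitive $n_F$-th root of unity and $y(t)=\sum a_it^i\in K((t))$ satisfies $F(t^{n_F},y(t))=0$; $\mathrm{supp}(F)=\{i:a_i\ne0\}$. Put $d_1^F=n_F$ and for $k\ge1$, while $d_k^F>1$, $m_k^F=\inf\{i\in\mathrm{supp}(F): d_k^F\nmid i\}$, $d_{k+1}^F=\gcd(d_k^F,m_k^F)$; $h_F$ is the integer with $d_{h_F+1}^F=1$ first attained ($h_F=0$ if $n_F=1$), and $m_{h_F+1}^F=+\infty$. Put $e_k^F=d_k^F/d_{k+1}^F$ for $1\le k\le h_F$. Contact. For monic irreducible $F,G$, $c(F,G)=\max O_x(y-z)$ over roots $y$ of $F$, $z$ of $G$ (so $c(F,F)=+\infty$). Tree. Let $f=f_1\cdots f_{\xi(f)}$ be the factorization into irreducible components. $C(f)=\{c(f_p,f_q):p\ne q\}\cup\bigcup_k\{m_1^{f_k}/n_{f_k},\dots,m_{h_{f_k}}^{f_k}/n_{f_k}\}$. For $M\in C(f)$, $C_M(f)$ is the set of components $f_p$ such that $c(f_p,f_q)\ge M$ for some $q\neq p$, or $m_j^{f_p}/n_{f_p}\ge M$ for some $1\le j\le h_{f_p}$.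 On $C_M(f)$, $f_pR_Mf_q$ iff $p=q$ or $c(f_p,f_q)\ge M$; this is an equivalence relation, and its classes $P_1^M,\dots,P_{s_M}^M$ are the points of $T(f)$ at level $M$ (points at different levels are regarded as different). $P_j^N$ dominates $P_i^M$ if $N\ge M$ and $P_j^N\subseteq P_i^M$; it strictly dominates $P_i^M$ if moreover $N>M$ and $C(f)\cap\,]M,N[\,=\emptyset$. $\mathrm{Top}(f)$ is the set of maximal points. $D_i^M$ is the set of elements of $P_i^M$ lying in no point strictly dominating $P_i^M$. $Q_H(M,i)$ is the product (with multiplicities) of the irreducible components of $H$ whose contact with every element of $P_i^M$ equals $M$. *)

theory Defs
  imports
    "HOL-Computational_Algebra.Computational_Algebra"
    "HOL-Library.Extended_Real"
begin

section \<open>Irreducible components and Puiseux roots\<close>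

text \<open>The type \<open>'a fls poly\<close> is \<open>K((x))[y]\<close>.\<close>

definition components :: "'a::field fls poly \<Rightarrow> 'a fls poly set" where
  "components H = {G. lead_coeff G = 1 \<and> irreducible G \<and> G dvd H}"

text \<open>
  A series in \<open>K((x\<^bsup>1/p\<^esup>))\<close> is represented by a Laurent series in \<open>t = x\<^bsup>1/p\<^esup>\<close>. The following is
  the set of those \<open>y(t)\<close> with \<open>F(t\<^sup>p, y(t)) = 0\<close>.
\<close>
definition puiseux_roots :: "nat \<Rightarrow> 'a::field fls poly \<Rightarrow> 'a fls set" where
  "puiseux_roots p F = {y. poly (map_poly (\<lambda>a. fls_compose_power a p) F) y = 0}"

text \<open>The order in \<open>x\<close> of \<open>y(x\<^bsup>1/p\<^esup>)\<close>.\<close>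
definition ord_x :: "nat \<Rightarrow> 'a::field fls \<Rightarrow> ereal" where
  "ord_x p y = (if y = 0 then \<infinity> else ereal (real_of_int (fls_subdegree y) / real p))"

section \<open>Characteristic sequences\<close>

text \<open>
  For a monic irreducible \<open>F\<close> the choice of the root does not matter: by Newton's theorem the
  roots are the \<open>y(w\<^sup>k t)\<close>, which have the same support.
\<close>
definition param :: "'a::field fls poly \<Rightarrow> 'a fls" where
  "param F = (SOME y. y \<in> puiseux_roots (degree F) F)"

definition supp :: "'a::field fls poly \<Rightarrow> int set" where
  "supp F = {i. fls_nth (param F) i \<noteq> 0}"

text \<open>
  The sequences \<open>d\<^sub>k\<close>, \<open>m\<^sub>k\<close>, \<open>e\<^sub>k\<close> are indexed from 1; the values at 0 are irrelevant. After
  \<open>d\<^sub>k = 1\<close> is reached, \<open>d\<close> stays constant and \<open>m\<^sub>k\<close>, an infimum over the empty set, is \<open>\<infinity>\<close>.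
  In \<open>char_d\<close> the infimum is taken in \<open>int\<close>; for monic irreducible \<open>F\<close> and \<open>d\<^sub>k > 1\<close> the set is
  nonempty and bounded below.
\<close>
primrec char_d :: "'a::field fls poly \<Rightarrow> nat \<Rightarrow> nat" where
  "char_d F 0 = degree F"
| "char_d F (Suc k) =
     (if k = 0 then degree F
      else if char_d F k > 1
        then nat (gcd (int (char_d F k)) (Inf {i \<in> supp F. \<not> int (char_d F k) dvd i}))
      else char_d F k)"

definition char_m :: "'a::field fls poly \<Rightarrow> nat \<Rightarrow> ereal" where
  "char_m F k = (INF i \<in> {i \<in> supp F. \<not> int (char_d F k) dvd i}. ereal (real_of_int i))"

definition char_h :: "'a::field fls poly \<Rightarrow> nat" where
  "char_h F = (LEAST h. char_d F (Suc h) = 1)"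

definition char_e :: "'a::field fls poly \<Rightarrow> nat \<Rightarrow> nat" where
  "char_e F k = char_d F k div char_d F (Suc k)"

text \<open>\<open>m\<^sub>k / n\<^sub>F\<close>\<close>
definition char_ratio :: "'a::field fls poly \<Rightarrow> nat \<Rightarrow> ereal" where
  "char_ratio F k = char_m F k / ereal (real (degree F))"

section \<open>Contact\<close>

text \<open>All roots of \<open>F\<close> and of \<open>G\<close> lie in \<open>K((x\<^bsup>1/p\<^esup>))\<close> for \<open>p = n\<^sub>F n\<^sub>G\<close>.\<close>
definition contact :: "'a::field fls poly \<Rightarrow> 'a fls poly \<Rightarrow> ereal" where
  "contact F G = (let p = degree F * degree G in
     Max {ord_x p (y - z) | y z. y \<in> puiseux_roots p F \<and> z \<in> puiseux_roots p G})"

section \<open>The tree\<close>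

definition contact_levels :: "'a::field fls poly \<Rightarrow> ereal set" where
  "contact_levels f =
     {contact F G | F G. F \<in> components f \<and> G \<in> components f \<and> F \<noteq> G}
     \<union> (\<Union>F \<in> components f. char_ratio F ` {1..char_h F})"

definition components_at :: "'a::field fls poly \<Rightarrow> ereal \<Rightarrow> 'a fls poly set" where
  "components_at f M = {F \<in> components f.
     (\<exists>G \<in> components f. G \<noteq> F \<and> contact F G \<ge> M)
     \<or> (\<exists>j \<in> {1..char_h F}. char_ratio F j \<ge> M)}"

definition rel_at :: "'a::field fls poly \<Rightarrow> ereal \<Rightarrow> ('a fls poly \<times> 'a fls poly) set" where
  "rel_at f M = {(F, G). F \<in> components_at f M \<and> G \<in> components_at f M
     \<and> (F = G \<or> contact F G \<ge> M)}"

text \<open>A point carries its level, so that equal classes at different levels remain different.\<close>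
type_synonym 'a point = "ereal \<times> 'a fls poly set"

definition tree :: "'a::field fls poly \<Rightarrow> 'a point set" where
  "tree f = {(M, P). M \<in> contact_levels f \<and> P \<in> components_at f M // rel_at f M}"

definition dominates :: "'a::field point \<Rightarrow> 'a point \<Rightarrow> bool" where
  "dominates q p \<longleftrightarrow> fst q \<ge> fst p \<and> snd q \<subseteq> snd p"

definition strictly_dominates :: "'a::field fls poly \<Rightarrow> 'a point \<Rightarrow> 'a point \<Rightarrow> bool" where
  "strictly_dominates f q p \<longleftrightarrow>
     dominates q p \<and> fst q > fst p \<and> contact_levels f \<inter> {fst p<..<fst q} = {}"

definition Top :: "'a::field fls poly \<Rightarrow> 'a point set" where
  "Top f = {p \<in> tree f. \<forall>q \<in> tree f. dominates q p \<longrightarrow> q = p}"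

definition D_set :: "'a::field fls poly \<Rightarrow> ereal \<Rightarrow> 'a fls poly set \<Rightarrow> 'a fls poly set" where
  "D_set f M P = {F \<in> P. \<forall>q \<in> tree f. strictly_dominates f q (M, P) \<longrightarrow> F \<notin> snd q}"

text \<open>
  The exponent is the multiplicity of \<open>G\<close> in \<open>H\<close>; the library's \<open>multiplicity\<close> is not available
  for polynomials over \<open>'a fls\<close>, which lacks the required class instances.
\<close>
definition Q_part :: "'a::field fls poly \<Rightarrow> ereal \<Rightarrow> 'a fls poly set \<Rightarrow> 'a fls poly" where
  "Q_part H M P = (\<Prod>G \<in> {G \<in> components H. \<forall>F \<in> P. contact G F = M}. G ^ Max {n. G ^ n dvd H})"

end

theory Submission
  imports Defs
begin

text \<open>
  All components of \<open>f\<close> and of \<open>f\<^sub>y\<close> split over \<open>K((x\<^bsup>1/p\<^esup>))\<close> for a common \<open>p\<close>. In characteristic 0 the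
  number of roots in a ball containing a root of \<open>f\<close> drops by exactly one when passing from \<open>f\<close>
  to \<open>f\<^sub>y\<close>. Hence in a ball of radius \<open>M\<close> around a root of an element of \<open>P\<close>, the roots of \<open>f\<^sub>y\<close> lying
  in none of the smaller open balls around the roots of \<open>f\<close> number one less than these smaller balls,
  and \<open>deg\<^sub>y Q\<close> is the total number of open balls minus the total number of closed ones. Balls
  correspond to truncated roots. The truncations of the roots of a component \<open>F\<close> up to a threshold
  form one orbit of the \<open>n\<^sub>F\<close>-th roots of unity with stabilizer of order \<open>d\<^sub>k\<close>, which gives \<open>n\<^sub>F / d\<^sub>k\<close> of
  them. The closed balls are counted by \<open>F\<^sub>1\<close> alone, the open ones by the elements of \<open>D\<close> and the
  \<open>F\<^sub>l\<close>; the sums over \<open>j\<close> telescope.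
\<close>

text \<open>Exponents lie in (1/p)Z, so closed and open balls alike prescribe the coefficients below
  some integer \<open>r\<close>; one counting theorem serves both. The drop by one comes from
  reduction: after the ball is moved to the valuation ring and a power of t is cleared, the number
  of roots inside is the degree of a polynomial over K, and differentiation lowers a positive degree
  by one. This needs a root of f in the ball, so both counts run over exactly the balls met by the
  point, and their difference isolates the roots of f_y at distance M. Two obstacles shape the rest.
  The components of f_y need not resemble those of f and may be multiple, so one index p must serve
  all pairs of components of both, and multiplicities are carried along. And balls belong to single
  roots whereas contacts belong to components; transitivity of the roots of unity on the roots of a
  component bridges the two, which is why Newton's theorem is developed from Hensel's lemma at the
  outset.\<close>

unbundle fps_syntax

section \<open>Coefficientwise maps\<close>

text \<open>Four coefficient maps are instances: \<open>x -> x^d\<close>, the embedding of K[[x]] in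
  K((x)), reduction modulo x, and \<open>t -> w t\<close>. Reduction is not injective and power
  series form only a domain, so fields and injectivity are left to
  \<open>field_coeff_hom\<close>.\<close>

locale coeff_hom =
  fixes \<phi> :: "'b::idom \<Rightarrow> 'c::idom"
  assumes hom_add: "\<phi> (a + b) = \<phi> a + \<phi> b"
    and hom_mult: "\<phi> (a * b) = \<phi> a * \<phi> b"
    and hom_one: "\<phi> 1 = 1"
begin

lemma hom_zero [simp]: "\<phi> 0 = 0"
  using hom_add[of 0 0] by (metis add.right_neutral add_left_cancel)

lemma hom_uminus: "\<phi> (- a) = - \<phi> a"
  using hom_add[of a "- a"] by (simp add: eq_neg_iff_add_eq_0 add.commute)

lemma hom_sum: "\<phi> (sum f A) = (\<Sum>x\<in>A. \<phi> (f x))"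
  by (induction A rule: infinite_finite_induct) (auto simp: hom_add)

lemma hom_of_nat: "\<phi> (of_nat n) = of_nat n"
  by (induction n) (auto simp: hom_add hom_one)

lemma coeff_map_hom [simp]: "coeff (map_poly \<phi> p) i = \<phi> (coeff p i)"
  by (simp add: coeff_map_poly)

lemma map_poly_add_hom: "map_poly \<phi> (p + q) = map_poly \<phi> p + map_poly \<phi> q"
  by (intro poly_eqI) (simp add: hom_add)

lemma map_poly_mult_hom: "map_poly \<phi> (p * q) = map_poly \<phi> p * map_poly \<phi> q"
  by (intro poly_eqI) (simp add: coeff_mult hom_sum hom_mult)

lemma map_poly_smult_hom: "map_poly \<phi> (smult c p) = smult (\<phi> c) (map_poly \<phi> p)"
  by (intro poly_eqI) (simp add: hom_mult)

lemma map_poly_pderiv_hom: "map_poly \<phi> (pderiv p) = pderiv (map_poly \<phi> p)"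
  by (intro poly_eqI) (simp add: coeff_pderiv hom_mult hom_add hom_of_nat hom_one)

lemma map_poly_prod_hom: "map_poly \<phi> (prod f A) = (\<Prod>x\<in>A. map_poly \<phi> (f x))"
  by (induction A rule: infinite_finite_induct) (auto simp: map_poly_mult_hom hom_one map_poly_1')

lemma map_poly_power_hom: "map_poly \<phi> (p ^ n) = map_poly \<phi> p ^ n"
  by (induction n) (auto simp: map_poly_mult_hom hom_one map_poly_1')

lemma map_poly_linear_hom: "map_poly \<phi> [:- a, 1:] = [:- \<phi> a, 1:]"
  by (simp add: map_poly_pCons hom_one hom_uminus)

lemma poly_map_poly_hom: "poly (map_poly \<phi> p) (\<phi> x) = \<phi> (poly p x)"
  by (induction p) (auto simp: map_poly_pCons hom_add hom_mult)

lemma map_poly_pcompose_hom: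
  "map_poly \<phi> (pcompose p q) = pcompose (map_poly \<phi> p) (map_poly \<phi> q)"
  by (induction p)
    (auto simp: map_poly_pCons pcompose_pCons map_poly_add_hom map_poly_mult_hom)

end

locale field_coeff_hom = coeff_hom \<phi> for \<phi> :: "'b::field \<Rightarrow> 'c::field"
begin

lemma hom_eq_0_iff [simp]: "\<phi> a = 0 \<longleftrightarrow> a = 0"
proof
  assume "\<phi> a = 0"
  show "a = 0"
  proof (rule ccontr)
    assume "a \<noteq> 0"
    then have "\<phi> a * \<phi> (inverse a) = 1"
      by (simp flip: hom_mult add: hom_one)
    with \<open>\<phi> a = 0\<close> show False by simp
  qed
qed simp

lemma hom_inj: "\<phi> a = \<phi> b \<longleftrightarrow> a = b"
  using hom_eq_0_iff[of "a - b"] hom_add[of a "- b"]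
  by (metis add_uminus_conv_diff eq_iff_diff_eq_0 hom_uminus)

lemma map_poly_inj: "map_poly \<phi> p = map_poly \<phi> q \<longleftrightarrow> p = q"
  by (auto simp: poly_eq_iff hom_inj)

lemma degree_map_hom [simp]: "degree (map_poly \<phi> p) = degree p"
  by (rule degree_map_poly) auto

lemma map_poly_hom_eq_0_iff [simp]: "map_poly \<phi> p = 0 \<longleftrightarrow> p = 0"
  using map_poly_inj[of p 0] by simp

end

lemma compose_power_hom:
  assumes "d > 0"
  shows "field_coeff_hom (\<lambda>a :: 'a::field fls. fls_compose_power a d)"
  by unfold_locales (use assms in auto)

lemma fps_to_fls_hom: "coeff_hom (fps_to_fls :: 'a::field fps \<Rightarrow> 'a fls)"
  by unfold_locales (auto simp: fls_times_fps_to_fls)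

lemma compose_power_compose_power:
  assumes "d > 0" "e > 0"
  shows "fls_compose_power (fls_compose_power a d) e = fls_compose_power a (d * e)"
proof (rule fls_eqI)
  fix i
  show "fls_compose_power (fls_compose_power a d) e $$ i = fls_compose_power a (d * e) $$ i"
  proof (cases "int e dvd i")
    case True
    then obtain k where k: "i = int e * k" by auto
    have "int (d * e) dvd i \<longleftrightarrow> int d dvd k"
      using assms unfolding k by (simp add: mult.commute)
    moreover have "i div int (d * e) = k div int d"
      using assms unfolding k by (simp add: mult.commute)
    ultimately show ?thesis
      using assms unfolding fls_nth_compose_power[OF assms(2)] by (simp add: fls_nth_compose_power k)
  next
    case False
    then have "\<not> int (d * e) dvd i"
      by (metis dvd_mult_right of_nat_mult)
    with False show ?thesis
      using assms by (simp add: fls_nth_compose_power)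
  qed
qed

section \<open>Newton's theorem\<close>

text \<open>Since \<open>h\<close> has nonzero constant term, it is a unit modulo the m-th power of
  the variable, and \<open>a\<close> is the quotient of \<open>c\<close> by \<open>h\<close> there.
  This solves the linear equation of each Hensel step.\<close>

lemma split_off_power_of_X:
  fixes h c :: "'a::field poly"
  assumes "coeff h 0 \<noteq> 0"
  shows "\<exists>a b. c = a * h + monom 1 m * b \<and> (\<forall>i\<ge>m. coeff a i = 0)"
proof (induction m)
  case 0
  show ?case by (rule exI[of _ 0], rule exI[of _ c]) (simp add: monom_0)
next
  case (Suc m)
  then obtain a b where ab: "c = a * h + monom 1 m * b" "\<forall>i\<ge>m. coeff a i = 0"
    by blast
  \<comment> \<open>Chosen to cancel the constant term of \<open>b\<close>, so that one more power
    of the variable splits off.\<close>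
  define \<beta> where "\<beta> = coeff b 0 / coeff h 0"
  have "coeff (b - smult \<beta> h) 0 = 0"
    using assms by (simp add: \<beta>_def)
  then obtain b' where b': "b - smult \<beta> h = pCons 0 b'"
    by (metis coeff_pCons_0 pCons_cases)
  have "b = smult \<beta> h + monom 1 1 * b'"
    using b' by (simp add: algebra_simps monom_Suc monom_0)
  then have "c = (a + monom \<beta> m) * h + monom 1 (Suc m) * b'"
  proof -
    have "monom \<beta> m = smult \<beta> (monom 1 m)" "monom (1::'a) (Suc m) = monom 1 m * monom 1 1"
      by (simp_all add: smult_monom mult_monom)
    then show ?thesis
      using ab(1) \<open>b = _\<close> by (simp add: algebra_simps)
  qed
  moreover have "\<forall>i\<ge>Suc m. coeff (a + monom \<beta> m) i = 0"
    using ab(2) by auto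
  ultimately show ?case by blast
qed

lemma coeff_hom_fps_nth_0: "coeff_hom (\<lambda>a :: 'a::field fps. a $ 0)"
  by unfold_locales auto

text \<open>Comparing coefficients of \<open>x^k\<close> in \<open>F = G * H\<close> leaves
  \<open>g_k * h0 + X^m * h_k\<close> as the only new terms; they can be prescribed because
  \<open>X^m\<close> and \<open>h0\<close> are coprime. The degree hypothesis bounds the degrees of
  all \<open>h_k\<close>, so that \<open>H\<close> is a polynomial.\<close>

lemma hensel_power_of_X:
  fixes F :: "'a::field fps poly"
  assumes F0: "map_poly (\<lambda>a. a $ 0) F = monom 1 m * h0"
    and h0: "coeff h0 0 \<noteq> 0"
    and deg: "degree F = m + degree h0"
  shows "\<exists>G H. F = G * H \<and> degree G = m"
proof -
  define Fk where "Fk = (\<lambda>k. map_poly (\<lambda>a. a $ k) F)"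
  have coeff_Fk: "coeff (Fk k) i = coeff F i $ k" for k i
    by (simp add: Fk_def coeff_map_poly)
  define n1 where "n1 = degree h0"
  \<comment> \<open>\<open>R s k r\<close> says that the pair \<open>r\<close> continues the factors
    \<open>s\<close> at order \<open>k\<close>. It reads \<open>s\<close> only below
    \<open>k\<close>, so well-founded choice yields the whole sequence.\<close>
  define R where "R = (\<lambda>(s :: nat \<Rightarrow> 'a poly \<times> 'a poly) k r.
     (\<forall>i>m. coeff (fst r) i = 0) \<and> (\<forall>i>n1. coeff (snd r) i = 0) \<and>
     (if k = 0 then r = (monom 1 m, h0)
      else (\<forall>i\<ge>m. coeff (fst r) i = 0) \<and>
        Fk k = fst r * h0 + monom 1 m * snd r + (\<Sum>i=1..<k. fst (s i) * snd (s (k - i)))))"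
  have "\<exists>s. \<forall>k. R s k (s k)"
  proof (rule dependent_wf_choice[OF wf_less_than])
    fix f g :: "nat \<Rightarrow> 'a poly \<times> 'a poly" and k r
    assume fg: "\<And>z. (z, k) \<in> less_than \<Longrightarrow> f z = g z"
    have "(\<Sum>i=1..<k. fst (f i) * snd (f (k - i))) = (\<Sum>i=1..<k. fst (g i) * snd (g (k - i)))"
      by (intro sum.cong) (auto simp: fg)
    then show "R f k r = R g k r"
      by (simp add: R_def)
  next
    fix k :: nat and s :: "nat \<Rightarrow> 'a poly \<times> 'a poly"
    assume IH: "\<And>y. (y, k) \<in> less_than \<Longrightarrow> R s y (s y)"
    show "\<exists>r. R s k r"
    proof (cases "k = 0")
      case True
      then show ?thesis
        by (intro exI[of _ "(monom 1 m, h0)"]) (auto simp: R_def n1_def coeff_eq_0)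
    next
      case False
      define c where "c = Fk k - (\<Sum>i=1..<k. fst (s i) * snd (s (k - i)))"
      obtain a b where ab: "c = a * h0 + monom 1 m * b" "\<forall>i\<ge>m. coeff a i = 0"
        using split_off_power_of_X[OF h0, of c m] by blast
      \<comment> \<open>Both \<open>c\<close> and \<open>a * h0\<close> turn out to have degree at
        most \<open>m + n1\<close>, so \<open>b\<close> has degree at most
        \<open>n1\<close>.\<close>
      have deg_prod: "coeff (fst (s i) * snd (s (k - i))) j = 0" if "i \<in> {1..<k}" "j \<ge> m + n1 + 1" for i j
      proof -
        have "degree (fst (s i)) \<le> m" "degree (snd (s (k - i))) \<le> n1"
          using IH[of i] IH[of "k - i"] that by (auto simp: R_def intro!: degree_le)
        then show ?thesis
          using that by (intro coeff_eq_0 le_less_trans[OF degree_mult_le]) auto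
      qed
      have "coeff c j = 0" if "j \<ge> m + n1 + 1" for j
      proof -
        have "coeff (Fk k) j = 0"
          using deg that by (simp add: coeff_Fk coeff_eq_0 n1_def)
        moreover have "coeff (\<Sum>i=1..<k. fst (s i) * snd (s (k - i))) j = 0"
          unfolding coeff_sum by (rule sum.neutral) (use deg_prod that in auto)
        ultimately show ?thesis by (simp add: c_def)
      qed
      moreover have "coeff (a * h0) j = 0" if "j \<ge> m + n1 + 1" for j
      proof -
        have "degree a \<le> m"
          using ab(2) by (auto intro!: degree_le)
        then show ?thesis
          using that by (intro coeff_eq_0 le_less_trans[OF degree_mult_le]) (auto simp: n1_def)
      qed
      ultimately have "coeff (monom 1 m * b) (m + i) = 0" if "i > n1" for i
        using that arg_cong[OF ab(1), of "\<lambda>p. coeff p (m + i)"] by simp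
      then have "\<forall>i>n1. coeff b i = 0"
        by (simp add: coeff_monom_mult)
      with ab False show ?thesis
        by (intro exI[of _ "(a, b)"]) (auto simp: R_def c_def algebra_simps)
    qed
  qed
  then obtain s where s: "\<And>k. R s k (s k)" by blast
  define g where "g = (\<lambda>k. fst (s k))"
  define h where "h = (\<lambda>k. snd (s k))"
  have g0: "g 0 = monom 1 m" and hh0: "h 0 = h0"
    using s[of 0] by (auto simp: R_def g_def h_def)
  have g_zero: "coeff (g k) i = 0" if "i > m" for k i
    using s[of k] that by (auto simp: R_def g_def)
  have h_zero: "coeff (h k) i = 0" if "i > n1" for k i
    using s[of k] that by (auto simp: R_def h_def)
  have Fk_eq: "Fk k = (\<Sum>l=0..k. g l * h (k - l))" for k
  proof (cases "k = 0")
    case True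
    then show ?thesis using F0 by (simp add: g0 hh0 Fk_def)
  next
    case False
    then have "{0..k} = insert 0 (insert k {1..<k})" by auto
    then have "(\<Sum>l=0..k. g l * h (k - l)) = g 0 * h k + (g k * h 0 + (\<Sum>l=1..<k. g l * h (k - l)))"
      using False by simp
    then show ?thesis
      using s[of k] False unfolding g0 hh0 by (simp add: R_def g_def h_def algebra_simps)
  qed
  define G where "G = (\<Sum>i\<le>m. monom (Abs_fps (\<lambda>k. coeff (g k) i)) i)"
  define H where "H = (\<Sum>i\<le>n1. monom (Abs_fps (\<lambda>k. coeff (h k) i)) i)"
  have coeff_G: "coeff G i $ k = coeff (g k) i" for i k
    using g_zero[of i k] by (auto simp: G_def coeff_sum if_distrib if_distribR cong: if_cong)
  have coeff_H: "coeff H i $ k = coeff (h k) i" for i k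
    using h_zero[of i k] by (auto simp: H_def coeff_sum if_distrib if_distribR cong: if_cong)
  have FGH: "F = G * H"
  proof (intro poly_eqI fps_ext)
    fix i k
    have "coeff (G * H) i $ k = (\<Sum>j\<le>i. \<Sum>l=0..k. coeff (g l) j * coeff (h (k - l)) (i - j))"
      by (simp add: coeff_mult fps_sum_nth fps_mult_nth coeff_G coeff_H)
    also have "\<dots> = (\<Sum>l=0..k. coeff (g l * h (k - l)) i)"
      by (subst sum.swap) (simp add: coeff_mult)
    also have "\<dots> = coeff F i $ k"
      by (simp flip: coeff_Fk add: Fk_eq coeff_sum)
    finally show "coeff F i $ k = coeff (G * H) i $ k" by simp
  qed
  have "coeff G m \<noteq> 0"
    using coeff_G[of m 0] by (auto simp: g0)
  moreover have "\<forall>i>m. coeff G i = 0"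
    by (auto simp: fps_eq_iff coeff_G g_zero)
  ultimately have "degree G = m"
    by (meson degree_le le_antisym le_degree)
  with FGH show ?thesis by blast
qed

section \<open>Change of the ramification index\<close>

text \<open>This is \<open>F(t^p, y)\<close> over K((t)); it turns Puiseux roots into ordinary roots
  over a field.\<close>

definition lift :: "nat \<Rightarrow> 'a::field fls poly \<Rightarrow> 'a fls poly" where
  "lift p F = map_poly (\<lambda>a. fls_compose_power a p) F"

lemma puiseux_roots_lift: "puiseux_roots p F = {y. poly (lift p F) y = 0}"
  by (simp add: puiseux_roots_def lift_def)

context
  fixes p :: nat
  assumes p: "p > 0"
begin

interpretation cp: field_coeff_hom "\<lambda>a :: 'a::field fls. fls_compose_power a p"
  by (rule compose_power_hom[OF p])

lemma lift_mult: "lift p (F * G) = lift p F * lift p (G ::'a::field fls poly)"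
  by (simp add: lift_def cp.map_poly_mult_hom)

lemma lift_add: "lift p (F + G) = lift p F + lift p (G ::'a::field fls poly)"
  by (simp add: lift_def cp.map_poly_add_hom)

lemma lift_smult: "lift p (smult c F) = smult (fls_compose_power c p) (lift p (F ::'a::field fls poly))"
  by (simp add: lift_def cp.map_poly_smult_hom)

lemma lift_pcompose: "lift p (pcompose F G) = pcompose (lift p F) (lift p (G ::'a::field fls poly))"
  by (simp add: lift_def cp.map_poly_pcompose_hom)

lemma lift_pderiv: "lift p (pderiv F) = pderiv (lift p (F ::'a::field fls poly))"
  by (simp add: lift_def cp.map_poly_pderiv_hom)

lemma lift_prod: "lift p (prod f A) = (\<Prod>x\<in>A. lift p (f x ::'a::field fls poly))"
  by (simp add: lift_def cp.map_poly_prod_hom)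

lemma lift_power: "lift p (F ^ n) = lift p (F ::'a::field fls poly) ^ n"
  by (simp add: lift_def cp.map_poly_power_hom)

lemma lift_linear: "lift p [:- a, 1:] = [:- fls_compose_power (a ::'a::field fls) p, 1:]"
  by (simp add: lift_def cp.map_poly_linear_hom)

lemma degree_lift [simp]: "degree (lift p (F ::'a::field fls poly)) = degree F"
  by (simp add: lift_def)

lemma coeff_lift: "coeff (lift p (F ::'a::field fls poly)) i = fls_compose_power (coeff F i) p"
  by (simp add: lift_def)

lemma lift_eq_iff: "lift p F = lift p G \<longleftrightarrow> F = (G ::'a::field fls poly)"
  by (simp add: lift_def cp.map_poly_inj)

lemma lift_eq_0_iff [simp]: "lift p F = 0 \<longleftrightarrow> F = (0 ::'a::field fls poly)"
  by (simp add: lift_def)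

lemma poly_lift: "poly (lift p F) (fls_compose_power x p) = fls_compose_power (poly F (x ::'a::field fls)) p"
  by (simp add: lift_def cp.poly_map_poly_hom)

lemma compose_power_eq_iff: "fls_compose_power a p = fls_compose_power b p \<longleftrightarrow> a = (b ::'a::field fls)"
  by (rule cp.hom_inj)

lemma lift_lift: "q > 0 \<Longrightarrow> lift p (lift q F) = lift (q * p) (F ::'a::field fls poly)"
  using p by (intro poly_eqI)
    (simp add: lift_def coeff_map_poly compose_power_compose_power)

end

text \<open>Only the two top coefficients of \<open>p(y + b)\<close> matter: a suitable
  \<open>b\<close> kills the second one, the normalisation that later excludes an n-fold root of the
  reduction.\<close>

lemma coeff_pcompose_shift:
  fixes p :: "'b::comm_ring_1 poly"
  assumes "degree p \<le> Suc n"
  shows "coeff (pcompose p [:b, 1:]) n = coeff p n + of_nat (Suc n) * b * coeff p (Suc n)"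
    and "coeff (pcompose p [:b, 1:]) (Suc n) = coeff p (Suc n)"
proof -
  have "degree p \<le> Suc n \<Longrightarrow>
    coeff (pcompose p [:b, 1:]) n = coeff p n + of_nat (Suc n) * b * coeff p (Suc n)
    \<and> coeff (pcompose p [:b, 1:]) (Suc n) = coeff p (Suc n)"
  proof (induction p arbitrary: n)
    case 0
    then show ?case by simp
  next
    case (pCons a p)
    have top: "coeff (pcompose p [:b, 1:]) (Suc n) = 0"
    proof (rule coeff_eq_0)
      show "degree (pcompose p [:b, 1:]) < Suc n"
        using pCons.prems degree_pcompose_le[of p "[:b, 1:]"] by (cases "p = 0") auto
    qed
    show ?case
    proof (cases n)
      case 0
      then have "degree p = 0"
        using pCons.prems by (cases "p = 0") auto
      then obtain c where "p = [:c:]" by (rule degree_eq_zeroE)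
      then show ?thesis using 0 by (simp add: pcompose_pCons)
    next
      case (Suc k)
      have "degree p \<le> Suc k"
        using pCons.prems Suc by (cases "p = 0") auto
      from pCons.IH[OF this] top show ?thesis
        by (simp add: Suc pcompose_pCons coeff_pCons algebra_simps)
    qed
  qed
  with assms show "coeff (pcompose p [:b, 1:]) n = coeff p n + of_nat (Suc n) * b * coeff p (Suc n)"
    and "coeff (pcompose p [:b, 1:]) (Suc n) = coeff p (Suc n)" by auto
qed

section \<open>Newton polygon and existence of a root\<close>

text \<open>A single root for an unspecified index is enough for the induction on the degree; the
  other roots come later from conjugation.\<close>

definition has_puiseux_root :: "'a::field fls poly \<Rightarrow> bool" where
  "has_puiseux_root F \<longleftrightarrow> (\<exists>p>0. puiseux_roots p F \<noteq> {})"

lemma has_puiseux_root_dvd: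
  assumes "has_puiseux_root G" "G dvd F"
  shows "has_puiseux_root F"
proof -
  from assms obtain p y where "p > 0" "poly (lift p G) y = 0"
    by (auto simp: has_puiseux_root_def puiseux_roots_lift)
  moreover obtain H where "F = G * H"
    using assms(2) by (elim dvdE)
  ultimately show ?thesis
    unfolding has_puiseux_root_def by (intro exI[of _ p]) (auto simp: puiseux_roots_lift lift_mult)
qed

lemma has_puiseux_root_lift:
  assumes "has_puiseux_root (lift q F)" "q > 0"
  shows "has_puiseux_root F"
proof -
  from assms obtain p where "p > 0" "puiseux_roots p (lift q F) \<noteq> {}"
    by (auto simp: has_puiseux_root_def)
  then show ?thesis
    unfolding has_puiseux_root_def using assms
    by (intro exI[of _ "q * p"]) (auto simp: puiseux_roots_lift lift_lift)
qed

lemma has_puiseux_root_pcompose: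
  assumes "has_puiseux_root (pcompose F G)"
  shows "has_puiseux_root F"
proof -
  from assms obtain p y where "p > 0" "poly (lift p (pcompose F G)) y = 0"
    by (auto simp: has_puiseux_root_def puiseux_roots_lift)
  then show ?thesis
    unfolding has_puiseux_root_def
    by (auto simp: puiseux_roots_lift lift_pcompose poly_pcompose)
qed

lemma has_puiseux_root_smult:
  assumes "has_puiseux_root (smult c F)" "c \<noteq> 0"
  shows "has_puiseux_root F"
  using assms by (intro has_puiseux_root_dvd[OF assms(1)]) (simp add: smult_dvd)

text \<open>The reduction of \<open>F\<close> modulo x has a root \<open>c\<close>. Were
  \<open>c\<close> its only root, the vanishing second coefficient and characteristic 0 would force
  \<open>c = 0\<close>, against the unit coefficient at \<open>i0\<close>. So the multiplicity
  \<open>m\<close> of \<open>c\<close> lies strictly between 0 and the degree, and Hensel splits off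
  a factor of degree \<open>m\<close>.\<close>

lemma puiseux_root_step_integral:
  fixes F :: "'a::{alg_closed_field, field_char_0} fps poly"
  assumes deg: "degree F = Suc (Suc k)" and lc: "lead_coeff F = 1"
    and sub: "coeff F (Suc k) = 0"
    and i0: "i0 \<le> k" "coeff F i0 $ 0 \<noteq> 0"
    and IH: "\<And>G :: 'a fls poly. 0 < degree G \<Longrightarrow> degree G < degree F \<Longrightarrow> has_puiseux_root G"
  shows "has_puiseux_root (map_poly fps_to_fls F)"
proof -
  interpret res: coeff_hom "\<lambda>a :: 'a fps. a $ 0" by (rule coeff_hom_fps_nth_0)
  interpret emb: coeff_hom "fps_to_fls :: 'a fps \<Rightarrow> 'a fls" by (rule fps_to_fls_hom)
  define q0 where "q0 = map_poly (\<lambda>a. a $ 0) F"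
  have q0_coeff: "coeff q0 i = coeff F i $ 0" for i
    by (simp add: q0_def)
  have deg_q0: "degree q0 = Suc (Suc k)"
  proof (rule antisym)
    show "degree q0 \<le> Suc (Suc k)"
      using deg by (intro degree_le) (auto simp: q0_coeff coeff_eq_0)
    show "Suc (Suc k) \<le> degree q0"
      using deg lc by (intro le_degree) (simp add: q0_coeff)
  qed
  then obtain c where c: "poly q0 c = 0"
    using alg_closed_imp_poly_has_root[of q0] by auto
  define q1 where "q1 = pcompose q0 [:c, 1:]"
  have deg_q1: "degree q1 = Suc (Suc k)"
    by (simp add: q1_def degree_pcompose deg_q0)
  then have "q1 \<noteq> 0" by auto
  have lc_q1: "coeff q1 (Suc (Suc k)) = 1"
    using coeff_pcompose_shift(2)[of q0 "Suc k" c] deg_q0 deg lc by (simp add: q1_def q0_coeff)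
  have sub_q1: "coeff q1 (Suc k) = of_nat (Suc (Suc k)) * c"
    using coeff_pcompose_shift(1)[of q0 "Suc k" c] deg_q0 deg lc sub by (simp add: q1_def q0_coeff)
  obtain h0 where h0: "q1 = [:- 0, 1:] ^ order 0 q1 * h0" "\<not> [:- 0, 1:] dvd h0"
    using order_decomp[OF \<open>q1 \<noteq> 0\<close>, of 0] by auto
  define m where "m = order 0 q1"
  have q1_eq: "q1 = monom 1 m * h0"
    using h0(1) by (simp add: m_def monom_altdef)
  have h0_0: "coeff h0 0 \<noteq> 0"
    using h0(2) by (simp only: dvd_iff_poly_eq_0 minus_zero) (simp add: poly_0_coeff_0)
  have "h0 \<noteq> 0" using h0_0 by auto
  have "m > 0"
    using \<open>q1 \<noteq> 0\<close> c unfolding m_def order_gt_0_iff[OF \<open>q1 \<noteq> 0\<close>] by (simp add: q1_def poly_pcompose)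
  have deg_m: "Suc (Suc k) = m + degree h0"
    using deg_q1 \<open>h0 \<noteq> 0\<close> by (simp add: q1_eq degree_mult_eq degree_monom_eq)
  have "m \<noteq> Suc (Suc k)"
  proof
    assume m: "m = Suc (Suc k)"
    then have "degree h0 = 0" using deg_m by simp
    then obtain d where d: "h0 = [:d:]" by (rule degree_eq_zeroE)
    have q1d: "q1 = monom d m"
      using q1_eq by (simp add: d mult_monom flip: monom_0)
    then have "of_nat (Suc (Suc k)) * c = 0"
      using sub_q1 m by simp
    then have "c = 0"
      by (simp del: of_nat_Suc)
    then have "q0 = monom d m"
      using q1d by (simp add: q1_def)
    then show False
      using i0 m by (simp flip: q0_coeff)
  qed
  then have m_less: "m < Suc (Suc k)" using deg_m by simp
  define F6 where "F6 = pcompose F [:fps_const c, 1:]"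
  have "map_poly (\<lambda>a. a $ 0) F6 = monom 1 m * h0"
    unfolding F6_def res.map_poly_pcompose_hom
    by (simp add: q1_eq[symmetric] q1_def q0_def map_poly_pCons)
  moreover have deg_F6: "degree F6 = Suc (Suc k)"
    using deg by (simp add: F6_def degree_pcompose)
  ultimately obtain G H where GH: "F6 = G * H" "degree G = m"
    using hensel_power_of_X[of F6 m h0] h0_0 deg_m by auto
  define G' where "G' = map_poly fps_to_fls G"
  have "degree G' = m"
    using GH(2) by (simp add: G'_def degree_map_poly)
  then have "has_puiseux_root G'"
    using \<open>m > 0\<close> m_less deg by (intro IH) auto
  moreover have "G' dvd pcompose (map_poly fps_to_fls F) [:fls_const c, 1:]"
  proof -
    have "pcompose (map_poly fps_to_fls F) [:fls_const c, 1:] = map_poly fps_to_fls F6"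
      by (simp add: F6_def emb.map_poly_pcompose_hom map_poly_pCons)
    then show ?thesis
      by (simp add: GH emb.map_poly_mult_hom G'_def)
  qed
  ultimately show ?thesis
    using has_puiseux_root_dvd has_puiseux_root_pcompose by blast
qed

text \<open>For the least slope \<open>\<rho> / q\<close> of the Newton polygon, putting
  \<open>x = t^q\<close> and \<open>y = t^\<rho> * y'\<close> makes all coefficients integral and
  the one at \<open>i0\<close> a unit. This is the situation of
  \<open>puiseux_root_step_integral\<close>.\<close>

lemma puiseux_root_step_monic:
  fixes F :: "'a::{alg_closed_field, field_char_0} fls poly"
  assumes deg: "degree F = Suc (Suc k)" and lc: "lead_coeff F = 1"
    and sub: "coeff F (Suc k) = 0"
    and IH: "\<And>G :: 'a fls poly. 0 < degree G \<Longrightarrow> degree G < degree F \<Longrightarrow> has_puiseux_root G"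
  shows "has_puiseux_root F"
proof (cases "\<forall>i\<le>k. coeff F i = 0")
  case True
  then have "coeff F 0 = 0" by simp
  then have "[:- 0, 1:] dvd F"
    by (simp only: dvd_iff_poly_eq_0 minus_zero) (simp add: poly_0_coeff_0)
  moreover have "has_puiseux_root [:- 0 :: 'a fls, 1:]"
    by (rule IH) (auto simp: deg)
  ultimately show ?thesis
    using has_puiseux_root_dvd by blast
next
  case False
  define n where "n = Suc (Suc k)"
  define I where "I = {i. i \<le> k \<and> coeff F i \<noteq> 0}"
  define slope where "slope = (\<lambda>i. real_of_int (fls_subdegree (coeff F i)) / real (n - i))"
  have "finite I" "I \<noteq> {}"
    using False by (auto simp: I_def)
  then obtain i0 where i0: "i0 \<in> I" "\<And>i. i \<in> I \<Longrightarrow> slope i0 \<le> slope i"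
    using ex_min_if_finite[of "slope ` I"] by (fastforce simp: not_less)
  define q where "q = n - i0"
  define \<rho> where "\<rho> = fls_subdegree (coeff F i0)"
  have "i0 \<le> k" "q > 0" "int q = int n - int i0"
    using i0(1) by (auto simp: I_def q_def n_def)
  have slope: "\<rho> * int (n - i) \<le> int q * fls_subdegree (coeff F i)" if "i \<in> I" for i
  proof -
    have "n - i > 0" using that by (auto simp: I_def n_def)
    then have "real_of_int (\<rho> * int (n - i)) \<le> real_of_int (int q * fls_subdegree (coeff F i))"
      using i0(2)[OF that] \<open>q > 0\<close>
      by (simp add: slope_def q_def[symmetric] \<rho>_def field_simps)
    then show ?thesis by linarith
  qed
  define X :: "int \<Rightarrow> 'a fls" where "X = fls_X_intpow"
  \<comment> \<open>The outer factor makes the polynomial monic again. A nonzero coefficient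
    \<open>a_i\<close> then acquires order \<open>q * ord a_i - \<rho> * (n - i)\<close>, which is 0
    at \<open>i0\<close> and nonnegative elsewhere by minimality of the slope.\<close>
  define F4 where "F4 = smult (X (- \<rho> * int n)) (pcompose (lift q F) [:0, X \<rho>:])"
  have X_power: "X a ^ j = X (int j * a)" for a j
    unfolding X_def by (rule fls_X_intpow_power)
  have X_mult: "X a * f = fls_shift (- a) f" for a f
    unfolding X_def by (rule fls_X_intpow_times_conv_shift)
  have coeff_F4: "coeff F4 i $$ j =
      fls_compose_power (coeff F i) q $$ (j + \<rho> * (int n - int i))" for i j
  proof -
    have "coeff F4 i = X (- \<rho> * int n) * (X (int i * \<rho>) * fls_compose_power (coeff F i) q)"
      using \<open>q > 0\<close> by (simp add: F4_def coeff_pcompose_linear X_power coeff_lift)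
    then show ?thesis
      by (simp only: X_mult fls_shift_fls_shift fls_shift_nth) (simp add: algebra_simps)
  qed
  have F4_neg: "coeff F4 i $$ j = 0" if "j < 0" for i j
  proof (cases "i \<in> I")
    case True
    then have "int (n - i) = int n - int i" by (auto simp: I_def n_def)
    with slope[OF True] have "\<rho> * (int n - int i) \<le> int q * fls_subdegree (coeff F i)" by simp
    then have lt: "j + \<rho> * (int n - int i) < int q * fls_subdegree (coeff F i)"
      using that by linarith
    show ?thesis
    proof (cases "int q dvd j + \<rho> * (int n - int i)")
      case True
      then obtain l where l: "j + \<rho> * (int n - int i) = int q * l" by auto
      then have "l < fls_subdegree (coeff F i)"
        using lt \<open>q > 0\<close> by simp
      then show ?thesis
        using \<open>q > 0\<close> by (simp add: coeff_F4 l fls_nth_compose_power)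
    qed (use \<open>q > 0\<close> in \<open>simp add: coeff_F4 fls_nth_compose_power\<close>)
  next
    case False
    then consider "coeff F i = 0" | "i = n"
      using deg sub by (cases i n rule: linorder_cases)
        (auto simp: I_def n_def coeff_eq_0 not_le less_Suc_eq)
    then show ?thesis
      using that lc deg \<open>q > 0\<close> by cases (auto simp: coeff_F4 n_def)
  qed
  have deg_F4: "degree F4 = n"
  proof (rule antisym)
    show "degree F4 \<le> n"
      using deg \<open>q > 0\<close> by (intro degree_le) (auto simp: fls_eq_iff coeff_F4 coeff_eq_0 n_def)
    have "coeff F4 n $$ 0 \<noteq> 0"
      using lc deg \<open>q > 0\<close> by (simp add: coeff_F4 n_def)
    then show "n \<le> degree F4" by (intro le_degree) auto
  qed
  define F5 where "F5 = map_poly fls_regpart F4"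
  have coeff_F5: "coeff F5 i $ j = coeff F4 i $$ int j" for i j
    by (simp add: F5_def coeff_map_poly)
  have F45: "F4 = map_poly fps_to_fls F5"
    by (intro poly_eqI fls_eqI) (auto simp: coeff_map_poly coeff_F5 F4_neg)
  have deg_F5: "degree F5 = n"
    using deg_F4 unfolding F45 by (simp add: degree_map_poly)
  have "has_puiseux_root F4"
    unfolding F45
  proof (rule puiseux_root_step_integral)
    show "degree F5 = Suc (Suc k)"
      by (simp add: deg_F5 n_def)
    show "lead_coeff F5 = 1"
      using lc deg \<open>q > 0\<close> unfolding deg_F5
      by (auto simp: fps_eq_iff coeff_F5 coeff_F4 n_def)
    show "coeff F5 (Suc k) = 0"
      using sub by (auto simp: fps_eq_iff coeff_F5 coeff_F4)
    show "i0 \<le> k" by fact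
    have "coeff F5 i0 $ 0 = fls_compose_power (coeff F i0) q $$ (int q * \<rho>)"
      by (simp add: coeff_F5 coeff_F4 \<open>int q = _\<close> mult.commute)
    also have "\<dots> = coeff F i0 $$ \<rho>"
      using \<open>q > 0\<close> by (simp add: fls_nth_compose_power)
    also have "\<dots> \<noteq> 0"
      using i0(1) by (simp add: I_def \<rho>_def)
    finally show "coeff F5 i0 $ 0 \<noteq> 0" .
    show "has_puiseux_root G" if "0 < degree G" "degree G < degree F5" for G :: "'a fls poly"
      using that by (intro IH) (auto simp: deg deg_F5 n_def)
  qed
  then have "has_puiseux_root (pcompose (lift q F) [:0, X \<rho>:])"
    unfolding F4_def by (rule has_puiseux_root_smult) (simp add: X_def fls_shift_eq0_iff)
  then show ?thesis
    using has_puiseux_root_pcompose has_puiseux_root_lift \<open>q > 0\<close> by blast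
qed

theorem newton_puiseux:
  fixes F :: "'a::{alg_closed_field, field_char_0} fls poly"
  assumes "degree F > 0"
  shows "has_puiseux_root F"
  using assms
proof (induction "degree F" arbitrary: F rule: less_induct)
  case less
  define F1 where "F1 = smult (inverse (lead_coeff F)) F"
  have "lead_coeff F \<noteq> 0" using less.prems by auto
  then have F1: "degree F1 = degree F" "lead_coeff F1 = 1"
    by (simp_all add: F1_def)
  have "has_puiseux_root F1"
  proof (cases "degree F = 1")
    case True
    have "poly F1 (- coeff F1 0) = 0"
      using F1 True by (simp add: poly_altdef)
    then have "poly (lift 1 F1) (fls_compose_power (- coeff F1 0) 1) = 0"
      by (subst poly_lift) simp_all
    then show ?thesis
      unfolding has_puiseux_root_def puiseux_roots_lift by (intro exI[of _ 1]) auto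
  next
    case False
    then obtain k where k: "degree F = Suc (Suc k)"
      using less.prems by (metis One_nat_def Suc_pred neq0_conv)
    \<comment> \<open>The shift that removes the second coefficient; dividing by the degree requires
      characteristic 0.\<close>
    define b where "b = - coeff F1 (Suc k) / of_nat (Suc (Suc k))"
    have "has_puiseux_root (pcompose F1 [:b, 1:])"
    proof (rule puiseux_root_step_monic)
      have deg1: "degree F1 \<le> Suc (Suc k)" using F1 k by simp
      show deg2: "degree (pcompose F1 [:b, 1:]) = Suc (Suc k)"
        using F1 k by (simp add: degree_pcompose)
      show "lead_coeff (pcompose F1 [:b, 1:]) = 1"
        unfolding deg2 using coeff_pcompose_shift(2)[OF deg1, of b] F1 k by simp
      show "coeff (pcompose F1 [:b, 1:]) (Suc k) = 0"
        using coeff_pcompose_shift(1)[OF deg1, of b] F1 k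
        by (simp add: b_def del: of_nat_Suc)
      show "has_puiseux_root G" if "0 < degree G" "degree G < degree (pcompose F1 [:b, 1:])"
        for G :: "'a fls poly"
        using that deg2 k by (intro less.hyps) auto
    qed
    then show ?thesis by (rule has_puiseux_root_pcompose)
  qed
  then show ?case
    unfolding F1_def by (rule has_puiseux_root_smult) (use \<open>lead_coeff F \<noteq> 0\<close> in auto)
qed

section \<open>Conjugate roots\<close>

text \<open>This group is the Galois group of K((t)) over K((t^n)), acting by
  \<open>t -> w t\<close>. Working with the whole group avoids the choice of a primitive
  root.\<close>

definition unity_roots :: "nat \<Rightarrow> 'a::field set" where
  "unity_roots n = {w. w ^ n = 1}"

lemma card_poly_roots_eq_degree:
  fixes p :: "'a::{alg_closed_field, field_char_0} poly"
  assumes "p \<noteq> 0" "\<And>x. poly p x = 0 \<Longrightarrow> poly (pderiv p) x \<noteq> 0"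
  shows "card {x. poly p x = 0} = degree p"
proof -
  obtain A where A: "size A = degree p" "p = smult (lead_coeff p) (\<Prod>x\<in>#A. [:-x, 1:])"
    using alg_closed_imp_factorization[OF assms(1)] by blast
  have roots: "{x. poly p x = 0} = set_mset A"
    using assms(1) by (subst A(2)) (auto simp: poly_prod_mset)
  have "count A x \<le> 1" for x
  proof (rule ccontr)
    assume "\<not> count A x \<le> 1"
    then obtain B where "A = add_mset x (add_mset x B)"
      by (metis Suc_le_eq One_nat_def count_add_mset count_greater_zero_iff multi_member_split
          nat_le_linear not_less_eq_eq not_in_iff)
    then have "p = [:-x, 1:] * ([:-x, 1:] * smult (lead_coeff p) (\<Prod>x\<in>#B. [:-x, 1:]))"
      using A(2) by simp
    then obtain q where q: "p = [:-x, 1:] * ([:-x, 1:] * q)" by blast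
    then have "poly p x = 0" by simp
    moreover have "poly (pderiv p) x = 0"
      unfolding q by (simp only: pderiv_mult poly_add poly_mult) simp
    ultimately show False using assms(2) by blast
  qed
  then have "mset_set (set_mset A) = A"
    by (intro multiset_eqI) (metis count_mset_set(1,3) finite_set_mset le_less_Suc_eq
        less_one not_in_iff One_nat_def linorder_not_less nat_less_le)
  then have "card (set_mset A) = size A"
    by (metis size_mset_set)
  then show ?thesis using roots A(1) by simp
qed

lemma card_unity_roots:
  assumes "n > 0"
  shows "card (unity_roots n :: 'a::{alg_closed_field, field_char_0} set) = n"
    and "finite (unity_roots n :: 'a set)"
proof -
  define p :: "'a poly" where "p = monom 1 n - 1"
  have deg: "degree p = n"
  proof (rule antisym)
    show "degree p \<le> n"
      unfolding p_def by (rule degree_diff_le) (auto simp: degree_monom_le)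
    show "n \<le> degree p"
      using assms by (intro le_degree) (simp add: p_def)
  qed
  have roots: "unity_roots n = {x. poly p x = 0}"
    by (auto simp: unity_roots_def p_def poly_monom)
  have "p \<noteq> 0" using deg assms by auto
  have "poly (pderiv p) x \<noteq> 0" if "poly p x = 0" for x
  proof -
    have "x \<noteq> 0" using that assms by (auto simp: p_def poly_monom power_0_left)
    then show ?thesis
      using assms by (simp add: p_def pderiv_diff pderiv_monom poly_monom)
  qed
  then show "card (unity_roots n :: 'a set) = n"
    unfolding roots using card_poly_roots_eq_degree[OF \<open>p \<noteq> 0\<close>] deg by blast
  show "finite (unity_roots n :: 'a set)"
    unfolding roots by (rule poly_roots_finite[OF \<open>p \<noteq> 0\<close>])
qed

lemma unity_roots_nonzero: "w \<in> unity_roots n \<Longrightarrow> n > 0 \<Longrightarrow> w \<noteq> 0"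
  by (auto simp: unity_roots_def power_0_left)

lemma unity_roots_mult: "u \<in> unity_roots n \<Longrightarrow> w \<in> unity_roots n \<Longrightarrow> u * w \<in> unity_roots n"
  by (simp add: unity_roots_def power_mult_distrib)

lemma unity_roots_divide: "u \<in> unity_roots n \<Longrightarrow> w \<in> unity_roots n \<Longrightarrow> u / w \<in> unity_roots n"
  by (simp add: unity_roots_def power_divide)

lemma power_int_mod:
  fixes w :: "'a::field"
  assumes "w ^ e = 1" "e > 0"
  shows "w powi i = w ^ nat (i mod int e)"
proof -
  have "w \<noteq> 0" using assms by (auto simp: power_0_left)
  have "w powi i = w powi (int e * (i div int e) + i mod int e)" by simp
  also have "\<dots> = (w powi int e) powi (i div int e) * w powi (i mod int e)"
    using \<open>w \<noteq> 0\<close> by (subst power_int_add) (auto simp: power_int_mult)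
  also have "\<dots> = w ^ nat (i mod int e)"
    using assms by (simp add: power_int_def)
  finally show ?thesis .
qed

lemma order_of_unity_root:
  fixes u :: "'a::field"
  assumes "u ^ p = 1" "p > 0"
  shows "\<exists>e>0. \<forall>i::int. u powi i = 1 \<longleftrightarrow> int e dvd i"
proof -
  define e where "e = (LEAST e. e > 0 \<and> u ^ e = 1)"
  have e: "e > 0" "u ^ e = 1"
    using LeastI[of "\<lambda>e. e > 0 \<and> u ^ e = 1" p] assms by (auto simp: e_def)
  have "u powi i = 1 \<longleftrightarrow> int e dvd i" for i
  proof -
    have "u ^ nat (i mod int e) = 1 \<longleftrightarrow> nat (i mod int e) = 0"
    proof (intro iffI)
      assume "u ^ nat (i mod int e) = 1"
      then have "\<not> nat (i mod int e) < e \<or> nat (i mod int e) = 0"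
        using not_less_Least[of "nat (i mod int e)" "\<lambda>e. e > 0 \<and> u ^ e = 1"] by (auto simp: e_def)
      then show "nat (i mod int e) = 0"
        using e pos_mod_bound[of "int e" i] by linarith
    qed simp
    moreover have "nat (i mod int e) = 0 \<longleftrightarrow> int e dvd i"
      using e pos_mod_sign[of "int e" i] by (auto simp: dvd_eq_mod_eq_0 intro!: antisym)
    ultimately show ?thesis
      by (simp add: power_int_mod[OF e(2,1)])
  qed
  with e show ?thesis by blast
qed

text \<open>The conjugates \<open>y(w\<^sup>k x\<^bsup>1/n\<^esup>)\<close> of a root \<open>y\<close> are the series \<open>twist (w ^ k) y\<close>.\<close>

definition twist :: "'a::field \<Rightarrow> 'a fls \<Rightarrow> 'a fls" where
  "twist w y = Abs_fls (\<lambda>i. w powi i * y $$ i)"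

lemma twist_nth [simp]: "twist w y $$ i = w powi i * y $$ i"
  unfolding twist_def by (rule nth_Abs_fls_lower_bound[of "fls_subdegree y"]) simp

lemma twist_twist: "w \<noteq> 0 \<Longrightarrow> u \<noteq> 0 \<Longrightarrow> twist w (twist u y) = twist (w * u) y"
  by (intro fls_eqI) (simp add: power_int_mult_distrib)

lemma twist_1 [simp]: "twist 1 y = y"
  by (intro fls_eqI) simp

lemma twist_diff: "twist w (y - z) = twist w y - twist w z"
  by (intro fls_eqI) (simp add: algebra_simps)

lemma twist_compose_power:
  assumes "q > 0"
  shows "twist u (fls_compose_power a q) = fls_compose_power (twist (u ^ q) a) q"
proof (rule fls_eqI)
  fix i
  show "twist u (fls_compose_power a q) $$ i = fls_compose_power (twist (u ^ q) a) q $$ i"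
  proof (cases "int q dvd i")
    case True
    then obtain k where "i = int q * k" by auto
    then show ?thesis
      using assms by (simp add: fls_nth_compose_power power_int_mult)
  qed (use assms in \<open>simp add: fls_nth_compose_power\<close>)
qed

lemma subdegree_twist:
  assumes "w \<noteq> 0"
  shows "fls_subdegree (twist w y) = fls_subdegree y"
proof (cases "y = 0")
  case True
  then have "twist w y = 0" by (intro fls_eqI) simp
  with True show ?thesis by simp
next
  case False
  then show ?thesis
    using assms by (intro fls_subdegree_eqI) auto
qed

lemma twist_hom:
  fixes w :: "'a::field"
  assumes "w \<noteq> 0"
  shows "field_coeff_hom (twist w)"
proof
  show "twist w (a + b) = twist w a + twist w b" for a b :: "'a fls"
    by (intro fls_eqI) (simp add: algebra_simps)
  show "twist w 1 = 1"
    by (intro fls_eqI) auto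
  show "twist w (a * b) = twist w a * twist w b" for a b :: "'a fls"
  proof (rule fls_eqI)
    fix n :: int
    have "(twist w a * twist w b) $$ n =
        (\<Sum>i=fls_subdegree a..n - fls_subdegree b. (w powi i * a $$ i) * (w powi (n - i) * b $$ (n - i)))"
      using assms by (simp add: fls_times_nth(2) subdegree_twist)
    also have "\<dots> = (\<Sum>i=fls_subdegree a..n - fls_subdegree b. w powi n * (a $$ i * b $$ (n - i)))"
    proof (rule sum.cong[OF refl])
      fix i
      have "w powi i * w powi (n - i) = w powi n"
        using assms by (simp flip: power_int_add)
      then show "(w powi i * a $$ i) * (w powi (n - i) * b $$ (n - i)) = w powi n * (a $$ i * b $$ (n - i))"
        by (metis mult.assoc mult.left_commute)
    qed
    also have "\<dots> = twist w (a * b) $$ n"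
      by (simp add: fls_times_nth(2) sum_distrib_left)
    finally show "twist w (a * b) $$ n = (twist w a * twist w b) $$ n" by simp
  qed
qed

text \<open>The coefficients of \<open>lift p F\<close> are series in \<open>t^p\<close>, which
  \<open>t -> w t\<close> fixes when \<open>w^p = 1\<close>.\<close>

lemma map_twist_lift:
  assumes "w \<in> unity_roots p" "p > 0"
  shows "map_poly (twist w) (lift p F) = lift p F"
proof (rule poly_eqI)
  interpret tw: field_coeff_hom "twist w"
    by (rule twist_hom[OF unity_roots_nonzero[OF assms]])
  fix i
  have "w ^ p = 1" using assms(1) by (simp add: unity_roots_def)
  then show "coeff (map_poly (twist w) (lift p F)) i = coeff (lift p F) i"
    using assms(2) by (simp add: coeff_lift twist_compose_power)
qed

lemma twist_puiseux_root:
  assumes "w \<in> unity_roots p" "p > 0" "y \<in> puiseux_roots p F"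
  shows "twist w y \<in> puiseux_roots p F"
proof -
  interpret tw: field_coeff_hom "twist w"
    by (rule twist_hom[OF unity_roots_nonzero[OF assms(1,2)]])
  have "poly (lift p F) (twist w y) = twist w (poly (lift p F) y)"
    using tw.poly_map_poly_hom[of "lift p F" y] by (simp add: map_twist_lift[OF assms(1,2)])
  then show ?thesis
    using assms(3) by (simp add: puiseux_roots_lift)
qed

lemma compose_power_ex:
  assumes "e > 0" "\<And>i. y $$ i \<noteq> 0 \<Longrightarrow> int e dvd i"
  shows "\<exists>z. y = fls_compose_power z e"
proof -
  \<comment> \<open>For \<open>k \<le> 0\<close> one has \<open>e * k \<le> k\<close>, so below
    \<open>N\<close> the index \<open>e * k\<close> lies under the order of \<open>y\<close>. The
    minimum with 0 makes this inequality available.\<close>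
  define N where "N = min 0 (fls_subdegree y)"
  have low: "y $$ (int e * k) = 0" if "k < N" for k
  proof -
    have "int e * k \<le> 1 * k"
      using assms(1) that by (intro mult_right_mono_neg) (auto simp: N_def)
    moreover have "k < fls_subdegree y" using that by (simp add: N_def)
    ultimately show ?thesis
      by (intro fls_eq0_below_subdegree) linarith
  qed
  define z where "z = Abs_fls (\<lambda>i. y $$ (int e * i))"
  have z: "z $$ i = y $$ (int e * i)" for i
    unfolding z_def by (rule nth_Abs_fls_lower_bound[of N]) (use low in auto)
  have "y = fls_compose_power z e"
    using assms by (intro fls_eqI) (auto simp: fls_nth_compose_power z)
  then show ?thesis ..
qed

text \<open>Galois descent to K((t^p)). If \<open>i\<close> is in the support, every p-th root of
  unity is a j-th root of unity for \<open>j = i mod p\<close>; since \<open>j < p\<close>, counting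
  leaves only \<open>j = 0\<close>.\<close>

lemma twist_invariant_imp_compose_power:
  fixes a :: "'a::{alg_closed_field, field_char_0} fls"
  assumes "p > 0" "\<And>w. w \<in> unity_roots p \<Longrightarrow> twist w a = a"
  shows "\<exists>b. a = fls_compose_power b p"
proof (rule compose_power_ex[OF assms(1)])
  fix i assume i: "a $$ i \<noteq> 0"
  define j where "j = nat (i mod int p)"
  have "w ^ j = 1" if "w \<in> unity_roots p" for w :: 'a
  proof -
    have "w powi i * a $$ i = a $$ i"
      using arg_cong[OF assms(2)[OF that], of "\<lambda>a. a $$ i"] by simp
    then have "w powi i = 1" using i by simp
    then show ?thesis
      using power_int_mod[of w p i] that assms(1) by (simp add: unity_roots_def j_def)
  qed
  then have "unity_roots p \<subseteq> (unity_roots j :: 'a set)"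
    by (auto simp: unity_roots_def)
  moreover have "j < p"
    using assms(1) pos_mod_bound[of "int p" i] pos_mod_sign[of "int p" i] unfolding j_def by linarith
  ultimately have "j = 0"
    using card_mono[of "unity_roots j :: 'a set" "unity_roots p"] card_unity_roots[of j, where 'a='a]
      card_unity_roots[of p, where 'a='a] assms(1) by (cases "j = 0") auto
  then show "int p dvd i"
    using assms(1) pos_mod_sign[of "int p" i]
    by (auto simp: j_def dvd_eq_mod_eq_0 intro!: antisym)
qed

lemma prod_linear_dvd:
  fixes p :: "'a::field poly"
  assumes "finite S" "\<And>x. x \<in> S \<Longrightarrow> poly p x = 0"
  shows "(\<Prod>x\<in>S. [:-x, 1:]) dvd p"
  using assms
proof (induction S arbitrary: p rule: finite_induct)
  case (insert x S)
  then obtain q where q: "p = [:-x, 1:] * q"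
    by (meson dvdE insertI1 poly_eq_0_iff_dvd)
  have "poly q z = 0" if "z \<in> S" for z
    using insert.prems[of z] insert.hyps(2) that by (auto simp: q)
  then have "(\<Prod>x\<in>S. [:-x, 1:]) dvd q" by (rule insert.IH)
  then show ?case
    unfolding q prod.insert[OF insert.hyps] by (rule mult_dvd_mono[OF dvd_refl])
qed simp

lemma lead_coeff_prod_linear:
  "lead_coeff (\<Prod>x\<in>S. [:- f x, 1 :: 'a::field:]) = 1"
  by (induction S rule: infinite_finite_induct) (auto simp: lead_coeff_mult simp del: mult_pCons_left)

lemma degree_prod_linear:
  "degree (\<Prod>x\<in>S. [:- f x, 1 :: 'a::field:]) = card S"
proof (induction S rule: infinite_finite_induct)
  case (insert x S)
  have "(\<Prod>x\<in>S. [:- f x, 1 :: 'a:]) \<noteq> 0"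
    using lead_coeff_prod_linear[of f S] by auto
  then show ?case
    using insert by (simp add: degree_mult_eq del: mult_pCons_left)
qed auto

text \<open>
  For the least \<open>p\<close> such that \<open>F\<close> has a root \<open>y\<close> in \<open>K((x\<^bsup>1/p\<^esup>))\<close> the conjugates of \<open>y\<close> are
  distinct, so their product descends to a factor of \<open>F\<close> of degree \<open>p\<close>.
\<close>

theorem irreducible_factorization:
  fixes F :: "'a::{alg_closed_field, field_char_0} fls poly"
  assumes irr: "irreducible F" and monic: "lead_coeff F = 1"
  shows "\<exists>y. lift (degree F) F = (\<Prod>w\<in>unity_roots (degree F). [:- twist w y, 1:])
           \<and> inj_on (\<lambda>w. twist w y) (unity_roots (degree F))"
proof -
  have "degree F > 0"
    using irr is_unit_iff_degree[of F] by (cases "F = 0") (auto simp: irreducible_def)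
  define Q where "Q = (\<lambda>p. p > 0 \<and> puiseux_roots p F \<noteq> {})"
  define p where "p = (LEAST p. Q p)"
  have "Q p"
    using newton_puiseux[OF \<open>degree F > 0\<close>] LeastI_ex[of Q] unfolding has_puiseux_root_def Q_def p_def
    by blast
  then obtain y where p: "p > 0" and y: "y \<in> puiseux_roots p F"
    by (auto simp: Q_def)
  \<comment> \<open>Two equal conjugates would make \<open>y\<close> a series in \<open>t^e\<close>,
    where \<open>e > 1\<close> is the order of \<open>w / w'\<close> and divides \<open>p\<close>.
    Then \<open>F\<close> would have a root for the index \<open>p / e\<close>, against
    minimality.\<close>
  have inj: "inj_on (\<lambda>w. twist w y) (unity_roots p)"
  proof (rule inj_onI, rule ccontr)
    fix w w' assume w: "w \<in> unity_roots p" "w' \<in> unity_roots p" "twist w y = twist w' y" "w \<noteq> w'"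
    define u where "u = w / w'"
    have nz: "w \<noteq> 0" "w' \<noteq> 0"
      using w unity_roots_nonzero p by blast+
    have "u ^ p = 1" "u \<noteq> 1"
      using unity_roots_divide[OF w(1,2)] w nz by (auto simp: u_def unity_roots_def)
    obtain e where e: "e > 0" "\<And>i::int. u powi i = 1 \<longleftrightarrow> int e dvd i"
      using order_of_unity_root[OF \<open>u ^ p = 1\<close> p] by blast
    have "e \<noteq> 1" using e(2)[of 1] \<open>u \<noteq> 1\<close> by auto
    have "e dvd p" using e(2)[of "int p"] \<open>u ^ p = 1\<close> by simp
    then obtain q where q: "p = q * e" by (metis dvd_def mult.commute)
    have "int e dvd i" if "y $$ i \<noteq> 0" for i
    proof -
      have "w powi i * y $$ i = w' powi i * y $$ i"
        using arg_cong[OF w(3), of "\<lambda>a. a $$ i"] by simp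
      then have "w powi i = w' powi i" using that by simp
      then have "u powi i = 1"
        using nz by (simp add: u_def power_int_divide_distrib)
      then show ?thesis using e by simp
    qed
    then obtain z where z: "y = fls_compose_power z e"
      using compose_power_ex[OF e(1)] by blast
    have "q > 0" using p q by auto
    have "poly (lift e (lift q F)) (fls_compose_power z e) = 0"
      using y e(1) \<open>q > 0\<close> by (simp add: puiseux_roots_lift q z lift_lift)
    then have "fls_compose_power (poly (lift q F) z) e = fls_compose_power 0 e"
      using e(1) by (simp add: poly_lift)
    then have "poly (lift q F) z = 0"
      using compose_power_eq_iff[OF e(1)] by blast
    then have "Q q"
      using \<open>q > 0\<close> by (auto simp: Q_def puiseux_roots_lift)
    moreover have "q < p"
      using q e(1) \<open>e \<noteq> 1\<close> \<open>q > 0\<close> by simp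
    ultimately show False
      using not_less_Least[of q Q] by (simp add: p_def)
  qed
  define Pi where "Pi = (\<Prod>w\<in>unity_roots p. [:- twist w y, 1:])"
  \<comment> \<open>Multiplication by \<open>u\<close> permutes the conjugates, so their product is
    fixed and its coefficients descend to K((x)).\<close>
  have inv: "twist u (coeff Pi i) = coeff Pi i" if u: "u \<in> unity_roots p" for u i
  proof -
    have "u \<noteq> 0" using unity_roots_nonzero[OF u p] .
    interpret tw: field_coeff_hom "twist u"
      by (rule twist_hom[OF \<open>u \<noteq> 0\<close>])
    have "map_poly (twist u) Pi = (\<Prod>w\<in>unity_roots p. [:- twist (u * w) y, 1:])"
      unfolding Pi_def tw.map_poly_prod_hom tw.map_poly_linear_hom
      by (intro prod.cong) (auto simp: twist_twist \<open>u \<noteq> 0\<close> unity_roots_nonzero[OF _ p])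
    also have "\<dots> = Pi"
      unfolding Pi_def
      by (rule prod.reindex_bij_witness[of _ "\<lambda>w. w / u" "\<lambda>w. u * w"])
        (use u \<open>u \<noteq> 0\<close> in \<open>auto intro: unity_roots_mult unity_roots_divide\<close>)
    finally show ?thesis
      by (metis tw.coeff_map_hom)
  qed
  have "\<forall>i. \<exists>b. coeff Pi i = fls_compose_power b p"
    using twist_invariant_imp_compose_power[OF p inv] by blast
  then obtain b where b: "\<And>i. coeff Pi i = fls_compose_power (b i) p" by metis
  define G where "G = (\<Sum>i\<le>degree Pi. monom (b i) i)"
  have "lift p G = Pi"
  proof (rule poly_eqI)
    fix i
    have "coeff G i = (if i \<le> degree Pi then b i else 0)"
      by (auto simp: G_def coeff_sum if_distrib if_distribR cong: if_cong)
    then show "coeff (lift p G) i = coeff Pi i"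
      using p b[of i] by (auto simp: coeff_lift coeff_eq_0)
  qed
  have deg_Pi: "degree Pi = p"
    using card_unity_roots[OF p, where 'a='a] by (simp add: Pi_def degree_prod_linear)
  have deg_G: "degree G = p"
    using \<open>lift p G = Pi\<close> deg_Pi degree_lift[OF p, of G] by simp
  have Pi_dvd: "Pi dvd lift p F"
  proof -
    have "Pi = (\<Prod>z\<in>(\<lambda>w. twist w y) ` unity_roots p. [:- z, 1:])"
      unfolding Pi_def by (simp add: prod.reindex[OF inj])
    moreover have "\<dots> dvd lift p F"
      using twist_puiseux_root[OF _ p y] card_unity_roots[OF p, where 'a='a]
      by (intro prod_linear_dvd) (auto simp: puiseux_roots_lift)
    ultimately show ?thesis by simp
  qed
  \<comment> \<open>The division takes place over K((x)) and is then lifted: \<open>Pi\<close>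
    divides the lifted remainder, whose degree is smaller if it is nonzero, so the remainder
    vanishes.\<close>
  have "lift p F = Pi * lift p (F div G) + lift p (F mod G)"
    using p by (simp flip: \<open>lift p G = Pi\<close> lift_mult lift_add)
  then have "Pi dvd lift p (F mod G)"
    using Pi_dvd by (metis dvd_add_right_iff dvd_triv_left)
  moreover have "G \<noteq> 0" using deg_G p by auto
  ultimately have "F mod G = 0"
    using degree_mod_less[OF \<open>G \<noteq> 0\<close>, of F] dvd_imp_degree_le[of Pi "lift p (F mod G)"] p deg_G deg_Pi
    by fastforce
  then obtain c where c: "F = G * c" by (metis dvdE mod_eq_0_iff_dvd)
  have "\<not> G dvd 1"
    using deg_G p by (simp add: is_unit_iff_degree \<open>G \<noteq> 0\<close>)
  then have "c dvd 1"
    using irreducibleD[OF irr c] by blast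
  then obtain d where d: "c = [:d:]" by (auto elim: is_unit_polyE)
  have "fls_compose_power (lead_coeff G) p = fls_compose_power 1 p"
  proof -
    have "coeff (lift p G) (degree G) = 1"
      using lead_coeff_prod_linear[of "\<lambda>w. twist w y" "unity_roots p"] \<open>lift p G = Pi\<close> deg_G deg_Pi
      by (simp add: Pi_def)
    then show ?thesis using p by (simp add: coeff_lift)
  qed
  then have "lead_coeff G = 1"
    using compose_power_eq_iff[OF p] by blast
  then have "d = 1"
    using monic lead_coeff_mult[of G c] by (simp add: c[symmetric]) (simp add: d)
  then have "F = G" by (simp add: c d)
  then show ?thesis
    using \<open>lift p G = Pi\<close> inj deg_G by (auto simp: Pi_def)
qed

lemma degree_irreducible_pos:
  fixes F :: "'a::field poly"
  assumes "irreducible F"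
  shows "degree F > 0"
  using assms is_unit_iff_degree[of F] by (cases "F = 0") (auto simp: irreducible_def)

text \<open>The full factorization at index \<open>degree F\<close> is carried along by
  \<open>t -> t^q\<close>, so at a multiple of that index no new roots appear and they stay
  simple.\<close>

lemma
  fixes F :: "'a::{alg_closed_field, field_char_0} fls poly"
  assumes "irreducible F" "lead_coeff F = 1"
  shows irreducible_roots_twist: "\<exists>y. puiseux_roots (degree F) F = (\<lambda>w. twist w y) ` unity_roots (degree F)
      \<and> inj_on (\<lambda>w. twist w y) (unity_roots (degree F))"
    and irreducible_roots_scale: "\<And>q. q > 0 \<Longrightarrow>
      puiseux_roots (degree F * q) F = (\<lambda>a. fls_compose_power a q) ` puiseux_roots (degree F) F"
    and irreducible_lift_eq: "\<And>q. q > 0 \<Longrightarrow>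
      lift (degree F * q) F = (\<Prod>z\<in>puiseux_roots (degree F * q) F. [:- z, 1:])"
proof -
  obtain y where y: "lift (degree F) F = (\<Prod>w\<in>unity_roots (degree F). [:- twist w y, 1:])"
    and inj: "inj_on (\<lambda>w. twist w y) (unity_roots (degree F))"
    using irreducible_factorization[OF assms] by blast
  have n: "degree F > 0" using degree_irreducible_pos[OF assms(1)] .
  note fin = card_unity_roots(2)[OF n, where 'a='a]
  have fact: "lift (degree F * q) F =
      (\<Prod>w\<in>unity_roots (degree F). [:- fls_compose_power (twist w y) q, 1:])" if "q > 0" for q
  proof -
    have "lift (degree F * q) F = lift q (lift (degree F) F)"
      using n that by (simp add: lift_lift)
    then show ?thesis
      by (simp only: y lift_prod[OF that] lift_linear[OF that])
  qed
  have roots: "puiseux_roots (degree F) F = (\<lambda>w. twist w y) ` unity_roots (degree F)"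
    using fin by (auto simp: puiseux_roots_lift y poly_prod)
  have roots': "puiseux_roots (degree F * q) F = (\<lambda>a. fls_compose_power a q) ` puiseux_roots (degree F) F"
    if "q > 0" for q
    unfolding roots using fin by (auto simp: puiseux_roots_lift fact[OF that] poly_prod)
  have "lift (degree F * q) F = (\<Prod>z\<in>puiseux_roots (degree F * q) F. [:- z, 1:])" if "q > 0" for q
  proof -
    have "inj_on (\<lambda>w. fls_compose_power (twist w y) q) (unity_roots (degree F))"
      using inj by (auto simp: inj_on_def compose_power_eq_iff[OF that])
    then show ?thesis
      unfolding roots'[OF that] roots image_image fact[OF that] by (simp add: prod.reindex)
  qed
  then show "\<And>q. q > 0 \<Longrightarrow>
      lift (degree F * q) F = (\<Prod>z\<in>puiseux_roots (degree F * q) F. [:- z, 1:])" .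
  show "\<And>q. q > 0 \<Longrightarrow>
      puiseux_roots (degree F * q) F = (\<lambda>a. fls_compose_power a q) ` puiseux_roots (degree F) F"
    by (rule roots')
  show "\<exists>y. puiseux_roots (degree F) F = (\<lambda>w. twist w y) ` unity_roots (degree F)
      \<and> inj_on (\<lambda>w. twist w y) (unity_roots (degree F))"
    using roots inj by blast
qed

section \<open>Roots of a component at a common index\<close>

context
  fixes F :: "'a::{alg_closed_field, field_char_0} fls poly" and p :: nat
  assumes irr: "irreducible F" and monic: "lead_coeff F = 1"
    and p: "p > 0" and dvd: "degree F dvd p"
begin

lemma lift_eq_prod_roots: "lift p F = (\<Prod>z\<in>puiseux_roots p F. [:- z, 1:])"
proof -
  obtain q where "p = degree F * q" using dvd by auto
  then have "q > 0" using p by simp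
  from irreducible_lift_eq[OF irr monic this] show ?thesis
    by (simp add: \<open>p = _\<close>)
qed

lemma card_roots: "card (puiseux_roots p F) = degree F"
  using degree_prod_linear[of "\<lambda>z. z" "puiseux_roots p F"] p
  by (simp flip: lift_eq_prod_roots)

lemma finite_roots: "finite (puiseux_roots p F)"
  using card_roots degree_irreducible_pos[OF irr] by (metis card.infinite less_irrefl)

lemma roots_nonempty: "puiseux_roots p F \<noteq> {}"
  using card_roots degree_irreducible_pos[OF irr] by force

lemma roots_scale:
  assumes "q > 0"
  shows "puiseux_roots (p * q) F = (\<lambda>a. fls_compose_power a q) ` puiseux_roots p F"
proof -
  obtain r where r: "p = degree F * r" using dvd by auto
  then have "r > 0" using p by simp
  show ?thesis
    using irreducible_roots_scale[OF irr monic, of r] irreducible_roots_scale[OF irr monic, of "r * q"] \<open>r > 0\<close> assms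
    by (simp add: r image_image compose_power_compose_power mult.assoc)
qed

text \<open>At index \<open>p = n * q\<close> the roots are series in \<open>t^q\<close>, on which a
  twist by \<open>u\<close> acts through \<open>u^q\<close>. The n-th root of unity
  \<open>w / v\<close> linking two roots is therefore realised by any q-th root \<open>u\<close> of
  it, and \<open>u^p = 1\<close>.\<close>

lemma roots_transitive:
  assumes "y \<in> puiseux_roots p F" "z \<in> puiseux_roots p F"
  shows "\<exists>u\<in>unity_roots p. z = twist u y"
proof -
  define n where "n = degree F"
  have n: "n > 0" using degree_irreducible_pos[OF irr] by (simp add: n_def)
  obtain q where q: "p = n * q" using dvd by (auto simp: n_def)
  then have "q > 0" using p by simp
  obtain x where x: "puiseux_roots n F = (\<lambda>w. twist w x) ` unity_roots n"
    using irreducible_roots_twist[OF irr monic] unfolding n_def by blast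
  moreover have "puiseux_roots (n * q) F = (\<lambda>a. fls_compose_power a q) ` puiseux_roots n F"
    using irreducible_roots_scale[OF irr monic \<open>q > 0\<close>] by (simp add: n_def)
  ultimately obtain v w where v: "v \<in> unity_roots n" "y = fls_compose_power (twist v x) q"
    and w: "w \<in> unity_roots n" "z = fls_compose_power (twist w x) q"
    using assms by (auto simp: q)
  have nz: "v \<noteq> 0" "w \<noteq> 0" using v w n unity_roots_nonzero by blast+
  obtain u where u: "u ^ q = w / v" using nth_root_exists[OF \<open>q > 0\<close>] by blast
  have "u ^ p = (u ^ q) ^ n" by (simp add: q power_mult mult.commute[of n])
  then have "u \<in> unity_roots p"
    using unity_roots_divide[OF w(1) v(1)] by (simp add: unity_roots_def u)
  moreover have "twist u y = z"
    using nz by (simp add: v w twist_compose_power \<open>q > 0\<close> u twist_twist)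
  ultimately show ?thesis by blast
qed

end

text \<open>The orbit of a shared root is the whole root set of both polynomials, and each lifted
  polynomial is the product over its simple roots.\<close>

lemma common_root_imp_eq:
  fixes F G :: "'a::{alg_closed_field, field_char_0} fls poly"
  assumes F: "irreducible F" "lead_coeff F = 1" "degree F dvd p"
    and G: "irreducible G" "lead_coeff G = 1" "degree G dvd p"
    and p: "p > 0" and y: "y \<in> puiseux_roots p F" "y \<in> puiseux_roots p G"
  shows "F = G"
proof -
  have "puiseux_roots p F = puiseux_roots p G"
    using roots_transitive[OF F(1,2) p F(3) y(1)] roots_transitive[OF G(1,2) p G(3) y(2)]
      twist_puiseux_root[OF _ p y(1)] twist_puiseux_root[OF _ p y(2)] by blast
  then have "lift p F = lift p G"
    using lift_eq_prod_roots[OF F(1,2) p F(3)] lift_eq_prod_roots[OF G(1,2) p G(3)] by simp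
  then show ?thesis using lift_eq_iff[OF p] by blast
qed

section \<open>Factorization into components\<close>

lemma monic_irreducible_factorization:
  fixes F :: "'b::field poly"
  assumes "lead_coeff F = 1"
  shows "\<exists>A. F = prod_mset A \<and> (\<forall>G\<in>#A. irreducible G \<and> lead_coeff G = 1)"
  using assms
proof (induction "degree F" arbitrary: F rule: less_induct)
  case less
  consider "degree F = 0" | "irreducible F" | "degree F > 0" "\<not> irreducible F" by blast
  then show ?case
  proof cases
    case 1
    then obtain c where "F = [:c:]" by (rule degree_eq_zeroE)
    then have "F = 1" using less.prems by (simp add: one_pCons)
    then show ?thesis by (intro exI[of _ "{#}"]) auto
  next
    case 2
    then show ?thesis using less.prems by (intro exI[of _ "{#F#}"]) auto
  next
    case 3
    then have "F \<noteq> 0" by auto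
    with 3 have "\<not> F dvd 1"
      by (simp add: is_unit_iff_degree)
    then obtain a b where ab: "F = a * b" "\<not> a dvd 1" "\<not> b dvd 1"
      using 3 \<open>F \<noteq> 0\<close> by (auto simp: irreducible_def)
    have nz: "a \<noteq> 0" "b \<noteq> 0" using ab \<open>F \<noteq> 0\<close> by auto
    then have deg: "degree a > 0" "degree b > 0"
      using ab(2,3) is_unit_iff_degree by blast+
    define a' where "a' = smult (inverse (lead_coeff a)) a"
    define b' where "b' = smult (inverse (lead_coeff b)) b"
    have lcab: "lead_coeff a * lead_coeff b = 1"
      using less.prems by (simp add: ab(1) lead_coeff_mult)
    have "F = a' * b'"
      using lcab by (simp add: a'_def b'_def ab(1) mult.commute flip: inverse_mult_distrib)
    have "degree a' < degree F" "degree b' < degree F"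
      using deg nz by (simp_all add: a'_def b'_def ab(1) degree_mult_eq)
    moreover have "lead_coeff a' = 1" "lead_coeff b' = 1"
      using nz by (simp_all add: a'_def b'_def)
    ultimately obtain A B
      where "a' = prod_mset A" "\<forall>G\<in>#A. irreducible G \<and> lead_coeff G = 1"
        and "b' = prod_mset B" "\<forall>G\<in>#B. irreducible G \<and> lead_coeff G = 1"
      using less.hyps[of a'] less.hyps[of b'] by blast
    then show ?thesis
      using \<open>F = a' * b'\<close> by (intro exI[of _ "A + B"]) auto
  qed
qed

lemma monic_irreducible_dvd_imp_eq:
  fixes F G :: "'b::field poly"
  assumes "irreducible F" "irreducible G" "lead_coeff F = 1" "lead_coeff G = 1" "F dvd G"
  shows "F = G"
proof -
  obtain c where c: "G = F * c" using assms(5) by (elim dvdE)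
  have "\<not> F dvd 1" using assms(1) by (simp add: irreducible_def)
  then have "c dvd 1" using irreducibleD[OF assms(2) c] by blast
  then obtain d where "c = [:d:]" by (auto elim: is_unit_polyE)
  moreover have "lead_coeff c = 1"
    using assms(3,4) lead_coeff_mult[of F c] by (simp add: c[symmetric])
  ultimately show ?thesis by (simp add: c)
qed

lemma irreducible_dvd_prod_mset:
  fixes G :: "'b::field poly"
  assumes "irreducible G" "lead_coeff G = 1" "G dvd prod_mset B"
    and "\<And>x. x \<in># B \<Longrightarrow> irreducible x \<and> lead_coeff x = 1"
  shows "G \<in># B"
  using assms(3,4)
proof (induction B)
  case empty
  with assms(1) show ?case by (simp add: irreducible_def)
next
  case (add x B)
  have "prime_elem G" using field_poly_irreducible_imp_prime[OF assms(1)] .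
  then consider "G dvd x" | "G dvd prod_mset B"
    using add.prems(1) by (auto simp: prime_elem_dvd_mult_iff)
  then show ?case
  proof cases
    case 1
    then show ?thesis
      using monic_irreducible_dvd_imp_eq[of G x] add.prems(2)[of x] assms(1,2) by simp
  next
    case 2
    then show ?thesis using add.IH add.prems(2) by simp
  qed
qed

definition mult_of :: "'a::field fls poly \<Rightarrow> 'a fls poly \<Rightarrow> nat" where
  "mult_of G H = Max {n. G ^ n dvd H}"

lemma Q_part_altdef:
  "Q_part H M P = (\<Prod>G \<in> {G \<in> components H. \<forall>F \<in> P. contact G F = M}. G ^ mult_of G H)"
  by (simp add: Q_part_def mult_of_def)

lemma componentsD:
  assumes "G \<in> components H"
  shows "irreducible G" "lead_coeff G = 1" "G dvd H"
  using assms by (auto simp: components_def)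

context
  fixes H :: "'a::field fls poly" and A :: "'a fls poly multiset"
  assumes H: "H = smult (lead_coeff H) (prod_mset A)" "H \<noteq> 0"
    and A: "\<And>G. G \<in># A \<Longrightarrow> irreducible G \<and> lead_coeff G = 1"
begin

lemma dvd_H_iff: "G dvd H \<longleftrightarrow> G dvd prod_mset A"
  by (subst H(1)) (use H(2) in \<open>auto simp: dvd_smult_iff\<close>)

lemma components_eq_set_mset: "components H = set_mset A"
proof (intro equalityI subsetI)
  fix G assume "G \<in> components H"
  then show "G \<in># A"
    using irreducible_dvd_prod_mset[of G A] A by (auto simp: components_def dvd_H_iff)
next
  fix G assume "G \<in># A"
  then show "G \<in> components H"
    using A[of G] by (auto simp: components_def dvd_H_iff intro: dvd_prod_mset)
qed

lemma power_dvd_iff_count: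
  assumes "G \<in># A"
  shows "G ^ n dvd H \<longleftrightarrow> n \<le> count A G"
proof -
  define k where "k = count A G"
  define B where "B = A - replicate_mset k G"
  have AB: "A = replicate_mset k G + B"
    unfolding B_def k_def by (simp add: count_le_replicate_mset_subset_eq[symmetric] subset_mset.add_diff_inverse)
  then have "count B G = 0"
    by (metis add_cancel_right_right count_replicate_mset count_union k_def)
  have G: "irreducible G" "lead_coeff G = 1" "G \<noteq> 0" using A[OF assms] by auto
  have prod: "prod_mset A = G ^ k * prod_mset B"
    by (simp add: AB)
  show ?thesis
  proof
    assume "n \<le> count A G"
    then have "G ^ n dvd G ^ k" by (simp add: k_def le_imp_power_dvd)
    then show "G ^ n dvd H" by (simp add: dvd_H_iff prod)
  next
    assume dvd: "G ^ n dvd H"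
    show "n \<le> count A G"
    proof (rule ccontr)
      assume "\<not> n \<le> count A G"
      then have "G ^ Suc k dvd G ^ n" by (intro le_imp_power_dvd) (simp add: k_def)
      then have "G ^ k * G dvd G ^ k * prod_mset B"
        using dvd by (metis dvd_H_iff dvd_trans power_Suc2 prod)
      then have "G dvd prod_mset B" using G(3) by simp
      then have "G \<in># B"
        using A AB by (intro irreducible_dvd_prod_mset[OF G(1,2)]) auto
      with \<open>count B G = 0\<close> show False by (metis count_eq_zero_iff)
    qed
  qed
qed

lemma mult_of_eq_count:
  assumes "G \<in># A"
  shows "mult_of G H = count A G"
proof -
  have "{n. G ^ n dvd H} = {..count A G}"
    using power_dvd_iff_count[OF assms] by auto
  then show ?thesis by (auto simp: mult_of_def intro!: Max_eqI)
qed

end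

text \<open>The leading coefficient stays in front because the formula is also applied to
  \<open>pderiv f\<close>, which in general is not monic.\<close>

lemma components_factorization:
  fixes H :: "'a::field fls poly"
  assumes "H \<noteq> 0"
  shows "finite (components H)"
    and "H = smult (lead_coeff H) (\<Prod>G\<in>components H. G ^ mult_of G H)"
proof -
  define H' where "H' = smult (inverse (lead_coeff H)) H"
  have "lead_coeff H' = 1" using assms by (simp add: H'_def)
  then obtain A where A: "H' = prod_mset A" "\<And>G. G \<in># A \<Longrightarrow> irreducible G \<and> lead_coeff G = 1"
    using monic_irreducible_factorization[of H'] by blast
  have HA: "H = smult (lead_coeff H) (prod_mset A)"
    using assms by (simp flip: A(1) add: H'_def)
  note eq = components_eq_set_mset[OF HA assms A(2)] mult_of_eq_count[OF HA assms A(2)]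
  show "finite (components H)" by (simp add: eq(1))
  have "prod_mset A = (\<Prod>G\<in>components H. G ^ mult_of G H)"
    by (subst prod_mset_multiplicity) (auto simp: eq intro!: prod.cong)
  then show "H = smult (lead_coeff H) (\<Prod>G\<in>components H. G ^ mult_of G H)"
    using HA by simp
qed

lemma degree_component_le:
  assumes "G \<in> components H" "H \<noteq> 0"
  shows "degree G \<le> degree H"
  using dvd_imp_degree_le[OF componentsD(3)[OF assms(1)] assms(2)] .

lemma mult_of_squarefree:
  fixes f :: "'a::field fls poly"
  assumes "squarefree f" "G \<in> components f"
  shows "mult_of G f = 1"
proof -
  have "\<not> G dvd 1" "G dvd f"
    using assms(2) by (auto simp: components_def irreducible_def)
  have "n \<le> 1" if "G ^ n dvd f" for n
  proof (rule ccontr)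
    assume "\<not> n \<le> 1"
    then have "G ^ 2 dvd f" using that by (metis le_imp_power_dvd dvd_trans not_less_eq_eq One_nat_def numeral_2_eq_2)
    then show False using assms(1) \<open>\<not> G dvd 1\<close> by (auto simp: squarefree_def)
  qed
  then have "{n. G ^ n dvd f} = {0, 1}"
    using \<open>G dvd f\<close> by (force simp: le_Suc_eq)
  then show ?thesis by (simp add: mult_of_def)
qed

section \<open>Non-archimedean Rolle theorem\<close>

lemma fls_nth_sum: "(\<Sum>x\<in>A. f x) $$ i = (\<Sum>x\<in>A. f x $$ i)"
  by (induction A rule: infinite_finite_induct) auto

lemma fls_times_nth_low:
  fixes a b :: "'a::field fls"
  assumes "\<And>j. j < s \<Longrightarrow> a $$ j = 0" "\<And>j. j < s' \<Longrightarrow> b $$ j = 0" "j \<le> s + s'"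
  shows "(a * b) $$ j = (if j = s + s' then a $$ s * b $$ s' else 0)"
proof -
  have a: "fls_shift s a = fps_to_fls (fls_regpart (fls_shift s a))"
    using assms(1) by (intro fls_eqI) auto
  have b: "fls_shift s' b = fps_to_fls (fls_regpart (fls_shift s' b))"
    using assms(2) by (intro fls_eqI) auto
  have "fls_shift (s + s') (a * b) = fls_shift s a * fls_shift s' b"
    by (simp add: fls_times_both_shifted_simp)
  also have "\<dots> = fps_to_fls (fls_regpart (fls_shift s a) * fls_regpart (fls_shift s' b))"
    by (subst a, subst b) (simp add: fls_times_fps_to_fls)
  finally have "fls_shift (s + s') (a * b) $$ (j - (s + s')) =
    fps_to_fls (fls_regpart (fls_shift s a) * fls_regpart (fls_shift s' b)) $$ (j - (s + s'))" by simp
  then show ?thesis using assms(3) by auto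
qed

definition integral_at :: "int \<Rightarrow> 'a::field fls poly \<Rightarrow> bool" where
  "integral_at s g \<longleftrightarrow> (\<forall>i j. j < s \<longrightarrow> coeff g i $$ j = 0)"

definition residue_poly :: "int \<Rightarrow> 'a::field fls poly \<Rightarrow> 'a poly" where
  "residue_poly s g = map_poly (\<lambda>a. a $$ s) g"

lemma coeff_residue_poly [simp]: "coeff (residue_poly s g) i = coeff g i $$ s"
  by (simp add: residue_poly_def coeff_map_poly)

text \<open>
  If the coefficient series of \<open>g\<close> have minimal order \<open>s\<close>, the number of roots of \<open>g\<close> of
  nonnegative order is the degree of the residue class of \<open>t\<^bsup>-s\<^esup> g\<close>; that degree is additive on
  products and, in characteristic 0, drops by one under differentiation.
\<close>

definition residual_degree :: "'a::field fls poly \<Rightarrow> nat \<Rightarrow> bool" where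
  "residual_degree g k \<longleftrightarrow>
     (\<exists>s. integral_at s g \<and> residue_poly s g \<noteq> 0 \<and> degree (residue_poly s g) = k)"

lemma residual_degree_unique:
  assumes "residual_degree g k" "residual_degree g l"
  shows "k = l"
proof -
  from assms obtain s s' where s: "integral_at s g" "residue_poly s g \<noteq> 0" "degree (residue_poly s g) = k"
    and s': "integral_at s' g" "residue_poly s' g \<noteq> 0" "degree (residue_poly s' g) = l"
    by (auto simp: residual_degree_def)
  have "\<not> s < s'" "\<not> s' < s"
    using s(1,2) s'(1,2) by (auto simp: integral_at_def poly_eq_iff)
  with s s' show ?thesis by (simp add: antisym_conv3)
qed

text \<open>Gauss's lemma: minimal orders add, and the reductions multiply to a nonzero polynomial
  because K[y] is a domain.\<close>

lemma residual_degree_mult: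
  assumes "residual_degree g k" "residual_degree h l"
  shows "residual_degree (g * h) (k + l)"
proof -
  from assms obtain s s' where s: "integral_at s g" "residue_poly s g \<noteq> 0" "degree (residue_poly s g) = k"
    and s': "integral_at s' h" "residue_poly s' h \<noteq> 0" "degree (residue_poly s' h) = l"
    by (auto simp: residual_degree_def)
  have coeff: "coeff (g * h) i $$ j =
      (if j = s + s' then coeff (residue_poly s g * residue_poly s' h) i else 0)"
    if "j \<le> s + s'" for i j
  proof -
    have "(coeff g m * coeff h (i - m)) $$ j =
        (if j = s + s' then coeff g m $$ s * coeff h (i - m) $$ s' else 0)" for m
      using s(1) s'(1) that by (intro fls_times_nth_low) (auto simp: integral_at_def)
    then show ?thesis
      by (simp add: coeff_mult fls_nth_sum)
  qed
  then have "residue_poly (s + s') (g * h) = residue_poly s g * residue_poly s' h"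
    by (intro poly_eqI) simp
  moreover have "integral_at (s + s') (g * h)"
    using coeff by (auto simp: integral_at_def)
  ultimately show ?thesis
    using s s' unfolding residual_degree_def by (intro exI[of _ "s + s'"]) (simp add: degree_mult_eq)
qed

lemma residual_degree_const:
  assumes "c \<noteq> 0"
  shows "residual_degree [:c:] 0"
proof -
  have "residue_poly (fls_subdegree c) [:c:] = [:c $$ fls_subdegree c:]"
    by (intro poly_eqI) (simp add: coeff_pCons split: nat.splits)
  then show ?thesis
    using assms unfolding residual_degree_def
    by (intro exI[of _ "fls_subdegree c"]) (auto simp: integral_at_def coeff_pCons split: nat.splits)
qed

lemma residual_degree_1: "residual_degree 1 0"
  using residual_degree_const[of 1] by (simp add: one_pCons)

lemma residual_degree_prod:
  assumes "finite A" "\<And>x. x \<in> A \<Longrightarrow> residual_degree (g x) (k x)"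
  shows "residual_degree (\<Prod>x\<in>A. g x) (\<Sum>x\<in>A. k x)"
  using assms by (induction A rule: finite_induct) (auto intro: residual_degree_1 residual_degree_mult)

lemma residual_degree_power:
  assumes "residual_degree g k"
  shows "residual_degree (g ^ n) (n * k)"
  using assms by (induction n) (auto intro: residual_degree_1 residual_degree_mult)

text \<open>Reduction commutes with differentiation. Positivity of the degree matters: the
  derivative of a constant reduction is zero, and then \<open>s\<close> is no longer the minimal
  order.\<close>

lemma residual_degree_pderiv:
  fixes g :: "'a::field_char_0 fls poly"
  assumes "residual_degree g (Suc k)"
  shows "residual_degree (pderiv g) k"
proof -
  from assms obtain s where s: "integral_at s g" "degree (residue_poly s g) = Suc k"
    by (auto simp: residual_degree_def)
  have "fls_nth (of_nat m * a) j = of_nat m * a $$ j" for m j and a :: "'a fls"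
    by (rule fls_mult_of_nat_nth)
  then have coeff: "coeff (pderiv g) i $$ j = of_nat (Suc i) * coeff g (Suc i) $$ j" for i j
    by (simp add: coeff_pderiv del: of_nat_Suc)
  then have "residue_poly s (pderiv g) = pderiv (residue_poly s g)"
    by (intro poly_eqI) (simp add: coeff_pderiv)
  moreover have "integral_at s (pderiv g)"
    using s(1) by (auto simp: integral_at_def coeff)
  moreover have "degree (pderiv (residue_poly s g)) = k"
    using s(2) by (simp add: degree_pderiv)
  moreover have "pderiv (residue_poly s g) \<noteq> 0"
    using s(2) by (simp add: pderiv_eq_0_iff)
  ultimately show ?thesis
    unfolding residual_degree_def by auto
qed

section \<open>Balls and the number of roots inside\<close>

definition ball_int :: "'a::field fls \<Rightarrow> int \<Rightarrow> 'a fls set" where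
  "ball_int b r = {z. \<forall>i<r. z $$ i = b $$ i}"

text \<open>The substitution \<open>y = b + t^r * y'\<close> turns the roots in the ball around
  \<open>b\<close> into roots of nonnegative order, which the residual degree counts.\<close>

definition rescale :: "'a::field fls \<Rightarrow> int \<Rightarrow> 'a fls poly \<Rightarrow> 'a fls poly" where
  "rescale b r g = pcompose g [:b, fls_X_intpow r:]"

text \<open>The rescaled factor is \<open>(b - z) + t^r * y\<close>. Inside the ball the coefficient
  of \<open>y\<close> attains the minimal order \<open>r\<close>; outside, the constant term has
  smaller order and the reduction is constant.\<close>

lemma residual_degree_linear:
  "residual_degree (rescale b r [:- z, 1:]) (if z \<in> ball_int b r then 1 else 0)"
proof -
  define c where "c = b - z"
  have eq: "rescale b r [:- z, 1:] = [:c, fls_X_intpow r:]"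
    by (simp add: rescale_def pcompose_pCons c_def)
  have res: "residue_poly s [:c, fls_X_intpow r:] = [:c $$ s, if s = r then 1 else 0:]" for s
    by (intro poly_eqI) (auto simp: coeff_pCons split: nat.splits)
  show ?thesis
  proof (cases "z \<in> ball_int b r")
    case True
    then have "c $$ i = 0" if "i < r" for i
      using that by (simp add: ball_int_def c_def)
    with True show ?thesis
      unfolding residual_degree_def eq
      by (intro exI[of _ r]) (auto simp: res integral_at_def coeff_pCons split: nat.splits)
  next
    case False
    then obtain i where i: "i < r" "c $$ i \<noteq> 0" by (auto simp: ball_int_def c_def)
    then have "fls_subdegree c < r" "c \<noteq> 0"
      using fls_subdegree_leI[of c i] by auto
    then show ?thesis
      unfolding residual_degree_def eq using False
      by (intro exI[of _ "fls_subdegree c"])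
        (auto simp: res integral_at_def coeff_pCons split: nat.splits)
  qed
qed

lemma pcompose_power: "pcompose (p ^ n) q = pcompose p q ^ n" for p :: "'b::comm_ring_1 poly"
  by (induction n) (auto simp: pcompose_mult pcompose_1)

definition count_roots :: "nat \<Rightarrow> 'a::field fls poly \<Rightarrow> 'a fls set \<Rightarrow> nat" where
  "count_roots p H S = (\<Sum>G\<in>components H. mult_of G H * card (puiseux_roots p G \<inter> S))"

lemma residual_degree_count_roots:
  fixes H :: "'a::{alg_closed_field, field_char_0} fls poly"
  assumes "H \<noteq> 0" and p: "p > 0" "\<And>G. G \<in> components H \<Longrightarrow> degree G dvd p"
  shows "residual_degree (rescale b r (lift p H)) (count_roots p H (ball_int b r))"
proof -
  have comp: "residual_degree (rescale b r (lift p G)) (card (puiseux_roots p G \<inter> ball_int b r))"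
    if "G \<in> components H" for G
  proof -
    note G = componentsD(1,2)[OF that] p(1) p(2)[OF that]
    have "residual_degree (\<Prod>z\<in>puiseux_roots p G. rescale b r [:- z, 1:])
        (\<Sum>z\<in>puiseux_roots p G. if z \<in> ball_int b r then 1 else 0)"
      using finite_roots[OF G] by (intro residual_degree_prod residual_degree_linear)
    moreover have "(\<Sum>z\<in>puiseux_roots p G. if z \<in> ball_int b r then 1 else 0)
        = card (puiseux_roots p G \<inter> ball_int b r)"
      using finite_roots[OF G] by (simp flip: sum.inter_restrict)
    moreover have "rescale b r (lift p G) = (\<Prod>z\<in>puiseux_roots p G. rescale b r [:- z, 1:])"
      by (subst lift_eq_prod_roots[OF G]) (simp only: rescale_def pcompose_prod)
    ultimately show ?thesis by simp
  qed
  have "lift p H = [:fls_compose_power (lead_coeff H) p:] * (\<Prod>G\<in>components H. lift p G ^ mult_of G H)"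
    by (subst components_factorization(2)[OF assms(1)])
      (simp add: lift_smult[OF p(1)] lift_prod[OF p(1)] lift_power[OF p(1)])
  then have "rescale b r (lift p H) = [:fls_compose_power (lead_coeff H) p:] *
      (\<Prod>G\<in>components H. rescale b r (lift p G) ^ mult_of G H)"
    by (simp add: rescale_def pcompose_mult pcompose_prod pcompose_power pcompose_smult)
  moreover have "fls_compose_power (lead_coeff H) p \<noteq> 0"
    using assms(1) compose_power_eq_iff[OF p(1), of "lead_coeff H" 0] by simp
  ultimately show ?thesis
    using residual_degree_mult[OF residual_degree_const
        residual_degree_prod[OF components_factorization(1)[OF assms(1)] residual_degree_power[OF comp]]]
    by (simp add: count_roots_def)
qed

text \<open>A root of \<open>f\<close> in the ball makes the residual degree positive, the case in
  which differentiation lowers it by one.\<close>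

theorem rolle_ball:
  fixes f :: "'a::{alg_closed_field, field_char_0} fls poly"
  assumes f: "f \<noteq> 0" "pderiv f \<noteq> 0" and p: "p > 0"
    and deg: "\<And>G. G \<in> components f \<Longrightarrow> degree G dvd p"
      "\<And>G. G \<in> components (pderiv f) \<Longrightarrow> degree G dvd p"
    and pos: "count_roots p f (ball_int b r) > 0"
  shows "count_roots p (pderiv f) (ball_int b r) = count_roots p f (ball_int b r) - 1"
proof -
  obtain k where k: "count_roots p f (ball_int b r) = Suc k"
    using pos by (auto simp: gr0_conv_Suc)
  have "residual_degree (pderiv (rescale b r (lift p f))) k"
    using residual_degree_count_roots[OF f(1) p deg(1), of b r] k
    by (intro residual_degree_pderiv) simp
  \<comment> \<open>The chain rule leaves a factor \<open>t^r\<close>, a nonzero constant of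
    residual degree 0.\<close>
  moreover have "pderiv (rescale b r (lift p f)) = rescale b r (lift p (pderiv f)) * [:fls_X_intpow r:]"
    by (simp add: rescale_def pderiv_pcompose lift_pderiv[OF p] pderiv_pCons)
  moreover have "residual_degree (rescale b r (lift p (pderiv f)) * [:fls_X_intpow r:])
      (count_roots p (pderiv f) (ball_int b r) + 0)"
    by (intro residual_degree_mult residual_degree_const residual_degree_count_roots f p deg)
      (auto simp: fls_shift_eq0_iff)
  ultimately have "k = count_roots p (pderiv f) (ball_int b r) + 0"
    using residual_degree_unique by metis
  with k show ?thesis by simp
qed

section \<open>Orders and contacts\<close>

lemma ord_x_ge_iff:
  assumes "p > 0"
  shows "M \<le> ord_x p y \<longleftrightarrow> (\<forall>i. ereal (real_of_int i / real p) < M \<longrightarrow> y $$ i = 0)"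
proof (cases "y = 0")
  case True
  then show ?thesis by (simp add: ord_x_def)
next
  case False
  define s where "s = fls_subdegree y"
  have ord: "ord_x p y = ereal (real_of_int s / real p)" and "y $$ s \<noteq> 0"
    using False by (simp_all add: ord_x_def s_def)
  have "y $$ i = 0" if "M \<le> ord_x p y" "ereal (real_of_int i / real p) < M" for i
  proof -
    have "ereal (real_of_int i / real p) < ereal (real_of_int s / real p)"
      using that unfolding ord by (meson less_le_trans le_less_trans)
    then have "i < s" using assms by (simp add: divide_less_cancel)
    then show ?thesis by (simp add: s_def)
  qed
  then show ?thesis
    using \<open>y $$ s \<noteq> 0\<close> ord by (metis not_le)
qed

text \<open>At \<open>M = \<infinity>\<close> the zero series would satisfy the right side but not
  the left.\<close>

lemma ord_x_gt_iff:
  assumes "p > 0" "M < \<infinity>"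
  shows "M < ord_x p y \<longleftrightarrow> (\<forall>i. ereal (real_of_int i / real p) \<le> M \<longrightarrow> y $$ i = 0)"
proof (cases "y = 0")
  case True
  then show ?thesis using assms by (simp add: ord_x_def)
next
  case False
  define s where "s = fls_subdegree y"
  have ord: "ord_x p y = ereal (real_of_int s / real p)" and "y $$ s \<noteq> 0"
    using False by (simp_all add: ord_x_def s_def)
  have "y $$ i = 0" if "M < ord_x p y" "ereal (real_of_int i / real p) \<le> M" for i
  proof -
    have "ereal (real_of_int i / real p) < ereal (real_of_int s / real p)"
      using that unfolding ord by (meson less_le_trans le_less_trans)
    then have "i < s" using assms by (simp add: divide_less_cancel)
    then show ?thesis by (simp add: s_def)
  qed
  then show ?thesis
    using \<open>y $$ s \<noteq> 0\<close> ord by (metis not_le)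
qed

lemma ord_x_compose_power:
  fixes y :: "'a::field fls"
  assumes "p > 0" "q > 0"
  shows "ord_x (p * q) (fls_compose_power y q) = ord_x p y"
proof (cases "y = 0")
  case True
  then show ?thesis by (simp add: ord_x_def)
next
  case False
  have "fls_subdegree (fls_compose_power y q) = int q * fls_subdegree y"
  proof (rule fls_subdegree_eqI)
    show "fls_compose_power y q $$ (int q * fls_subdegree y) \<noteq> 0"
      using assms False by (simp add: fls_nth_compose_power)
    fix i assume i: "i < int q * fls_subdegree y"
    show "fls_compose_power y q $$ i = 0"
    proof (cases "int q dvd i")
      case True
      then obtain k where "i = int q * k" by auto
      then show ?thesis using i assms by (simp add: fls_nth_compose_power)
    qed (use assms in \<open>simp add: fls_nth_compose_power\<close>)
  qed
  moreover have "fls_compose_power y q \<noteq> 0"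
    using False compose_power_eq_iff[OF assms(2), of y 0] by simp
  ultimately show ?thesis
    using False assms by (simp add: ord_x_def)
qed

lemma ord_x_twist:
  assumes "u \<noteq> 0"
  shows "ord_x p (twist u y) = ord_x p y"
proof -
  interpret tw: field_coeff_hom "twist u" by (rule twist_hom[OF assms])
  show ?thesis by (simp add: ord_x_def subdegree_twist[OF assms])
qed

lemma ord_x_minus_commute: "ord_x p (y - z) = ord_x p (z - y)"
  using fls_uminus_subdegree[of "y - z"] by (simp add: ord_x_def)

lemma ord_x_not_MInf: "ord_x p y \<noteq> -\<infinity>"
  by (simp add: ord_x_def)

context
  fixes F G :: "'a::{alg_closed_field, field_char_0} fls poly" and p :: nat
  assumes F: "irreducible F" "lead_coeff F = 1"
    and G: "irreducible G" "lead_coeff G = 1"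
    and p: "p > 0" and dvd: "degree F * degree G dvd p"
begin

text \<open>The order in x is unchanged by \<open>t -> t^q\<close>, so the contact may be computed
  at any multiple of the index in its definition, in particular at one index for all pairs.\<close>

lemma contact_eq_Max:
  "contact F G = Max ((\<lambda>(y, z). ord_x p (y - z)) ` (puiseux_roots p F \<times> puiseux_roots p G))"
proof -
  define p0 where "p0 = degree F * degree G"
  have p0: "p0 > 0"
    using degree_irreducible_pos[OF F(1)] degree_irreducible_pos[OF G(1)] by (simp add: p0_def)
  obtain q where q: "p = p0 * q" using dvd by (auto simp: p0_def)
  then have "q > 0" using p by simp
  have "puiseux_roots p F = (\<lambda>a. fls_compose_power a q) ` puiseux_roots p0 F"
    "puiseux_roots p G = (\<lambda>a. fls_compose_power a q) ` puiseux_roots p0 G"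
    unfolding q by (rule roots_scale; use F G p0 \<open>q > 0\<close> in \<open>simp add: p0_def\<close>)+
  then have "(\<lambda>(y, z). ord_x p (y - z)) ` (puiseux_roots p F \<times> puiseux_roots p G)
      = (\<lambda>(y, z). ord_x p (fls_compose_power (y - z) q)) ` (puiseux_roots p0 F \<times> puiseux_roots p0 G)"
    by (force simp: image_iff)
  also have "\<dots> = {ord_x p0 (y - z) | y z. y \<in> puiseux_roots p0 F \<and> z \<in> puiseux_roots p0 G}"
    unfolding q ord_x_compose_power[OF p0 \<open>q > 0\<close>] by auto
  finally show ?thesis
    by (simp add: contact_def p0_def Let_def)
qed

lemma root_data:
  shows "finite (puiseux_roots p F)" "puiseux_roots p F \<noteq> {}"
    and "finite (puiseux_roots p G)" "puiseux_roots p G \<noteq> {}"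
    and "degree F dvd p" "degree G dvd p"
proof -
  show F': "degree F dvd p" and G': "degree G dvd p"
    using dvd by (auto dest: dvd_mult_left dvd_mult_right)
  show "finite (puiseux_roots p F)" "puiseux_roots p F \<noteq> {}"
    by (rule finite_roots[OF F p F'], rule roots_nonempty[OF F p F'])
  show "finite (puiseux_roots p G)" "puiseux_roots p G \<noteq> {}"
    by (rule finite_roots[OF G p G'], rule roots_nonempty[OF G p G'])
qed

lemma contact_attained:
  "\<exists>y\<in>puiseux_roots p F. \<exists>z\<in>puiseux_roots p G. contact F G = ord_x p (y - z)"
proof -
  have "contact F G \<in> (\<lambda>(y, z). ord_x p (y - z)) ` (puiseux_roots p F \<times> puiseux_roots p G)"
    unfolding contact_eq_Max using root_data by (intro Max_in) auto
  then show ?thesis by auto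
qed

lemma contact_upper:
  assumes "y \<in> puiseux_roots p F" "z \<in> puiseux_roots p G"
  shows "ord_x p (y - z) \<le> contact F G"
  unfolding contact_eq_Max using root_data assms by (intro Max_ge) auto

text \<open>A pair of roots attaining the contact can be twisted so that it starts at any given root
  of \<open>F\<close>, and twisting preserves orders. The choice of the root thereby becomes
  immaterial.\<close>

lemma contact_attained_at:
  assumes "y \<in> puiseux_roots p F"
  shows "\<exists>z\<in>puiseux_roots p G. ord_x p (y - z) = contact F G"
proof -
  obtain y' z' where yz: "y' \<in> puiseux_roots p F" "z' \<in> puiseux_roots p G"
    "contact F G = ord_x p (y' - z')"
    using contact_attained by blast
  obtain u where u: "u \<in> unity_roots p" "y = twist u y'"
    using roots_transitive[OF F p root_data(5) yz(1) assms] by blast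
  have "ord_x p (y - twist u z') = contact F G"
    unfolding u(2) yz(3) twist_diff[symmetric]
    by (rule ord_x_twist[OF unity_roots_nonzero[OF u(1) p]])
  then show ?thesis
    using twist_puiseux_root[OF u(1) p yz(2)] by blast
qed

lemma contact_not_MInf: "contact F G \<noteq> -\<infinity>"
  using contact_attained ord_x_not_MInf by metis

lemma contact_not_PInf:
  assumes "F \<noteq> G"
  shows "contact F G \<noteq> \<infinity>"
proof
  assume "contact F G = \<infinity>"
  then obtain y z where "y \<in> puiseux_roots p F" "z \<in> puiseux_roots p G" "ord_x p (y - z) = \<infinity>"
    using contact_attained by metis
  then have "y = z" by (simp add: ord_x_def split: if_splits)
  then have "F = G"
    using common_root_imp_eq[OF F root_data(5) G root_data(6) p] \<open>y \<in> _\<close> \<open>z \<in> _\<close> by blast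
  with assms show False by simp
qed

end

lemma contact_commute:
  fixes F G :: "'a::{alg_closed_field, field_char_0} fls poly"
  shows "contact F G = contact G F"
proof -
  have "{ord_x p (y - z) | y z. y \<in> puiseux_roots p F \<and> z \<in> puiseux_roots p G}
    = {ord_x p (y - z) | y z. y \<in> puiseux_roots p G \<and> z \<in> puiseux_roots p F}" for p
    using ord_x_minus_commute by blast
  then show ?thesis
    by (simp add: contact_def Let_def mult.commute)
qed

section \<open>Counting truncated roots\<close>

text \<open>The fibres of \<open>trunc p {..<M}\<close> are the closed balls of radius
  \<open>M\<close>, those of \<open>trunc p {..M}\<close> the open ones. \<open>S\<close> holds
  exponents in x rather than t, so that it is directly comparable with contacts and characteristic
  ratios.\<close>

definition trunc :: "nat \<Rightarrow> ereal set \<Rightarrow> 'a::field fls \<Rightarrow> int \<Rightarrow> 'a" where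
  "trunc p S y = (\<lambda>i. if ereal (real_of_int i / real p) \<in> S then y $$ i else 0)"

lemma trunc_eq_iff:
  "trunc p S y = trunc p S z \<longleftrightarrow> (\<forall>i. ereal (real_of_int i / real p) \<in> S \<longrightarrow> y $$ i = z $$ i)"
  by (auto simp: trunc_def fun_eq_iff)

lemma trunc_less_eq_iff:
  "p > 0 \<Longrightarrow> trunc p {..<M} y = trunc p {..<M} z \<longleftrightarrow> M \<le> ord_x p (y - z)"
  by (simp add: trunc_eq_iff ord_x_ge_iff)

lemma trunc_le_eq_iff:
  "p > 0 \<Longrightarrow> M < \<infinity> \<Longrightarrow> trunc p {..M} y = trunc p {..M} z \<longleftrightarrow> M < ord_x p (y - z)"
  by (simp add: trunc_eq_iff ord_x_gt_iff)

lemma card_image_eq_if_same_kernel: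
  assumes "\<And>x y. x \<in> A \<Longrightarrow> y \<in> A \<Longrightarrow> f x = f y \<longleftrightarrow> g x = g y"
  shows "card (f ` A) = card (g ` A)"
proof (rule bij_betw_same_card)
  show "bij_betw (\<lambda>t. g (inv_into A f t)) (f ` A) (g ` A)"
  proof (rule bij_betwI')
    fix s t assume "s \<in> f ` A" "t \<in> f ` A"
    then show "g (inv_into A f s) = g (inv_into A f t) \<longleftrightarrow> s = t"
      using assms by (metis f_inv_into_f inv_into_into)
  next
    fix v assume "v \<in> g ` A"
    then obtain x where "x \<in> A" "v = g x" by blast
    then show "\<exists>t\<in>f ` A. v = g (inv_into A f t)"
      using assms[of x "inv_into A f (f x)"]
      by (intro bexI[of _ "f x"]) (auto simp: inv_into_into f_inv_into_f)
  qed (auto intro: inv_into_into)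
qed

text \<open>The order of \<open>u\<close> divides \<open>n\<close>, so \<open>n\<close> can join
  \<open>A\<close> under the gcd. With \<open>A\<close> the truncated support, this makes the
  stabilizer of a truncation the group of g-th roots of unity, g being the gcd.\<close>

lemma unity_root_powers_eq_1_iff:
  fixes u :: "'a::field"
  assumes "u \<in> unity_roots n" "n > 0"
  shows "(\<forall>i\<in>A. u powi i = 1) \<longleftrightarrow> u ^ nat (Gcd (insert (int n) A)) = 1"
proof -
  obtain e where e: "\<And>i::int. u powi i = 1 \<longleftrightarrow> int e dvd i"
    using order_of_unity_root[of u n] assms by (auto simp: unity_roots_def)
  have "int e dvd int n"
    using e[of "int n"] assms by (simp add: unity_roots_def)
  then have "(\<forall>i\<in>A. int e dvd i) \<longleftrightarrow> int e dvd Gcd (insert (int n) A)"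
    unfolding dvd_Gcd_iff by auto
  also have "\<dots> \<longleftrightarrow> u powi (int (nat (Gcd (insert (int n) A)))) = 1"
    unfolding e by simp
  also have "\<dots> \<longleftrightarrow> u ^ nat (Gcd (insert (int n) A)) = 1"
    by (simp only: power_int_of_nat)
  finally show ?thesis unfolding e .
qed

context
  fixes F :: "'a::{alg_closed_field, field_char_0} fls poly"
  assumes irr: "irreducible F" and monic: "lead_coeff F = 1"
begin

lemma roots_eq_twist_param:
  "puiseux_roots (degree F) F = (\<lambda>w. twist w (param F)) ` unity_roots (degree F)"
proof -
  note n = degree_irreducible_pos[OF irr]
  have "param F \<in> puiseux_roots (degree F) F"
    unfolding param_def using roots_nonempty[OF irr monic n dvd_refl] by (simp add: some_in_eq)
  then show ?thesis
    using roots_transitive[OF irr monic n dvd_refl] twist_puiseux_root[OF _ n] by blast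
qed

text \<open>Orbit and stabilizer: two n-th roots of unity give the same truncation iff their g-th
  powers agree, and these powers are exactly the roots of unity of order dividing
  \<open>n / g\<close>.\<close>

lemma card_trunc_roots:
  assumes p: "p > 0" "degree F dvd p"
  shows "card (trunc p S ` puiseux_roots p F) *
    nat (Gcd (insert (int (degree F)) {i \<in> supp F. ereal (real_of_int i / real (degree F)) \<in> S}))
    = degree F"
proof -
  define n where "n = degree F"
  have n: "n > 0" using degree_irreducible_pos[OF irr] by (simp add: n_def)
  obtain q where q: "p = n * q" using p by (auto simp: n_def)
  then have "q > 0" using p by simp
  define A where "A = {i \<in> supp F. ereal (real_of_int i / real n) \<in> S}"
  define g where "g = nat (Gcd (insert (int n) A))"
  have "int g dvd int n" by (simp add: g_def)
  then have "g dvd n" by (simp only: int_dvd_int_iff)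
  then obtain m where m: "n = m * g" by (metis dvd_def mult.commute)
  then have "g > 0" "m > 0" using n by auto
  define y where "y = param F"
  \<comment> \<open>Passing from index \<open>n\<close> to \<open>p = n * q\<close> spreads the
    coefficients to multiples of \<open>q\<close> but keeps their exponents in x, so the comparison
    takes place at index \<open>n\<close>.\<close>
  have same: "trunc p S (fls_compose_power a q) = trunc p S (fls_compose_power b q)
      \<longleftrightarrow> (\<forall>i. ereal (real_of_int i / real n) \<in> S \<longrightarrow> a $$ i = b $$ i)" for a b :: "'a fls"
  proof -
    have "(\<forall>i. ereal (real_of_int i / real p) \<in> S \<longrightarrow>
            fls_compose_power a q $$ i = fls_compose_power b q $$ i)
        \<longleftrightarrow> (\<forall>j. ereal (real_of_int (int q * j) / real p) \<in> S \<longrightarrow> a $$ j = b $$ j)"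
      (is "?L \<longleftrightarrow> ?R")
    proof
      assume L: ?L
      show ?R
      proof (intro allI impI)
        fix j assume "ereal (real_of_int (int q * j) / real p) \<in> S"
        with L have "fls_compose_power a q $$ (int q * j) = fls_compose_power b q $$ (int q * j)" by blast
        then show "a $$ j = b $$ j" using \<open>q > 0\<close> by (simp add: fls_nth_compose_power)
      qed
    next
      assume ?R
      then show ?L using \<open>q > 0\<close> by (auto simp: fls_nth_compose_power elim!: dvdE)
    qed
    moreover have "real_of_int (int q * j) / real p = real_of_int j / real n" for j
      using \<open>q > 0\<close> by (simp add: q)
    ultimately show ?thesis by (simp add: trunc_eq_iff)
  qed
  have tw: "(\<forall>i. ereal (real_of_int i / real n) \<in> S \<longrightarrow> twist w y $$ i = twist w' y $$ i)
      \<longleftrightarrow> w ^ g = w' ^ g" if w: "w \<in> unity_roots n" "w' \<in> unity_roots n" for w w' :: 'a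
  proof -
    have nz: "w \<noteq> 0" "w' \<noteq> 0" using w unity_roots_nonzero n by blast+
    have "(\<forall>i. ereal (real_of_int i / real n) \<in> S \<longrightarrow> twist w y $$ i = twist w' y $$ i)
        \<longleftrightarrow> (\<forall>i\<in>A. w powi i = w' powi i)"
      by (auto simp: A_def supp_def y_def)
    also have "\<dots> \<longleftrightarrow> (\<forall>i\<in>A. (w / w') powi i = 1)"
      using nz by (simp add: power_int_divide_distrib)
    also have "\<dots> \<longleftrightarrow> (w / w') ^ g = 1"
      unfolding g_def by (rule unity_root_powers_eq_1_iff[OF unity_roots_divide[OF w] n])
    also have "\<dots> \<longleftrightarrow> w ^ g = w' ^ g"
      using nz by (simp add: power_divide)
    finally show ?thesis .
  qed
  define T where "T = (\<lambda>w. trunc p S (fls_compose_power (twist w y) q))"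
  have "puiseux_roots p F = (\<lambda>w. fls_compose_power (twist w y) q) ` unity_roots n"
    unfolding q n_def irreducible_roots_scale[OF irr monic \<open>q > 0\<close>] roots_eq_twist_param y_def
    by (simp add: image_image)
  then have "trunc p S ` puiseux_roots p F = T ` unity_roots n"
    by (simp add: T_def image_image)
  also have "card \<dots> = card ((\<lambda>w :: 'a. w ^ g) ` unity_roots n)"
    by (rule card_image_eq_if_same_kernel) (use T_def same tw in metis)
  also have "(\<lambda>w :: 'a. w ^ g) ` unity_roots n = unity_roots m"
  proof (intro equalityI subsetI)
    fix v :: 'a assume v: "v \<in> unity_roots m"
    obtain w where "w ^ g = v" using nth_root_exists[OF \<open>g > 0\<close>] by blast
    then show "v \<in> (\<lambda>w. w ^ g) ` unity_roots n"
      using v by (intro image_eqI[of _ _ w]) (auto simp: unity_roots_def m power_mult mult.commute[of m])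
  qed (auto simp: unity_roots_def m mult.commute[of m] simp flip: power_mult)
  finally have "card (trunc p S ` puiseux_roots p F) = m"
    using card_unity_roots(1)[OF \<open>m > 0\<close>, where 'a='a] by simp
  then show ?thesis
    using m by (simp add: g_def A_def n_def)
qed

text \<open>For the threshold \<open>UNIV\<close> truncation is injective and the n roots are
  distinct, so the stabilizer is trivial. This is what drives the characteristic sequence down to
  1.\<close>

lemma Gcd_supp: "Gcd (insert (int (degree F)) (supp F)) = 1"
proof -
  note n = degree_irreducible_pos[OF irr]
  have "inj_on (trunc (degree F) UNIV) (puiseux_roots (degree F) F)"
    by (auto simp: inj_on_def trunc_eq_iff fls_eq_iff)
  then have "card (trunc (degree F) UNIV ` puiseux_roots (degree F) F) = degree F"
    using card_roots[OF irr monic n dvd_refl] by (simp add: card_image)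
  then have "nat (Gcd (insert (int (degree F)) (supp F))) = 1"
    using card_trunc_roots[OF n dvd_refl, of UNIV] n by simp
  then show ?thesis by (simp add: nat_eq_iff)
qed

subsection \<open>Characteristic sequences\<close>

definition nondiv :: "nat \<Rightarrow> int set" where
  "nondiv k = {i \<in> supp F. \<not> int (char_d F k) dvd i}"

lemma char_m_altdef: "char_m F k = (INF i \<in> nondiv k. ereal (real_of_int i))"
  by (simp add: char_m_def nondiv_def)

lemma char_d_1: "char_d F (Suc 0) = degree F"
  by simp

lemma char_d_Suc:
  "k \<ge> 1 \<Longrightarrow> char_d F (Suc k) =
    (if char_d F k > 1 then nat (gcd (int (char_d F k)) (Inf (nondiv k))) else char_d F k)"
  by (simp add: nondiv_def)

lemma char_d_dvd_Suc: "k \<ge> 1 \<Longrightarrow> char_d F (Suc k) dvd char_d F k"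
proof -
  assume k: "k \<ge> 1"
  have "int (nat (gcd (int (char_d F k)) (Inf (nondiv k)))) dvd int (char_d F k)" by simp
  then have "nat (gcd (int (char_d F k)) (Inf (nondiv k))) dvd char_d F k"
    by (simp only: int_dvd_int_iff)
  then show ?thesis using k by (simp add: char_d_Suc del: char_d.simps)
qed

lemma char_d_dvd: "1 \<le> j \<Longrightarrow> j \<le> k \<Longrightarrow> char_d F k dvd char_d F j"
proof (induction k)
  case (Suc k)
  then show ?case
    using char_d_dvd_Suc[of k] by (cases "j = Suc k") (auto simp del: char_d.simps intro: dvd_trans)
qed simp

lemma char_d_dvd_degree: "k \<ge> 1 \<Longrightarrow> char_d F k dvd degree F"
  using char_d_dvd[of 1 k] by (simp del: char_d.simps(2) add: char_d_1)

lemma char_d_pos: "k \<ge> 1 \<Longrightarrow> char_d F k > 0"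
  using char_d_dvd_degree degree_irreducible_pos[OF irr] by (metis dvd_0_left_iff gr0I not_less0)

text \<open>If \<open>char_d F k\<close> divided the whole support, it would divide the gcd 1.
  Laurent supports are bounded below, so the infimum in \<open>int\<close> is attained and is the
  true \<open>m_k\<close>.\<close>

lemma nondiv_least:
  assumes "k \<ge> 1" "char_d F k > 1"
  shows "Inf (nondiv k) \<in> nondiv k" and "\<And>i. i \<in> nondiv k \<Longrightarrow> Inf (nondiv k) \<le> i"
proof -
  have "nondiv k \<noteq> {}"
  proof
    assume "nondiv k = {}"
    then have "int (char_d F k) dvd Gcd (insert (int (degree F)) (supp F))"
      unfolding dvd_Gcd_iff using char_d_dvd_degree[OF assms(1)] by (auto simp: nondiv_def)
    then show False using assms(2) by (simp add: Gcd_supp del: Gcd_insert)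
  qed
  moreover define b where "b = fls_subdegree (param F)"
  have low: "b \<le> i" if "i \<in> nondiv k" for i
    using that fls_subdegree_leI[of "param F" i] by (simp add: nondiv_def supp_def b_def)
  ultimately obtain i0 where i0: "i0 \<in> nondiv k" "\<And>i. i \<in> nondiv k \<Longrightarrow> nat (i0 - b) \<le> nat (i - b)"
    using ex_has_least_nat[of "\<lambda>i. i \<in> nondiv k" _ "\<lambda>i. nat (i - b)"] by blast
  have min: "i0 \<le> i" if "i \<in> nondiv k" for i
    using i0(2)[OF that] low[OF that] low[OF i0(1)] by linarith
  have "Inf (nondiv k) = i0"
    using i0(1) min by (intro cInf_eq_minimum)
  then show "Inf (nondiv k) \<in> nondiv k" and "\<And>i. i \<in> nondiv k \<Longrightarrow> Inf (nondiv k) \<le> i"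
    using i0(1) min by auto
qed

lemma char_m_eq:
  assumes "k \<ge> 1" "char_d F k > 1"
  shows "char_m F k = ereal (real_of_int (Inf (nondiv k)))"
  unfolding char_m_altdef
  by (rule antisym)
    (auto intro!: INF_lower INF_greatest nondiv_least[OF assms])

lemma char_m_infinite: "char_d F k = 1 \<Longrightarrow> char_m F k = \<infinity>"
  by (simp add: char_m_def top_ereal_def)

lemma char_d_eq_1_or_greater: "k \<ge> 1 \<Longrightarrow> char_d F k = 1 \<or> char_d F k > 1"
  using char_d_pos[of k] by linarith

lemma char_ratio_eq:
  assumes "k \<ge> 1" "char_d F k > 1"
  shows "char_ratio F k = ereal (real_of_int (Inf (nondiv k)) / real (degree F))"
  using char_m_eq[OF assms] degree_irreducible_pos[OF irr] by (simp add: char_ratio_def)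

lemma char_ratio_infinite: "char_d F k = 1 \<Longrightarrow> char_ratio F k = \<infinity>"
  using degree_irreducible_pos[OF irr] by (simp add: char_ratio_def char_m_infinite)

lemma char_d_1_iff_ratio_infinite: "k \<ge> 1 \<Longrightarrow> char_d F k = 1 \<longleftrightarrow> char_ratio F k = \<infinity>"
  using char_d_eq_1_or_greater[of k] char_ratio_eq[of k] char_ratio_infinite[of k] by auto

lemma char_d_decreasing:
  assumes "k \<ge> 1" "char_d F k > 1"
  shows "char_d F (Suc k) < char_d F k"
proof -
  have "\<not> int (char_d F k) dvd Inf (nondiv k)"
    using nondiv_least(1)[OF assms] by (simp add: nondiv_def)
  moreover have "int (char_d F (Suc k)) dvd Inf (nondiv k)"
    using assms by (simp add: char_d_Suc del: char_d.simps)
  ultimately have "char_d F (Suc k) \<noteq> char_d F k" by metis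
  moreover have "char_d F (Suc k) \<le> char_d F k"
    using dvd_imp_le[OF char_d_dvd_Suc[OF assms(1)] char_d_pos[OF assms(1)]] .
  ultimately show ?thesis by simp
qed

lemma char_d_reaches_1: "\<exists>k. char_d F (Suc k) = 1"
proof (rule ccontr)
  assume "\<nexists>k. char_d F (Suc k) = 1"
  then have gt: "char_d F (Suc k) > 1" for k
    using char_d_eq_1_or_greater[of "Suc k"] by auto
  have "char_d F (Suc k) + k \<le> degree F" for k
  proof (induction k)
    case (Suc k)
    then show ?case using char_d_decreasing[of "Suc k"] gt[of k] by (simp del: char_d.simps)
  qed simp
  from this[of "degree F"] gt[of "degree F"] show False by linarith
qed

lemma char_d_h: "char_d F (Suc (char_h F)) = 1"
  unfolding char_h_def using char_d_reaches_1 by (rule LeastI_ex)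

lemma char_d_eq_1_iff:
  assumes "k \<ge> 1"
  shows "char_d F k = 1 \<longleftrightarrow> k > char_h F"
proof
  assume "char_d F k = 1"
  then have "char_h F \<le> k - 1"
    unfolding char_h_def using assms by (intro Least_le) (simp del: char_d.simps)
  with assms show "k > char_h F" by simp
next
  assume "k > char_h F"
  then have "char_d F k dvd char_d F (Suc (char_h F))"
    by (intro char_d_dvd) auto
  then show "char_d F k = 1" by (simp only: char_d_h) simp
qed

lemma char_d_gt_1_iff: "k \<ge> 1 \<Longrightarrow> char_d F k > 1 \<longleftrightarrow> k \<le> char_h F"
  using char_d_eq_1_iff[of k] char_d_eq_1_or_greater[of k] by auto

lemma char_ratio_finite_iff: "k \<ge> 1 \<Longrightarrow> char_ratio F k < \<infinity> \<longleftrightarrow> k \<le> char_h F"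
  using char_d_1_iff_ratio_infinite[of k] char_d_eq_1_iff[of k] by auto

text \<open>\<open>m_j\<close> is divisible by \<open>char_d F (Suc j)\<close>, hence by
  \<open>char_d F k\<close>, whereas \<open>m_k\<close> is not. The bound on \<open>j\<close> is
  essential, since all ratios past \<open>char_h F\<close> are infinite.\<close>

lemma char_ratio_strict_mono:
  assumes "1 \<le> j" "j < k" "j \<le> char_h F"
  shows "char_ratio F j < char_ratio F k"
proof (cases "k \<le> char_h F")
  case True
  have gt: "char_d F j > 1" "char_d F k > 1"
    using assms True char_d_gt_1_iff by auto
  have "nondiv k \<subseteq> nondiv j"
    using char_d_dvd[of j k] assms by (auto simp: nondiv_def intro: dvd_trans)
  then have le: "Inf (nondiv j) \<le> Inf (nondiv k)"
    using nondiv_least[of k] nondiv_least[of j] assms gt by auto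
  have "int (char_d F (Suc j)) dvd Inf (nondiv j)"
    using assms gt by (simp add: char_d_Suc del: char_d.simps)
  then have "int (char_d F k) dvd Inf (nondiv j)"
    using char_d_dvd[of "Suc j" k] assms by (meson Suc_leI int_dvd_int_iff le_SucI dvd_trans of_nat_dvd_iff)
  then have "Inf (nondiv j) \<noteq> Inf (nondiv k)"
    using nondiv_least(1)[of k] assms gt by (auto simp: nondiv_def)
  with le have "Inf (nondiv j) < Inf (nondiv k)" by simp
  then show ?thesis
    using assms gt degree_irreducible_pos[OF irr] by (simp add: char_ratio_eq divide_strict_right_mono del: char_d.simps)
next
  case False
  then have "\<not> char_ratio F k < \<infinity>" "char_ratio F j < \<infinity>"
    using assms char_ratio_finite_iff by simp_all
  then show ?thesis by (metis not_le order.strict_trans2)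
qed

lemma char_ratio_mono:
  assumes "1 \<le> j" "j \<le> k"
  shows "char_ratio F j \<le> char_ratio F k"
proof (cases "j = k \<or> j \<le> char_h F")
  case True
  then show ?thesis using char_ratio_strict_mono[of j k] assms by (cases "j = k") auto
next
  case False
  then have "\<not> char_ratio F k < \<infinity>" using assms char_ratio_finite_iff by simp
  then show ?thesis by (simp add: not_less top.extremum_unique)
qed

text \<open>
  The truncation at a threshold \<open>S\<close> between two consecutive characteristic exponents has a
  stabilizer of order \<open>d\<^sub>k\<close> among the \<open>n\<close>-th roots of unity.
\<close>

lemma Gcd_supp_threshold:
  assumes k: "k \<ge> 1"
    and above: "\<And>v. v \<in> S \<Longrightarrow> v < char_ratio F k"
    and below: "\<And>j. 1 \<le> j \<Longrightarrow> j < k \<Longrightarrow> char_ratio F j < \<infinity> \<Longrightarrow> char_ratio F j \<in> S"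
  shows "Gcd (insert (int (degree F)) {i \<in> supp F. ereal (real_of_int i / real (degree F)) \<in> S})
    = int (char_d F k)"
proof -
  define n where "n = degree F"
  have n: "n > 0" using degree_irreducible_pos[OF irr] by (simp add: n_def)
  define A where "A = {i \<in> supp F. ereal (real_of_int i / real n) \<in> S}"
  define g where "g = Gcd (insert (int n) A)"
  have "int (char_d F k) dvd i" if "i \<in> A" for i
  proof (rule ccontr)
    assume "\<not> int (char_d F k) dvd i"
    then have i: "i \<in> nondiv k" using that by (simp add: nondiv_def A_def)
    then have gt: "char_d F k > 1"
      using char_d_eq_1_or_greater[OF k] by (auto simp: nondiv_def)
    have "ereal (real_of_int i / real n) < char_ratio F k"
      using above that by (simp add: A_def)
    then have "i < Inf (nondiv k)"
      using n by (simp add: char_ratio_eq[OF k gt] n_def divide_less_cancel)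
    with nondiv_least(2)[OF k gt i] show False by simp
  qed
  then have "int (char_d F k) dvd g"
    unfolding g_def dvd_Gcd_iff using char_d_dvd_degree[OF k] by (auto simp: n_def)
  \<comment> \<open>For the converse, \<open>g\<close> divides \<open>n\<close> and every finite
    \<open>m_j\<close> with \<open>j < k\<close>, as these lie in the threshold; the recursion for
    \<open>char_d\<close> propagates this.\<close>
  moreover have "g dvd int (char_d F j)" if "1 \<le> j" "j \<le> k" for j
    using that
  proof (induction j rule: dec_induct)
    case base
    have "g dvd int n" unfolding g_def by (rule Gcd_dvd) simp
    then show ?case by (simp add: n_def)
  next
    case (step j)
    show ?case
    proof (cases "char_d F j > 1")
      case True
      have "char_ratio F j \<in> S"
        using step(1,2,4) True by (intro below) (simp_all add: char_ratio_eq)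
      then have "Inf (nondiv j) \<in> A"
        using nondiv_least(1)[OF step(1) True]
        by (simp add: A_def char_ratio_eq[OF step(1) True] n_def nondiv_def)
      then have "g dvd Inf (nondiv j)" unfolding g_def by (intro Gcd_dvd) simp
      then show ?thesis
        using step by (simp add: char_d_Suc True del: char_d.simps)
    next
      case False
      then show ?thesis using step by (simp add: char_d_Suc del: char_d.simps)
    qed
  qed
  then have "g dvd int (char_d F k)" using k by simp
  moreover have "g \<ge> 0" by (simp add: g_def del: Gcd_insert)
  ultimately have "g = int (char_d F k)"
    by (intro zdvd_antisym_nonneg) auto
  then show ?thesis by (simp add: g_def A_def n_def)
qed

section \<open>Numbers of closed and open balls of one component\<close>

context
  fixes p :: nat
  assumes p: "p > 0" "degree F dvd p"
begin

lemma card_trunc_eq: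
  assumes "k \<ge> 1" "\<And>v. v \<in> S \<Longrightarrow> v < char_ratio F k"
    and "\<And>j. 1 \<le> j \<Longrightarrow> j < k \<Longrightarrow> char_ratio F j < \<infinity> \<Longrightarrow> char_ratio F j \<in> S"
  shows "real (card (trunc p S ` puiseux_roots p F)) = real (degree F) / real (char_d F k)"
proof -
  have "card (trunc p S ` puiseux_roots p F) * char_d F k = degree F"
    using card_trunc_roots[OF p, of S] Gcd_supp_threshold[OF assms] by simp
  then have "real (card (trunc p S ` puiseux_roots p F)) * real (char_d F k) = real (degree F)"
    by (simp flip: of_nat_mult)
  then show ?thesis
    using char_d_pos[OF assms(1)] by (simp add: field_simps)
qed

text \<open>The number of balls gained on crossing the j-th exponent, written as a difference so
  that sums over \<open>j\<close> telescope.\<close>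

lemma char_e_term:
  assumes "j \<in> {1..char_h F}"
  shows "(real (char_e F j) - 1) * (real (degree F) / real (char_d F j))
    = real (degree F) / real (char_d F (Suc j)) - real (degree F) / real (char_d F j)"
proof -
  have "real (char_e F j) = real (char_d F j) / real (char_d F (Suc j))"
    unfolding char_e_def using assms by (intro real_of_nat_div char_d_dvd_Suc) auto
  moreover have "char_d F j > 0" "char_d F (Suc j) > 0"
    using assms char_d_pos[of j] char_d_pos[of "Suc j"] by (auto simp del: char_d.simps)
  ultimately show ?thesis by (simp add: field_simps del: char_d.simps)
qed

context
  fixes M :: ereal and \<theta> :: nat
  assumes M: "M < \<infinity>"
    and \<theta>: "\<theta> \<ge> 1" "M \<le> char_ratio F \<theta>" "\<And>j. 1 \<le> j \<Longrightarrow> j < \<theta> \<Longrightarrow> char_ratio F j < M"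
begin

lemma card_trunc_less: "real (card (trunc p {..<M} ` puiseux_roots p F)) = real (degree F) / real (char_d F \<theta>)"
  using \<theta> by (intro card_trunc_eq) auto

lemma card_trunc_le_ne:
  assumes "M \<noteq> char_ratio F \<theta>"
  shows "real (card (trunc p {..M} ` puiseux_roots p F)) = real (degree F) / real (char_d F \<theta>)"
  using \<theta> assms by (intro card_trunc_eq) (auto simp: less_le)

lemma card_trunc_le_eq:
  assumes "M = char_ratio F \<theta>"
  shows "real (card (trunc p {..M} ` puiseux_roots p F)) = real (degree F) / real (char_d F (Suc \<theta>))"
proof -
  have h: "\<theta> \<le> char_h F"
    using M assms char_ratio_finite_iff[OF \<theta>(1)] by simp
  have "char_ratio F j \<le> M" if "1 \<le> j" "j < Suc \<theta>" for j
    using that \<theta>(3)[of j] assms by (cases "j = \<theta>") auto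
  moreover have "M < char_ratio F (Suc \<theta>)"
    unfolding assms using \<theta>(1) h by (intro char_ratio_strict_mono) auto
  ultimately show ?thesis by (intro card_trunc_eq) auto
qed

text \<open>Going from closed to open balls adds only the exponent \<open>M\<close> to the
  threshold, so the count changes only if \<open>M\<close> is itself characteristic.\<close>

lemma card_trunc_le_diff:
  "real (card (trunc p {..M} ` puiseux_roots p F)) - real (card (trunc p {..<M} ` puiseux_roots p F))
    = (if M = char_ratio F \<theta> then (real (char_e F \<theta>) - 1) * (real (degree F) / real (char_d F \<theta>)) else 0)"
proof (cases "M = char_ratio F \<theta>")
  case True
  then have "\<theta> \<in> {1..char_h F}"
    using M \<theta>(1) char_ratio_finite_iff[OF \<theta>(1)] by simp
  from char_e_term[OF this] True show ?thesis
    unfolding card_trunc_less card_trunc_le_eq[OF True] by (simp del: char_d.simps)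
qed (simp add: card_trunc_less card_trunc_le_ne)

text \<open>The telescope ends at \<open>char_d F (Suc (char_h F)) = 1\<close>, where all roots are
  separated; the subtracted terms are the separations that occur only above
  \<open>M\<close>.\<close>

lemma card_trunc_le_sum:
  "real (card (trunc p {..M} ` puiseux_roots p F)) = real (degree F)
    - (\<Sum>j | j \<in> {1..char_h F} \<and> M < char_ratio F j.
        (real (char_e F j) - 1) * (real (degree F) / real (char_d F j)))"
proof -
  \<comment> \<open>Index of the first ratio strictly above \<open>M\<close>. It may be
    \<open>Suc (char_h F)\<close>, in which case the sum is empty.\<close>
  define k where "k = (if M = char_ratio F \<theta> then Suc \<theta> else \<theta>)"
  have k: "k \<ge> 1" using \<theta>(1) by (simp add: k_def)
  have card: "real (card (trunc p {..M} ` puiseux_roots p F)) = real (degree F) / real (char_d F k)"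
    using card_trunc_le_eq card_trunc_le_ne by (auto simp only: k_def split: if_split)
  have lt: "M < char_ratio F k"
  proof (cases "M = char_ratio F \<theta>")
    case True
    then have "\<theta> \<le> char_h F" using M char_ratio_finite_iff[OF \<theta>(1)] by simp
    then show ?thesis
      using char_ratio_strict_mono[of \<theta> "Suc \<theta>"] \<theta>(1) True by (simp add: k_def)
  next
    case False
    then show ?thesis using \<theta>(2) by (simp add: k_def)
  qed
  have iff: "M < char_ratio F j \<longleftrightarrow> k \<le> j" if "j \<ge> 1" for j
  proof
    assume "k \<le> j"
    then show "M < char_ratio F j" using lt char_ratio_mono[OF k] by (metis less_le_trans)
  next
    assume "M < char_ratio F j"
    then show "k \<le> j"
      using \<theta>(3)[OF that] by (cases j \<theta> rule: linorder_cases) (auto simp: k_def)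
  qed
  have "k \<le> Suc (char_h F)"
    using iff[of "Suc (char_h F)"] char_ratio_infinite[OF char_d_h] M by simp
  have range: "{j. j \<in> {1..char_h F} \<and> M < char_ratio F j} = {k..char_h F}"
    using iff k by auto
  have "(\<Sum>j | j \<in> {1..char_h F} \<and> M < char_ratio F j.
        (real (char_e F j) - 1) * (real (degree F) / real (char_d F j)))
    = (\<Sum>j=k..char_h F. real (degree F) / real (char_d F (Suc j)) - real (degree F) / real (char_d F j))"
    unfolding range using k by (intro sum.cong refl char_e_term) simp
  also have "\<dots> = real (degree F) / real (char_d F (Suc (char_h F))) - real (degree F) / real (char_d F k)"
    using sum_Suc_diff[OF \<open>k \<le> Suc (char_h F)\<close>, of "\<lambda>j. real (degree F) / real (char_d F j)"]
    by (simp del: char_d.simps)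
  finally show ?thesis
    using char_d_h card by (simp del: char_d.simps)
qed

end

end

lemma ex_theta:
  "\<exists>\<theta>\<ge>1. M \<le> char_ratio F \<theta> \<and> (\<forall>j. 1 \<le> j \<and> j < \<theta> \<longrightarrow> char_ratio F j < M)"
proof -
  define \<theta> where "\<theta> = (LEAST k. 1 \<le> k \<and> M \<le> char_ratio F k)"
  have "1 \<le> Suc (char_h F) \<and> M \<le> char_ratio F (Suc (char_h F))"
    using char_ratio_infinite[OF char_d_h] by simp
  then have "1 \<le> \<theta> \<and> M \<le> char_ratio F \<theta>"
    unfolding \<theta>_def by (rule LeastI)
  moreover have "char_ratio F j < M" if "1 \<le> j" "j < \<theta>" for j
    using not_less_Least[of j "\<lambda>k. 1 \<le> k \<and> M \<le> char_ratio F k"] that by (auto simp: \<theta>_def)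
  ultimately show ?thesis by blast
qed

text \<open>This reads the characteristic ratios off the sets of truncated roots, so components with
  equal truncations share them.\<close>

lemma char_ratio_iff_jump:
  assumes p: "p > 0" "degree F dvd p" and M: "M < \<infinity>"
  shows "M \<in> char_ratio F ` {1..} \<longleftrightarrow>
    card (trunc p {..M} ` puiseux_roots p F) \<noteq> card (trunc p {..<M} ` puiseux_roots p F)"
proof -
  obtain \<theta> where \<theta>: "\<theta> \<ge> 1" "M \<le> char_ratio F \<theta>" "\<And>j. 1 \<le> j \<Longrightarrow> j < \<theta> \<Longrightarrow> char_ratio F j < M"
    using ex_theta[of M] by blast
  note diff = card_trunc_le_diff[OF p M \<theta>]
  have "M \<in> char_ratio F ` {1..} \<longleftrightarrow> M = char_ratio F \<theta>"
  proof
    assume "M \<in> char_ratio F ` {1..}"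
    then obtain j where j: "j \<ge> 1" "M = char_ratio F j" by auto
    have "\<theta> \<le> j" using \<theta>(3)[OF j(1)] j(2) by (meson less_irrefl not_le)
    then show "M = char_ratio F \<theta>"
      using char_ratio_mono[OF \<theta>(1)] \<theta>(2) j(2) by (simp add: antisym)
  qed (use \<theta>(1) in auto)
  also have "\<dots> \<longleftrightarrow> card (trunc p {..M} ` puiseux_roots p F) \<noteq> card (trunc p {..<M} ` puiseux_roots p F)"
  proof
    assume eq: "M = char_ratio F \<theta>"
    then have gt: "char_d F \<theta> > 1"
      using M \<theta>(1) char_ratio_finite_iff char_d_gt_1_iff by simp
    have "char_d F (Suc \<theta>) < char_d F \<theta>" by (rule char_d_decreasing[OF \<theta>(1) gt])
    moreover have "char_d F (Suc \<theta>) > 0" by (rule char_d_pos) simp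
    ultimately have "real (degree F) / real (char_d F \<theta>) < real (degree F) / real (char_d F (Suc \<theta>))"
      using degree_irreducible_pos[OF irr] by (intro divide_strict_left_mono) (auto simp del: char_d.simps)
    then show "card (trunc p {..M} ` puiseux_roots p F) \<noteq> card (trunc p {..<M} ` puiseux_roots p F)"
      using card_trunc_less[OF p M \<theta>] card_trunc_le_eq[OF p M \<theta> eq] by (metis less_irrefl)
  next
    assume "card (trunc p {..M} ` puiseux_roots p F) \<noteq> card (trunc p {..<M} ` puiseux_roots p F)"
    then show "M = char_ratio F \<theta>" using diff by (auto split: if_splits)
  qed
  finally show ?thesis .
qed

text \<open>
  Hence \<open>\<theta>\<close> is determined by the characteristic exponents below \<open>M\<close>, which all elements of a point
  of level \<open>M\<close> share.
\<close>

lemma le_char_ratio_iff_card: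
  assumes "k \<ge> 1"
  shows "M \<le> char_ratio F k \<longleftrightarrow> card (char_ratio F ` {1..} \<inter> {..<M}) < k"
proof -
  obtain \<theta> where \<theta>: "\<theta> \<ge> 1" "M \<le> char_ratio F \<theta>" "\<And>j. 1 \<le> j \<Longrightarrow> j < \<theta> \<Longrightarrow> char_ratio F j < M"
    using ex_theta[of M] by blast
  have iff: "M \<le> char_ratio F j \<longleftrightarrow> \<theta> \<le> j" if "j \<ge> 1" for j
    using \<theta>(2) \<theta>(3)[OF that] char_ratio_mono[OF \<theta>(1), of j] by (meson le_less_trans not_le order_trans)
  have "char_ratio F ` {1..} \<inter> {..<M} = char_ratio F ` {1..<\<theta>}"
    using iff by (auto simp: not_le[symmetric] image_iff)
  moreover have "inj_on (char_ratio F) {1..<\<theta>}"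
  proof (rule linorder_inj_onI')
    fix i j assume ij: "i \<in> {1..<\<theta>}" "j \<in> {1..<\<theta>}" "i < j"
    then have "char_ratio F i < \<infinity>" using \<theta>(3)[of i] by (auto intro: less_le_trans)
    then show "char_ratio F i \<noteq> char_ratio F j"
      using char_ratio_strict_mono[of i j] ij char_ratio_finite_iff[of i] by auto
  qed
  ultimately have "card (char_ratio F ` {1..} \<inter> {..<M}) = \<theta> - 1"
    by (simp add: card_image)
  then show ?thesis using iff[OF assms] \<theta>(1) by auto
qed

end

section \<open>Roots of the derivative\<close>

text \<open>Components of \<open>f\<close> and \<open>f_y\<close> have degree at most
  \<open>degree f\<close>, so each degree divides the factorial. The square accommodates products of
  two degrees, the index at which \<open>contact\<close> is defined.\<close>

definition common_index :: "'a::field fls poly \<Rightarrow> nat" where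
  "common_index f = fact (degree f) * fact (degree f)"

lemma common_index_pos: "common_index f > 0"
  by (simp add: common_index_def)

lemma degree_dvd_common_index:
  assumes "F \<in> components H" "H \<noteq> 0" "degree H \<le> degree f"
    and "G \<in> components H'" "H' \<noteq> 0" "degree H' \<le> degree f"
  shows "degree F * degree G dvd common_index f"
proof -
  have "degree F > 0" "degree F \<le> degree f" "degree G > 0" "degree G \<le> degree f"
    using degree_component_le[OF assms(1,2)] degree_component_le[OF assms(4,5)] assms(3,6)
      degree_irreducible_pos componentsD(1)[OF assms(1)] componentsD(1)[OF assms(4)] by force+
  then show ?thesis
    unfolding common_index_def by (intro mult_dvd_mono dvd_fact) auto
qed

context
  fixes f :: "'a::{alg_closed_field, field_char_0} fls poly" and p :: nat
  assumes monic: "lead_coeff f = 1" and reduced: "squarefree f" and deg_f: "degree f > 0"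
  defines "p \<equiv> common_index f"
begin

lemma p_pos: "p > 0"
  by (simp add: p_def common_index_pos)

lemma f_nonzero: "f \<noteq> 0" and pderiv_nonzero: "pderiv f \<noteq> 0"
  using deg_f by (auto simp: pderiv_eq_0_iff)

lemma degree_mult_dvd_p:
  assumes "F \<in> components f \<union> components (pderiv f)" "G \<in> components f \<union> components (pderiv f)"
  shows "degree F * degree G dvd p"
proof -
  have "degree (pderiv f) \<le> degree f" by (simp add: degree_pderiv)
  then show ?thesis
    using assms f_nonzero pderiv_nonzero order_refl[of "degree f"] unfolding p_def
    by (blast intro: degree_dvd_common_index)
qed

lemma component_props:
  assumes "F \<in> components f \<union> components (pderiv f)"
  shows "irreducible F" "lead_coeff F = 1" "degree F dvd p"
  using assms componentsD dvd_mult_left[OF degree_mult_dvd_p[OF assms assms]] by auto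

lemmas component_finite_roots = finite_roots[OF component_props(1,2) p_pos component_props(3)]

lemma roots_disjoint:
  assumes "F \<in> components f" "G \<in> components f" "F \<noteq> G"
  shows "puiseux_roots p F \<inter> puiseux_roots p G = {}"
  using common_root_imp_eq[OF component_props[of F] component_props[of G] p_pos] assms by blast

text \<open>By transitivity of the roots of unity the sets of closed balls met by two components are
  equal or disjoint. In this form contact at least \<open>M\<close> is visibly an
  equivalence.\<close>

lemma trunc_less_image_iff:
  assumes "F \<in> components f \<union> components (pderiv f)" "G \<in> components f \<union> components (pderiv f)"
  shows "M \<le> contact F G \<longleftrightarrow>
      trunc p {..<M} ` puiseux_roots p F = trunc p {..<M} ` puiseux_roots p G" (is ?A)
    and "M \<le> contact F G \<longleftrightarrow>
      trunc p {..<M} ` puiseux_roots p F \<inter> trunc p {..<M} ` puiseux_roots p G \<noteq> {}" (is ?B)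
proof -
  have sub: "trunc p {..<M} ` puiseux_roots p F \<subseteq> trunc p {..<M} ` puiseux_roots p G"
    if c: "M \<le> contact F G" and F: "F \<in> components f \<union> components (pderiv f)"
      and G: "G \<in> components f \<union> components (pderiv f)" for F G
  proof
    fix s assume "s \<in> trunc p {..<M} ` puiseux_roots p F"
    then obtain y where y: "y \<in> puiseux_roots p F" "s = trunc p {..<M} y" by blast
    obtain z where "z \<in> puiseux_roots p G" "ord_x p (y - z) = contact F G"
      using contact_attained_at[OF component_props(1,2)[OF F] component_props(1,2)[OF G]
          p_pos degree_mult_dvd_p[OF F G] y(1)] by blast
    then show "s \<in> trunc p {..<M} ` puiseux_roots p G"
      using c y(2) by (intro image_eqI[of _ _ z]) (auto simp: trunc_less_eq_iff[OF p_pos])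
  qed
  have ne: "puiseux_roots p F \<noteq> {}"
    using roots_nonempty[OF component_props(1,2) p_pos component_props(3), OF assms(1) assms(1) assms(1)] .
  have "M \<le> contact F G"
    if meet: "trunc p {..<M} ` puiseux_roots p F \<inter> trunc p {..<M} ` puiseux_roots p G \<noteq> {}"
  proof -
    obtain y z where yz: "y \<in> puiseux_roots p F" "z \<in> puiseux_roots p G"
      "trunc p {..<M} y = trunc p {..<M} z"
      using meet by blast
    then have "M \<le> ord_x p (y - z)" by (simp add: trunc_less_eq_iff[OF p_pos])
    also have "\<dots> \<le> contact F G"
      using contact_upper[OF component_props(1,2)[OF assms(1)] component_props(1,2)[OF assms(2)]
          p_pos degree_mult_dvd_p[OF assms] yz(1,2)] .
    finally show ?thesis .
  qed
  moreover have "trunc p {..<M} ` puiseux_roots p F = trunc p {..<M} ` puiseux_roots p G"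
    if "M \<le> contact F G"
    using sub[OF that assms] sub[of G F] that assms by (simp add: contact_commute[of G F] subset_antisym)
  ultimately show ?A ?B
    using ne by blast+
qed

lemma trunc_le_image_iff:
  assumes "F \<in> components f \<union> components (pderiv f)" "G \<in> components f \<union> components (pderiv f)"
    and M: "M < \<infinity>"
  shows "M < contact F G \<longleftrightarrow>
      trunc p {..M} ` puiseux_roots p F = trunc p {..M} ` puiseux_roots p G" (is ?A)
    and "M < contact F G \<longleftrightarrow>
      trunc p {..M} ` puiseux_roots p F \<inter> trunc p {..M} ` puiseux_roots p G \<noteq> {}" (is ?B)
proof -
  have sub: "trunc p {..M} ` puiseux_roots p F \<subseteq> trunc p {..M} ` puiseux_roots p G"
    if c: "M < contact F G" and F: "F \<in> components f \<union> components (pderiv f)"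
      and G: "G \<in> components f \<union> components (pderiv f)" for F G
  proof
    fix s assume "s \<in> trunc p {..M} ` puiseux_roots p F"
    then obtain y where y: "y \<in> puiseux_roots p F" "s = trunc p {..M} y" by blast
    obtain z where "z \<in> puiseux_roots p G" "ord_x p (y - z) = contact F G"
      using contact_attained_at[OF component_props(1,2)[OF F] component_props(1,2)[OF G]
          p_pos degree_mult_dvd_p[OF F G] y(1)] by blast
    then show "s \<in> trunc p {..M} ` puiseux_roots p G"
      using c y(2) by (intro image_eqI[of _ _ z]) (auto simp: trunc_le_eq_iff[OF p_pos M])
  qed
  have ne: "puiseux_roots p F \<noteq> {}"
    using roots_nonempty[OF component_props(1,2) p_pos component_props(3), OF assms(1) assms(1) assms(1)] .
  have "M < contact F G"
    if meet: "trunc p {..M} ` puiseux_roots p F \<inter> trunc p {..M} ` puiseux_roots p G \<noteq> {}"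
  proof -
    obtain y z where yz: "y \<in> puiseux_roots p F" "z \<in> puiseux_roots p G"
      "trunc p {..M} y = trunc p {..M} z"
      using meet by blast
    then have "M < ord_x p (y - z)" by (simp add: trunc_le_eq_iff[OF p_pos M])
    also have "\<dots> \<le> contact F G"
      using contact_upper[OF component_props(1,2)[OF assms(1)] component_props(1,2)[OF assms(2)]
          p_pos degree_mult_dvd_p[OF assms(1,2)] yz(1,2)] .
    finally show ?thesis .
  qed
  moreover have "trunc p {..M} ` puiseux_roots p F = trunc p {..M} ` puiseux_roots p G"
    if "M < contact F G"
    using sub[OF that assms(1,2)] sub[of G F] that assms by (simp add: contact_commute[of G F] subset_antisym)
  ultimately show ?A ?B
    using ne by blast+
qed

lemma contact_self: "F \<in> components f \<Longrightarrow> contact F F = \<infinity>"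
  using trunc_less_image_iff(1)[of F F \<infinity>] by simp

lemma count_roots_preimage:
  assumes "finite T"
  shows "count_roots p (pderiv f) {z. g z \<in> T} = (\<Sum>t\<in>T. count_roots p (pderiv f) {z. g z = t})"
proof -
  have "card (A \<inter> {z. g z \<in> T}) = (\<Sum>t\<in>T. card (A \<inter> {z. g z = t}))" if "finite A" for A
  proof -
    have "A \<inter> {z. g z \<in> T} = (\<Union>t\<in>T. A \<inter> {z. g z = t})" by auto
    then show ?thesis
      using that assms by (simp only:) (intro card_UN_disjoint, auto)
  qed
  then have "count_roots p (pderiv f) {z. g z \<in> T} =
      (\<Sum>G\<in>components (pderiv f). mult_of G (pderiv f) * (\<Sum>t\<in>T. card (puiseux_roots p G \<inter> {z. g z = t})))"
    unfolding count_roots_def using component_finite_roots by (intro sum.cong) auto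
  also have "\<dots> = (\<Sum>t\<in>T. count_roots p (pderiv f) {z. g z = t})"
    unfolding count_roots_def sum_distrib_left by (rule sum.swap)
  finally show ?thesis .
qed

lemma count_roots_f:
  "count_roots p f S = card ((\<Union>G\<in>components f. puiseux_roots p G) \<inter> S)"
proof -
  have "(\<Union>G\<in>components f. puiseux_roots p G) \<inter> S = (\<Union>G\<in>components f. puiseux_roots p G \<inter> S)" by auto
  also have "card \<dots> = (\<Sum>G\<in>components f. card (puiseux_roots p G \<inter> S))"
    using components_factorization(1)[OF f_nonzero] roots_disjoint component_finite_roots
    by (intro card_UN_disjoint) auto
  also have "\<dots> = count_roots p f S"
    unfolding count_roots_def by (intro sum.cong) (auto simp: mult_of_squarefree[OF reduced])
  finally show ?thesis ..
qed

text \<open>\<open>rolle_ball\<close> is summed over the fibres of the truncation. The assumption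
  \<open>S\<close> makes each fibre a ball, and \<open>closed\<close> puts all roots of
  \<open>f\<close> in it into \<open>Y\<close>, so each fibre loses exactly one root.\<close>

lemma count_derivative_roots_near:
  assumes S: "\<And>i. ereal (real_of_int i / real p) \<in> S \<longleftrightarrow> i < r"
    and Y: "Y \<subseteq> (\<Union>G\<in>components f. puiseux_roots p G)"
    and closed: "\<And>z y. z \<in> (\<Union>G\<in>components f. puiseux_roots p G) \<Longrightarrow> y \<in> Y \<Longrightarrow>
      trunc p S z = trunc p S y \<Longrightarrow> z \<in> Y"
  shows "count_roots p (pderiv f) {z. trunc p S z \<in> trunc p S ` Y} + card (trunc p S ` Y) = card Y"
proof -
  have "finite (\<Union>G\<in>components f. puiseux_roots p G)"
    using components_factorization(1)[OF f_nonzero] component_finite_roots by auto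
  then have finY: "finite Y" using Y finite_subset by blast
  have ball: "count_roots p (pderiv f) {z. trunc p S z = t} + 1 = card (Y \<inter> {z. trunc p S z = t})"
    if "t \<in> trunc p S ` Y" for t
  proof -
    from that obtain b where b: "b \<in> Y" "t = trunc p S b" by blast
    have eq: "{z. trunc p S z = t} = ball_int b r"
      by (auto simp: b(2) trunc_eq_iff ball_int_def S)
    have "(\<Union>G\<in>components f. puiseux_roots p G) \<inter> {z. trunc p S z = t} = Y \<inter> {z. trunc p S z = t}"
      using Y closed[OF _ b(1)] unfolding b(2) by blast
    then have f: "count_roots p f (ball_int b r) = card (Y \<inter> {z. trunc p S z = t})"
      unfolding count_roots_f eq by simp
    have pos: "count_roots p f (ball_int b r) > 0"
      unfolding f card_gt_0_iff using finY b by auto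
    have "count_roots p (pderiv f) (ball_int b r) = count_roots p f (ball_int b r) - 1"
      by (rule rolle_ball[OF f_nonzero pderiv_nonzero p_pos _ _ pos]) (rule component_props(3); simp)+
    then show ?thesis using pos f unfolding eq by simp
  qed
  have "card Y = (\<Sum>t\<in>trunc p S ` Y. card (Y \<inter> {z. trunc p S z = t}))"
  proof -
    have "card Y = card (\<Union>t\<in>trunc p S ` Y. Y \<inter> {z. trunc p S z = t})"
      by (rule arg_cong[of _ _ card]) blast
    also have "\<dots> = (\<Sum>t\<in>trunc p S ` Y. card (Y \<inter> {z. trunc p S z = t}))"
      using finY by (intro card_UN_disjoint) auto
    finally show ?thesis .
  qed
  also have "\<dots> = (\<Sum>t\<in>trunc p S ` Y. count_roots p (pderiv f) {z. trunc p S z = t} + 1)"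
    using ball by (intro sum.cong) auto
  finally show ?thesis
    using finY unfolding sum.distrib by (simp add: count_roots_preimage)
qed

section \<open>The balls around the roots of one point\<close>

context
  fixes M :: ereal and P :: "'a fls poly set"
  assumes M: "\<bar>M\<bar> \<noteq> \<infinity>" and P: "P \<subseteq> components f" "P \<noteq> {}"
    and P_class: "\<And>F G. F \<in> P \<Longrightarrow> G \<in> components f \<Longrightarrow> G \<in> P \<longleftrightarrow> M \<le> contact F G"
begin

definition "roots_of_class = (\<Union>F\<in>P. puiseux_roots p F)"

text \<open>Mutual contact at least \<open>M\<close> makes all elements of the class meet the same
  closed balls, so any representative will do.\<close>

lemma trunc_less_class: "F \<in> P \<Longrightarrow> trunc p {..<M} ` roots_of_class = trunc p {..<M} ` puiseux_roots p F"
proof -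
  assume F: "F \<in> P"
  have eq: "trunc p {..<M} ` puiseux_roots p G = trunc p {..<M} ` puiseux_roots p F" if "G \<in> P" for G
  proof -
    have "F \<in> components f" "G \<in> components f" using F that P(1) by auto
    moreover from this have "M \<le> contact F G" using P_class[OF F] that by simp
    ultimately show ?thesis using trunc_less_image_iff(1)[of F G M] by simp
  qed
  have "trunc p {..<M} ` roots_of_class = (\<Union>G\<in>P. trunc p {..<M} ` puiseux_roots p G)"
    by (simp only: roots_of_class_def image_UN)
  also have "\<dots> = (\<Union>G\<in>P. trunc p {..<M} ` puiseux_roots p F)"
    by (intro SUP_cong refl eq)
  finally show ?thesis using F by auto
qed

lemma roots_of_class_closed:
  assumes "z \<in> (\<Union>G\<in>components f. puiseux_roots p G)" "y \<in> roots_of_class"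
    and "trunc p {..<M} z = trunc p {..<M} y"
  shows "z \<in> roots_of_class"
proof -
  obtain G F where G: "G \<in> components f" "z \<in> puiseux_roots p G" and F: "F \<in> P" "y \<in> puiseux_roots p F"
    using assms by (auto simp: roots_of_class_def)
  then have "M \<le> contact F G"
    using trunc_less_image_iff(2)[of F G M] P(1) assms(3) by blast
  then have "G \<in> P" using P_class[OF F(1) G(1)] by simp
  with G show ?thesis by (auto simp: roots_of_class_def)
qed

lemma trunc_le_imp_less: "trunc p {..M} z = trunc p {..M} y \<Longrightarrow> trunc p {..<M} z = trunc p {..<M} y"
  by (auto simp: trunc_eq_iff)

text \<open>
  A component has contact \<open>M\<close> with all elements of \<open>P\<close> iff its roots lie in the balls of radius
  \<open>M\<close> around the roots of \<open>P\<close>, but in none of the smaller open balls.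
\<close>

lemma degree_Q_part:
  "degree (Q_part (pderiv f) M P) + card (trunc p {..<M} ` roots_of_class)
     = card (trunc p {..M} ` roots_of_class)"
proof -
  let ?f' = "pderiv f" and ?Y = roots_of_class
  define B0 where "B0 = {z. trunc p {..<M} z \<in> trunc p {..<M} ` ?Y}"
  define B1 where "B1 = {z. trunc p {..M} z \<in> trunc p {..M} ` ?Y}"
  define X where "X = {G \<in> components ?f'. \<forall>F \<in> P. contact G F = M}"
  obtain m where m: "M = ereal m" using M by (cases M) auto
  have fin: "M < \<infinity>" by (simp add: m)
  have Y: "?Y \<subseteq> (\<Union>G\<in>components f. puiseux_roots p G)"
    using P(1) by (auto simp: roots_of_class_def)
  have finX: "finite (components ?f')"
    by (rule components_factorization(1)[OF pderiv_nonzero])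
  have count0: "count_roots p ?f' B0 + card (trunc p {..<M} ` ?Y) = card ?Y"
    unfolding B0_def
  proof (rule count_derivative_roots_near[OF _ Y roots_of_class_closed])
    \<comment> \<open>\<open>M\<close> need not be a multiple of \<open>1 / p\<close>, hence the
      ceiling; with \<open>i \<le> M * p\<close> allowed, the open balls below need the floor plus
      one.\<close>
    show "ereal (real_of_int i / real p) \<in> {..<M} \<longleftrightarrow> i < \<lceil>m * real p\<rceil>" for i
      using p_pos by (simp add: m less_ceiling_iff pos_divide_less_eq)
  qed
  have count1: "count_roots p ?f' B1 + card (trunc p {..M} ` ?Y) = card ?Y"
    unfolding B1_def
  proof (rule count_derivative_roots_near[OF _ Y])
    show "ereal (real_of_int i / real p) \<in> {..M} \<longleftrightarrow> i < \<lfloor>m * real p\<rfloor> + 1" for i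
      using p_pos by (simp add: m pos_divide_le_eq flip: le_floor_iff)
  qed (rule roots_of_class_closed[OF _ _ trunc_le_imp_less])
  have "B1 \<subseteq> B0"
    by (auto simp: B0_def B1_def image_iff intro: trunc_le_imp_less)
  \<comment> \<open>The subtraction in \<open>nat\<close> loses nothing because \<open>B1\<close> is
    contained in \<open>B0\<close>.\<close>
  have card: "card (puiseux_roots p G \<inter> B0) - card (puiseux_roots p G \<inter> B1)
      = (if G \<in> X then degree G else 0)" if G: "G \<in> components ?f'" for G
  proof -
    let ?R = "puiseux_roots p G"
    have in_B0: "z \<in> B0 \<longleftrightarrow> (\<exists>y\<in>?Y. M \<le> ord_x p (z - y))" for z
      by (auto simp: B0_def trunc_less_eq_iff[OF p_pos] image_iff)
    have in_B1: "z \<in> B1 \<longleftrightarrow> (\<exists>y\<in>?Y. M < ord_x p (z - y))" for z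
      by (auto simp: B1_def trunc_le_eq_iff[OF p_pos fin] image_iff)
    have contact: "\<exists>y\<in>puiseux_roots p F. ord_x p (z - y) = contact G F"
      "\<And>y. y \<in> puiseux_roots p F \<Longrightarrow> ord_x p (z - y) \<le> contact G F"
      if "F \<in> P" "z \<in> ?R" for F z
      using contact_attained_at[OF component_props(1,2) component_props(1,2) p_pos degree_mult_dvd_p, of G F]
        contact_upper[OF component_props(1,2) component_props(1,2) p_pos degree_mult_dvd_p, of G F]
        that G P(1) by auto
    show ?thesis
    proof (cases "G \<in> X")
      case True
      then have c: "contact G F = M" if "F \<in> P" for F using that by (simp add: X_def)
      obtain F where F: "F \<in> P" using P(2) by blast
      have "?R \<subseteq> B0"
      proof
        fix z assume "z \<in> ?R"
        then obtain y where "y \<in> puiseux_roots p F" "ord_x p (z - y) = M"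
          using contact(1)[OF F] c[OF F] by metis
        then show "z \<in> B0" using F by (auto simp: in_B0 roots_of_class_def)
      qed
      moreover have "?R \<inter> B1 = {}"
      proof -
        have "\<not> M < ord_x p (z - y)" if "z \<in> ?R" "F \<in> P" "y \<in> puiseux_roots p F" for z y F
          using contact(2)[OF that(2,1,3)] c[OF that(2)] by simp
        then show ?thesis by (auto simp: in_B1 roots_of_class_def)
      qed
      moreover have "card ?R = degree G"
        using card_roots[OF component_props(1,2) p_pos component_props(3), of G] G by blast
      ultimately show ?thesis
        using True by (simp add: Int_absorb2)
    next
      case False
      \<comment> \<open>A root in \<open>B0\<close> but not in \<open>B1\<close> would force contact
        \<open>M\<close> with every element of \<open>P\<close>: missing \<open>B1\<close> bounds
        the contacts above, and by \<open>trunc_less_class\<close> each element has a root in the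
        closed ball of \<open>z\<close>.\<close>
      have "z \<in> B1" if z: "z \<in> ?R" "z \<in> B0" for z
      proof (rule ccontr)
        assume "z \<notin> B1"
        have "contact G F = M" if F: "F \<in> P" for F
        proof (rule antisym)
          obtain y where y: "y \<in> puiseux_roots p F" "ord_x p (z - y) = contact G F"
            using contact(1)[OF F z(1)] by blast
          then have "y \<in> ?Y" using F by (auto simp: roots_of_class_def)
          with \<open>z \<notin> B1\<close> y(2) show "contact G F \<le> M" by (fastforce simp: in_B1 not_less)
          obtain y' where "y' \<in> puiseux_roots p F" "trunc p {..<M} z = trunc p {..<M} y'"
            using z(2) by (auto simp: B0_def trunc_less_class[OF F])
          then show "M \<le> contact G F"
            using contact(2)[OF F z(1), of y'] by (auto simp: trunc_less_eq_iff[OF p_pos])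
        qed
        with False G show False by (simp add: X_def)
      qed
      then have "?R \<inter> B0 = ?R \<inter> B1" using \<open>B1 \<subseteq> B0\<close> by blast
      then show ?thesis using False by simp
    qed
  qed
  have "degree (Q_part ?f' M P) = (\<Sum>G\<in>X. mult_of G ?f' * degree G)"
  proof -
    have nz: "G \<noteq> 0" if "G \<in> X" for G
      using that componentsD(2) by (fastforce simp: X_def)
    have "Q_part ?f' M P = (\<Prod>G\<in>X. G ^ mult_of G ?f')"
      by (simp add: Q_part_altdef X_def)
    also have "degree \<dots> = (\<Sum>G\<in>X. degree (G ^ mult_of G ?f'))"
      using nz by (intro degree_prod_eq_sum_degree) auto
    also have "\<dots> = (\<Sum>G\<in>X. mult_of G ?f' * degree G)"
      using nz by (intro sum.cong) (auto simp: degree_power_eq)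
    finally show ?thesis .
  qed
  also have "\<dots> = (\<Sum>G\<in>components ?f'. mult_of G ?f' * (if G \<in> X then degree G else 0))"
    using finX by (intro sum.mono_neutral_cong_left) (auto simp: X_def)
  also have "\<dots> = (\<Sum>G\<in>components ?f'. mult_of G ?f' * (card (puiseux_roots p G \<inter> B0) - card (puiseux_roots p G \<inter> B1)))"
    using card by (intro sum.cong) auto
  finally have "degree (Q_part ?f' M P) + count_roots p ?f' B1 =
      (\<Sum>G\<in>components ?f'. mult_of G ?f' * (card (puiseux_roots p G \<inter> B0) - card (puiseux_roots p G \<inter> B1))
         + mult_of G ?f' * card (puiseux_roots p G \<inter> B1))"
    by (simp add: count_roots_def sum.distrib)
  also have "\<dots> = count_roots p ?f' B0"
    unfolding count_roots_def
  proof (intro sum.cong refl)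
    fix G assume "G \<in> components ?f'"
    then have "card (puiseux_roots p G \<inter> B1) \<le> card (puiseux_roots p G \<inter> B0)"
      using component_finite_roots \<open>B1 \<subseteq> B0\<close> by (intro card_mono) auto
    then show "mult_of G ?f' * (card (puiseux_roots p G \<inter> B0) - card (puiseux_roots p G \<inter> B1))
         + mult_of G ?f' * card (puiseux_roots p G \<inter> B1) = mult_of G ?f' * card (puiseux_roots p G \<inter> B0)"
      by (simp flip: distrib_left)
  qed
  finally show ?thesis using count0 count1 by linarith
qed

text \<open>At each \<open>N < M\<close> both kinds of truncation agree for the two components, so
  \<open>char_ratio_iff_jump\<close> sees the same jumps.\<close>

lemma char_ratio_below_M_eq:
  assumes "F \<in> P" "G \<in> P"
  shows "char_ratio F ` {1..} \<inter> {..<M} = char_ratio G ` {1..} \<inter> {..<M}"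
proof -
  have F: "F \<in> components f \<union> components (pderiv f)" and G: "G \<in> components f \<union> components (pderiv f)"
    using assms P(1) by auto
  have c: "M \<le> contact F G" using P_class[OF assms(1)] assms(2) P(1) by blast
  have "N \<in> char_ratio F ` {1..} \<longleftrightarrow> N \<in> char_ratio G ` {1..}" if "N < M" for N
  proof -
    have N: "N < \<infinity>" using that by (auto intro: less_le_trans)
    have "trunc p {..N} ` puiseux_roots p F = trunc p {..N} ` puiseux_roots p G"
      "trunc p {..<N} ` puiseux_roots p F = trunc p {..<N} ` puiseux_roots p G"
      using trunc_le_image_iff(1)[OF F G N] trunc_less_image_iff(1)[OF F G, of N] c that by auto
    then show ?thesis
      using char_ratio_iff_jump[OF component_props(1,2)[OF F] p_pos component_props(3)[OF F] N]
        char_ratio_iff_jump[OF component_props(1,2)[OF G] p_pos component_props(3)[OF G] N] by simp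
  qed
  then show ?thesis by blast
qed

text \<open>The number \<open>c\<close> of ratios below \<open>M\<close> is common to
  \<open>P\<close>, so the index defined by all elements jointly is \<open>Suc c\<close> and is the
  right one for each element.\<close>

lemma theta_props:
  assumes theta: "\<theta> = (LEAST k. 1 \<le> k \<and> (\<forall>F \<in> P. M \<le> char_ratio F k))" and F: "F \<in> P"
  shows "\<theta> \<ge> 1" "M \<le> char_ratio F \<theta>" "\<And>j. 1 \<le> j \<Longrightarrow> j < \<theta> \<Longrightarrow> char_ratio F j < M"
proof -
  define c where "c = card (char_ratio F ` {1..} \<inter> {..<M})"
  have iff: "M \<le> char_ratio G k \<longleftrightarrow> c < k" if "G \<in> P" "k \<ge> 1" for G k
    using le_char_ratio_iff_card[OF component_props(1,2), of G k M] that P(1)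
      char_ratio_below_M_eq[OF F that(1)] by (auto simp: c_def)
  have "\<theta> = (LEAST k. 1 \<le> k \<and> c < k)"
    unfolding theta using iff F by (intro arg_cong[of _ _ Least]) auto
  also have "\<dots> = Suc c"
    by (rule Least_equality) auto
  finally have "\<theta> = Suc c" .
  with iff[OF F] show "\<theta> \<ge> 1" "M \<le> char_ratio F \<theta>"
    "\<And>j. 1 \<le> j \<Longrightarrow> j < \<theta> \<Longrightarrow> char_ratio F j < M"
    by (auto simp flip: not_le)
qed

end

end

section \<open>The tree\<close>

text \<open>For \<open>F\<close> in \<open>components_at f M\<close> no restriction to that set is
  required: a further component with contact at least \<open>M\<close> belongs to it with
  \<open>F\<close> as witness.\<close>

definition contact_class :: "'a::field fls poly \<Rightarrow> ereal \<Rightarrow> 'a fls poly \<Rightarrow> 'a fls poly set" where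
  "contact_class f M F = {G \<in> components f. M \<le> contact F G}"

context
  fixes f :: "'a::{alg_closed_field, field_char_0} fls poly"
  assumes monic: "lead_coeff f = 1" and reduced: "squarefree f" and deg_f: "degree f > 0"
begin

lemma f_components: "F \<in> components f \<Longrightarrow> F \<in> components f \<union> components (pderiv f)"
  by simp

lemmas comp_props = component_props[OF monic reduced deg_f f_components]

lemma contact_class_eq:
  assumes "F \<in> components f" "F' \<in> contact_class f M F"
  shows "contact_class f M F' = contact_class f M F"
proof -
  have F': "F' \<in> components f" "M \<le> contact F F'"
    using assms(2) by (auto simp: contact_class_def)
  note iff = trunc_less_image_iff(1)[OF monic reduced deg_f f_components f_components]
  have "M \<le> contact F' G \<longleftrightarrow> M \<le> contact F G" if "G \<in> components f" for G
    using iff[OF assms(1) F'(1), of M] iff[OF assms(1) that, of M] iff[OF F'(1) that, of M] F'(2)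
    by simp
  then show ?thesis by (auto simp: contact_class_def)
qed

lemma self_in_contact_class: "F \<in> components f \<Longrightarrow> F \<in> contact_class f M F"
  by (simp add: contact_class_def contact_self[OF monic reduced deg_f])

lemma rel_at_Image:
  assumes "F \<in> components_at f M"
  shows "rel_at f M `` {F} = contact_class f M F"
proof -
  have F: "F \<in> components f" using assms by (simp add: components_at_def)
  have "G \<in> components_at f M" if "G \<in> components f" "M \<le> contact F G" for G
  proof (cases "G = F")
    case False
    then show ?thesis
      using that F by (auto simp: components_at_def contact_commute[of G F])
  qed (use assms in simp)
  then show ?thesis
    using assms contact_self[OF monic reduced deg_f F]
    by (auto simp: rel_at_def contact_class_def components_at_def)
qed

lemma tree_iff:
  "(M, P) \<in> tree f \<longleftrightarrow>
    M \<in> contact_levels f \<and> (\<exists>F\<in>components_at f M. P = contact_class f M F)"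
  using rel_at_Image by (auto simp: tree_def quotient_def)

lemma tree_class:
  assumes "(M, P) \<in> tree f" "F \<in> P"
  shows "P = contact_class f M F" "F \<in> components f"
proof -
  obtain F0 where F0: "F0 \<in> components_at f M" "P = contact_class f M F0"
    using assms(1) by (auto simp: tree_iff)
  then have "F0 \<in> components f" by (simp add: components_at_def)
  with assms(2) F0 show "P = contact_class f M F" "F \<in> components f"
    using contact_class_eq[of F0 F M] by (auto simp: contact_class_def)
qed

lemma tree_subset_components_at:
  assumes "(M, P) \<in> tree f"
  shows "P \<subseteq> components_at f M"
proof -
  obtain F0 where F0: "F0 \<in> components_at f M" "P = contact_class f M F0"
    using assms by (auto simp: tree_iff)
  have "rel_at f M `` {F0} \<subseteq> components_at f M" by (auto simp: rel_at_def)
  then show ?thesis using rel_at_Image[OF F0(1)] F0(2) by simp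
qed

lemma tree_nonempty: "(M, P) \<in> tree f \<Longrightarrow> P \<noteq> {}"
  using self_in_contact_class by (auto simp: tree_iff components_at_def)

lemma components_at_antimono: "M \<le> N \<Longrightarrow> components_at f N \<subseteq> components_at f M"
  by (auto simp: components_at_def intro: order_trans)

lemma finite_contact_levels: "finite (contact_levels f)"
proof -
  have fin: "finite (components f)"
    using components_factorization(1)[of f] deg_f by fastforce
  have "{contact F G | F G. F \<in> components f \<and> G \<in> components f \<and> F \<noteq> G}
      \<subseteq> (\<lambda>(F, G). contact F G) ` (components f \<times> components f)" by auto
  then show ?thesis
    unfolding contact_levels_def using fin finite_subset by blast
qed

lemma contact_levels_finite:
  assumes "M \<in> contact_levels f"
  shows "\<bar>M\<bar> \<noteq> \<infinity>"
proof -
  consider F G where "F \<in> components f" "G \<in> components f" "F \<noteq> G" "M = contact F G"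
    | F j where "F \<in> components f" "j \<in> {1..char_h F}" "M = char_ratio F j"
    using assms by (auto simp: contact_levels_def)
  then show ?thesis
  proof cases
    case 1
    note * = comp_props(1,2)[OF 1(1)] comp_props(1,2)[OF 1(2)] p_pos[OF monic reduced deg_f]
      degree_mult_dvd_p[OF monic reduced deg_f f_components[OF 1(1)] f_components[OF 1(2)]]
    show ?thesis
      using contact_not_MInf[OF *] contact_not_PInf[OF * 1(3)] 1(4) by auto
  next
    case 2
    then have "char_d F j > 1"
      using char_d_gt_1_iff[OF comp_props(1,2)[OF 2(1)]] by simp
    then show ?thesis
      using char_ratio_eq[OF comp_props(1,2)[OF 2(1)]] 2 by simp
  qed
qed

section \<open>Points strictly above a given point\<close>

context
  fixes M :: ereal and P :: "'a fls poly set"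
  assumes point: "(M, P) \<in> tree f" and not_top: "(M, P) \<notin> Top f"
begin

text \<open>All points strictly dominating the given one sit at this level. The minimum exists
  because the levels are finite in number and the point is not maximal.\<close>

definition "next_level = Min {N \<in> contact_levels f. M < N}"

lemma not_top_witness: "\<exists>N R. (N, R) \<in> tree f \<and> M < N \<and> R \<subseteq> P"
proof -
  obtain N R where NR: "(N, R) \<in> tree f" "M \<le> N" "R \<subseteq> P" "(N, R) \<noteq> (M, P)"
    using point not_top by (fastforce simp: Top_def dominates_def)
  have "N \<noteq> M"
  proof
    assume "N = M"
    obtain F where F: "F \<in> R" using tree_nonempty[OF NR(1)] by blast
    then have "R = contact_class f N F" "P = contact_class f M F"
      using tree_class(1)[OF NR(1) F] tree_class(1)[OF point] NR(3) by auto
    with \<open>N = M\<close> NR(4) show False by simp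
  qed
  with NR show ?thesis by (auto simp: less_le)
qed

lemma next_level: "next_level \<in> contact_levels f" "M < next_level"
  "\<And>N. N \<in> contact_levels f \<Longrightarrow> M < N \<Longrightarrow> next_level \<le> N"
proof -
  have fin: "finite {N \<in> contact_levels f. M < N}"
    using finite_contact_levels by simp
  moreover have "{N \<in> contact_levels f. M < N} \<noteq> {}"
    using not_top_witness by (auto simp: tree_iff)
  ultimately have "next_level \<in> {N \<in> contact_levels f. M < N}"
    unfolding next_level_def by (rule Min_in)
  then show "next_level \<in> contact_levels f" "M < next_level" by auto
  show "\<And>N. N \<in> contact_levels f \<Longrightarrow> M < N \<Longrightarrow> next_level \<le> N"
    unfolding next_level_def using fin by (intro Min_le) auto
qed

text \<open>Contacts of distinct components are themselves levels, so none lies strictly between.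
  This matches open balls of radius \<open>M\<close> with points at the next level.\<close>

lemma contact_gt_iff_next_level:
  assumes "F \<in> components f" "G \<in> components f"
  shows "M < contact F G \<longleftrightarrow> next_level \<le> contact F G"
proof (cases "F = G")
  case True
  then show ?thesis
    using contact_self[OF monic reduced deg_f assms(1)] next_level(2) by (auto intro: less_le_trans)
next
  case False
  then have "contact F G \<in> contact_levels f"
    using assms by (auto simp: contact_levels_def)
  then show ?thesis using next_level(2,3) by (auto intro: less_le_trans)
qed

lemma strictly_dominates_iff:
  assumes "(N, R) \<in> tree f"
  shows "strictly_dominates f (N, R) (M, P) \<longleftrightarrow> N = next_level \<and> R \<subseteq> P"
proof -
  have "N \<in> contact_levels f" using assms by (simp add: tree_iff)
  then show ?thesis
    using next_level
    by (auto simp: strictly_dominates_def dominates_def intro!: antisym not_less_iff_gr_or_eq[THEN iffD2]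
        dest: less_imp_le less_le_trans) (force simp: not_less)+
qed

lemma point_above:
  assumes "F \<in> P" "F \<in> components_at f next_level"
  shows "(next_level, contact_class f next_level F) \<in> tree f"
    and "strictly_dominates f (next_level, contact_class f next_level F) (M, P)"
proof -
  show t: "(next_level, contact_class f next_level F) \<in> tree f"
    using assms(2) next_level(1) by (auto simp: tree_iff)
  have "contact_class f next_level F \<subseteq> P"
    unfolding tree_class(1)[OF point assms(1)] using next_level(2)
    by (auto simp: contact_class_def)
  with t show "strictly_dominates f (next_level, contact_class f next_level F) (M, P)"
    by (simp add: strictly_dominates_iff)
qed

text \<open>The witness against maximality may lie several levels up; its elements are still present
  at the next level because \<open>components_at\<close> only shrinks upwards.\<close>

lemma ex_strictly_dominates: "\<exists>q\<in>tree f. strictly_dominates f q (M, P)"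
proof -
  obtain N R where NR: "(N, R) \<in> tree f" "M < N" "R \<subseteq> P"
    using not_top_witness by blast
  obtain F where F: "F \<in> R" using tree_nonempty[OF NR(1)] by blast
  have "next_level \<le> N"
    using NR next_level(3) by (simp add: tree_iff)
  then have "F \<in> components_at f next_level"
    using F tree_subset_components_at[OF NR(1)] components_at_antimono by blast
  with F NR(3) show ?thesis using point_above by blast
qed

text \<open>An element present at the next level spans a class there, which is a point strictly
  above; \<open>D_set\<close> is thus what leaves the tree right after \<open>M\<close>.\<close>

lemma D_set_iff: "F \<in> D_set f M P \<longleftrightarrow> F \<in> P \<and> F \<notin> components_at f next_level"
proof
  assume F: "F \<in> D_set f M P"
  then have "F \<in> P" by (simp add: D_set_def)
  moreover have "F \<notin> components_at f next_level"
  proof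
    assume "F \<in> components_at f next_level"
    then have "F \<notin> snd (next_level, contact_class f next_level F)"
      using F point_above \<open>F \<in> P\<close> unfolding D_set_def by blast
    then show False
      using self_in_contact_class tree_class(2)[OF point \<open>F \<in> P\<close>] by simp
  qed
  ultimately show "F \<in> P \<and> F \<notin> components_at f next_level" ..
next
  assume F: "F \<in> P \<and> F \<notin> components_at f next_level"
  have "F \<notin> snd q" if "q \<in> tree f" "strictly_dominates f q (M, P)" for q
  proof -
    obtain N R where "q = (N, R)" by (cases q)
    with that have "N = next_level" "R \<subseteq> components_at f N"
      using strictly_dominates_iff[of N R] tree_subset_components_at[of N R] by auto
    with F \<open>q = _\<close> show ?thesis by auto
  qed
  with F show "F \<in> D_set f M P" by (simp add: D_set_def)
qed

text \<open>A larger contact would reach the next level and keep \<open>F\<close> in the tree. Hence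
  no other component meets the open balls of \<open>F\<close>.\<close>

lemma D_set_contact:
  assumes "F \<in> D_set f M P" "G \<in> components f" "G \<noteq> F"
  shows "contact F G \<le> M"
proof (rule ccontr)
  assume "\<not> contact F G \<le> M"
  moreover have F: "F \<in> components f" "F \<notin> components_at f next_level"
    using assms(1) tree_class(2)[OF point] by (auto simp: D_set_iff)
  ultimately have "next_level \<le> contact F G"
    using contact_gt_iff_next_level[OF F(1) assms(2)] by (metis not_le)
  then show False
    using F assms(2,3) by (auto simp: components_at_def)
qed

text \<open>A larger ratio is again a level and would keep \<open>F\<close> in the tree. Hence the
  roots of \<open>F\<close> lie in pairwise different open balls, which yields the summand
  \<open>n_F\<close>.\<close>

lemma D_set_char_ratio:
  assumes "F \<in> D_set f M P" "j \<in> {1..char_h F}"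
  shows "char_ratio F j \<le> M"
proof (rule ccontr)
  assume "\<not> char_ratio F j \<le> M"
  moreover have F: "F \<in> components f" "F \<notin> components_at f next_level"
    using assms(1) tree_class(2)[OF point] by (auto simp: D_set_iff)
  moreover have "char_ratio F j \<in> contact_levels f"
    unfolding contact_levels_def using F(1) assms(2) by blast
  ultimately have "next_level \<le> char_ratio F j"
    using next_level(3) by simp
  then show False
    using F assms(2) by (auto simp: components_at_def)
qed

end

end

theorem proposition7p6:
  fixes f :: "'a::{alg_closed_field, field_char_0} fls poly"
    and M :: ereal and P :: "'a fls poly set"
    and t :: nat and N :: "nat \<Rightarrow> ereal" and R :: "nat \<Rightarrow> 'a fls poly set"
    and \<theta> :: nat and Fl :: "nat \<Rightarrow> 'a fls poly"
  assumes monic: "lead_coeff f = 1"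
    and reduced: "squarefree f"
    and point: "(M, P) \<in> tree f"
    and not_top: "(M, P) \<notin> Top f"
    and enum: "bij_betw (\<lambda>l. (N l, R l)) {1..t} {q \<in> tree f. strictly_dominates f q (M, P)}"
    and theta: "\<theta> = (LEAST k. 1 \<le> k \<and> (\<forall>F \<in> P. M \<le> char_ratio F k))"
    and Fl: "\<And>l. l \<in> {1..t} \<Longrightarrow> Fl l \<in> R l"
  shows "(M \<noteq> char_ratio (Fl 1) \<theta> \<longrightarrow>
      real (degree (Q_part (pderiv f) M P)) =
        (\<Sum>F \<in> D_set f M P. real (degree F))
        + (\<Sum>l = 2..t. real (degree (Fl l))
            - (\<Sum>j | j \<in> {1..char_h (Fl l)} \<and> M < char_ratio (Fl l) j.
                (real (char_e (Fl l) j) - 1) * (real (degree (Fl l)) / real (char_d (Fl l) j)))))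
    \<and> (M = char_ratio (Fl 1) \<theta> \<longrightarrow>
      real (degree (Q_part (pderiv f) M P)) =
        (\<Sum>F \<in> D_set f M P. real (degree F))
        + (\<Sum>l = 2..t. real (degree (Fl l))
            - (\<Sum>j | j \<in> {1..char_h (Fl l)} \<and> M < char_ratio (Fl l) j.
                (real (char_e (Fl l) j) - 1) * (real (degree (Fl l)) / real (char_d (Fl l) j))))
        + (real (char_e (Fl 1) \<theta>) - 1) * (real (degree (Fl 1)) / real (char_d (Fl 1) \<theta>)))"
proof -
  have "f \<noteq> 0" using monic by auto
  have deg_f: "degree f > 0"
  proof -
    obtain F where "F \<in> components f"
      using point by (auto simp: tree_def contact_levels_def)
    then show ?thesis
      using degree_irreducible_pos[OF componentsD(1)] degree_component_le \<open>f \<noteq> 0\<close>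
      by (metis le_zero_eq neq0_conv)
  qed
  note f_props = monic reduced deg_f
  define p where "p = common_index f"
  have p: "p > 0" by (simp add: p_def common_index_pos)
  have finM: "\<bar>M\<bar> \<noteq> \<infinity>"
    using point contact_levels_finite[OF f_props] by (simp add: tree_iff[OF f_props])
  then have M: "M < \<infinity>" by auto
  have P_ne: "P \<noteq> {}" by (rule tree_nonempty[OF f_props point])
  have P_sub: "P \<subseteq> components f" using tree_class(2)[OF f_props point] by blast
  have P_class: "G \<in> P \<longleftrightarrow> M \<le> contact F G" if "F \<in> P" "G \<in> components f" for F G
    using tree_class(1)[OF f_props point that(1)] that(2) by (simp add: contact_class_def)
  note cls = f_props finM P_sub P_ne P_class
  have comp: "irreducible F" "lead_coeff F = 1" "degree F dvd p" if "F \<in> components f" for F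
    using component_props[OF f_props, of F] that by (auto simp: p_def)
  have R: "(N l, R l) \<in> tree f" "N l = next_level f M" "R l \<subseteq> P" if "l \<in> {1..t}" for l
  proof -
    have "(N l, R l) \<in> {q \<in> tree f. strictly_dominates f q (M, P)}"
      using bij_betw_apply[OF enum that] .
    then show "(N l, R l) \<in> tree f" "N l = next_level f M" "R l \<subseteq> P"
      using strictly_dominates_iff[OF f_props point not_top, of "N l" "R l"] by auto
  qed
  have R_eq: "R l = contact_class f (next_level f M) F" if "l \<in> {1..t}" "F \<in> R l" for l F
    using tree_class(1)[OF f_props R(1)[OF that(1)] that(2)] R(2)[OF that(1)] by simp
  have FlP: "Fl l \<in> P" "Fl l \<in> components f" if "l \<in> {1..t}" for l
    using Fl[OF that] R(3)[OF that] P_sub by auto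
  \<comment> \<open>Non-maximality gives a point strictly above, so \<open>Fl 1\<close>
    exists.\<close>
  have t: "1 \<in> {1..t}"
    using ex_strictly_dominates[OF f_props point not_top] enum by (auto simp: bij_betw_def)
  define T where "T = (\<lambda>F :: 'a fls poly. trunc p {..M} ` puiseux_roots p F)"
  have T_iff: "M < contact F G \<longleftrightarrow> T F = T G" "M < contact F G \<longleftrightarrow> T F \<inter> T G \<noteq> {}"
    if "F \<in> components f" "G \<in> components f" for F G
    using trunc_le_image_iff[OF f_props _ _ M, of F G] that by (auto simp: T_def p_def)
  have gt_iff: "M < contact F G \<longleftrightarrow> next_level f M \<le> contact F G"
    if "F \<in> components f" "G \<in> components f" for F G
    by (rule contact_gt_iff_next_level[OF f_props point not_top that])
  have finT: "finite (T F)" if "F \<in> components f" for F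
    using finite_roots[OF comp(1,2)[OF that] p comp(3)[OF that]] by (simp add: T_def)
  have D_sub: "D_set f M P \<subseteq> P" by (auto simp: D_set_def)
  have fin_D: "finite (D_set f M P)"
    using D_sub P_sub components_factorization(1)[OF \<open>f \<noteq> 0\<close>] by (meson finite_subset)
  \<comment> \<open>An element outside \<open>D_set\<close> spans some \<open>R l\<close>, and its
    contact with \<open>Fl l\<close> reaches the next level, so both meet the same open
    balls.\<close>
  have T_total: "trunc p {..M} ` roots_of_class f P =
      (\<Union>F\<in>D_set f M P. T F) \<union> (\<Union>l\<in>{1..t}. T (Fl l))"
  proof -
    have "trunc p {..M} ` roots_of_class f P = (\<Union>F\<in>P. T F)"
      by (auto simp: roots_of_class_def[OF cls] T_def p_def)
    moreover have "\<exists>l\<in>{1..t}. T F = T (Fl l)" if F: "F \<in> P" "F \<notin> D_set f M P" for F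
    proof -
      have "F \<in> components_at f (next_level f M)"
        using F D_set_iff[OF f_props point not_top] by blast
      then have "(next_level f M, contact_class f (next_level f M) F)
          \<in> (\<lambda>l. (N l, R l)) ` {1..t}"
        unfolding bij_betw_imp_surj_on[OF enum]
        using point_above[OF f_props point not_top F(1)] by simp
      then obtain l where l: "l \<in> {1..t}" "R l = contact_class f (next_level f M) F"
        by auto
      then have "next_level f M \<le> contact F (Fl l)"
        using Fl[OF l(1)] by (simp add: contact_class_def)
      moreover have "F \<in> components f" using F(1) P_sub by blast
      ultimately have "T F = T (Fl l)"
        using T_iff(1)[of F "Fl l"] gt_iff[of F "Fl l"] FlP(2)[OF l(1)] by simp
      with l(1) show ?thesis by blast
    qed
    moreover have "(\<Union>F\<in>P. T F) = (\<Union>F\<in>D_set f M P. T F) \<union> (\<Union>l\<in>{1..t}. T (Fl l))"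
      if *: "\<And>F. F \<in> P \<Longrightarrow> F \<notin> D_set f M P \<Longrightarrow> \<exists>l\<in>{1..t}. T F = T (Fl l)"
    proof (intro equalityI UN_least Un_least)
      fix F assume "F \<in> P"
      then show "T F \<subseteq> (\<Union>F\<in>D_set f M P. T F) \<union> (\<Union>l\<in>{1..t}. T (Fl l))"
        using *[of F] by (cases "F \<in> D_set f M P") auto
    qed (use D_sub FlP(1) in auto)
    ultimately show ?thesis by simp
  qed
  have disj_D: "T F \<inter> T G = {}" if "F \<in> D_set f M P" "G \<in> components f" "G \<noteq> F" for F G
  proof -
    have "F \<in> components f" using that(1) D_sub P_sub by blast
    moreover have "\<not> M < contact F G"
      using D_set_contact[OF f_props point not_top that] by (simp add: not_less)
    ultimately show ?thesis using T_iff(2)[of F G] that(2) by simp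
  qed
  have Fl_notin_D: "Fl l \<notin> D_set f M P" if "l \<in> {1..t}" for l
  proof
    assume D: "Fl l \<in> D_set f M P"
    have "(N l, R l) \<in> {q \<in> tree f. strictly_dominates f q (M, P)}"
      using bij_betw_apply[OF enum that] .
    then have "Fl l \<notin> snd (N l, R l)"
      using D unfolding D_set_def by blast
    with Fl[OF that] show False by simp
  qed
  \<comment> \<open>A common open ball would put \<open>Fl l\<close> into \<open>R k\<close>, and
    two classes at one level with a common element coincide.\<close>
  have disj_Fl: "T (Fl k) \<inter> T (Fl l) = {}" if "k \<in> {1..t}" "l \<in> {1..t}" "k \<noteq> l" for k l
  proof (rule ccontr)
    assume "T (Fl k) \<inter> T (Fl l) \<noteq> {}"
    then have "next_level f M \<le> contact (Fl k) (Fl l)"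
      using T_iff(2)[OF FlP(2)[OF that(1)] FlP(2)[OF that(2)]]
        gt_iff[OF FlP(2)[OF that(1)] FlP(2)[OF that(2)]] by simp
    then have "Fl l \<in> R k"
      using R_eq[OF that(1) Fl[OF that(1)]] FlP(2)[OF that(2)] by (simp add: contact_class_def)
    then have "(N k, R k) = (N l, R l)"
      using R_eq[OF that(1) \<open>Fl l \<in> R k\<close>] R_eq[OF that(2) Fl[OF that(2)]] R(2)[OF that(1)] R(2)[OF that(2)]
      by (metis (no_types))
    then show False
      using inj_onD[OF bij_betw_imp_inj_on[OF enum] _ that(1,2)] that(3) by blast
  qed
  have "card (trunc p {..M} ` roots_of_class f P) =
      card (\<Union>F\<in>D_set f M P. T F) + card (\<Union>l\<in>{1..t}. T (Fl l))"
    unfolding T_total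
  proof (rule card_Un_disjoint)
    show "finite (\<Union>F\<in>D_set f M P. T F)" "finite (\<Union>l\<in>{1..t}. T (Fl l))"
      using fin_D finT D_sub P_sub FlP(2) by auto
    show "(\<Union>F\<in>D_set f M P. T F) \<inter> (\<Union>l\<in>{1..t}. T (Fl l)) = {}"
      using disj_D[OF _ FlP(2)] Fl_notin_D by fast
  qed
  also have "card (\<Union>F\<in>D_set f M P. T F) = (\<Sum>F\<in>D_set f M P. card (T F))"
  proof (intro card_UN_disjoint ballI impI fin_D)
    show "finite (T F)" if "F \<in> D_set f M P" for F
      using finT that D_sub P_sub by blast
    show "T F \<inter> T G = {}" if "F \<in> D_set f M P" "G \<in> D_set f M P" "F \<noteq> G" for F G
      using disj_D[of F G] that D_sub P_sub by blast
  qed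
  also have "card (\<Union>l\<in>{1..t}. T (Fl l)) = (\<Sum>l=1..t. card (T (Fl l)))"
    using finT FlP(2) disj_Fl by (intro card_UN_disjoint) auto
  \<comment> \<open>The term \<open>l = 1\<close> is split off to be paired with the closed balls,
    which the same component counts.\<close>
  also have "(\<Sum>l=1..t. card (T (Fl l))) = card (T (Fl 1)) + (\<Sum>l=2..t. card (T (Fl l)))"
    using t by (simp add: sum.atLeast_Suc_atMost numeral_2_eq_2)
  finally have card_T: "real (card (trunc p {..M} ` roots_of_class f P)) =
      (\<Sum>F\<in>D_set f M P. real (card (T F))) + (real (card (T (Fl 1))) + (\<Sum>l=2..t. real (card (T (Fl l)))))"
    by simp
  have sum_formula: "real (card (T F)) = real (degree F)
      - (\<Sum>j | j \<in> {1..char_h F} \<and> M < char_ratio F j.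
          (real (char_e F j) - 1) * (real (degree F) / real (char_d F j)))" if "F \<in> P" for F
  proof -
    have F: "F \<in> components f" using that P_sub by blast
    show ?thesis
      unfolding T_def
      by (rule card_trunc_le_sum[OF comp(1,2)[OF F] p comp(3)[OF F] M theta_props[OF cls theta that]])
  qed
  have card_D: "real (card (T F)) = real (degree F)" if "F \<in> D_set f M P" for F
  proof -
    have "{j. j \<in> {1..char_h F} \<and> M < char_ratio F j} = {}"
      using D_set_char_ratio[OF f_props point not_top that] by fastforce
    then show ?thesis
      using sum_formula[of F] that D_sub by (simp only: sum.empty) auto
  qed
  have "real (degree (Q_part (pderiv f) M P)) =
      real (card (trunc p {..M} ` roots_of_class f P)) - real (card (trunc p {..<M} ` roots_of_class f P))"
    using degree_Q_part[OF cls] by (simp add: p_def)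
  also have "trunc p {..<M} ` roots_of_class f P = trunc p {..<M} ` puiseux_roots p (Fl 1)"
    using trunc_less_class[OF cls FlP(1)[OF t]] by (simp add: p_def)
  also have "real (card (trunc p {..M} ` roots_of_class f P)) =
      (\<Sum>F\<in>D_set f M P. real (degree F)) + (real (card (T (Fl 1))) +
       (\<Sum>l = 2..t. real (degree (Fl l))
            - (\<Sum>j | j \<in> {1..char_h (Fl l)} \<and> M < char_ratio (Fl l) j.
                (real (char_e (Fl l) j) - 1) * (real (degree (Fl l)) / real (char_d (Fl l) j)))))"
    unfolding card_T using card_D sum_formula[OF FlP(1)] by (intro arg_cong2[of _ _ _ _ "(+)"] sum.cong refl) auto
  finally have deg_Q: "real (degree (Q_part (pderiv f) M P)) =
      (\<Sum>F\<in>D_set f M P. real (degree F)) +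
       (\<Sum>l = 2..t. real (degree (Fl l))
            - (\<Sum>j | j \<in> {1..char_h (Fl l)} \<and> M < char_ratio (Fl l) j.
                (real (char_e (Fl l) j) - 1) * (real (degree (Fl l)) / real (char_d (Fl l) j))))
      + (real (card (T (Fl 1))) - real (card (trunc p {..<M} ` puiseux_roots p (Fl 1))))"
    by linarith
  \<comment> \<open>Open minus closed balls of \<open>Fl 1\<close>; this one difference produces the
    two cases of the theorem.\<close>
  have jump: "real (card (T (Fl 1))) - real (card (trunc p {..<M} ` puiseux_roots p (Fl 1)))
    = (if M = char_ratio (Fl 1) \<theta>
       then (real (char_e (Fl 1) \<theta>) - 1) * (real (degree (Fl 1)) / real (char_d (Fl 1) \<theta>)) else 0)"
    unfolding T_def
    by (rule card_trunc_le_diff[OF comp(1,2) p comp(3) M theta_props[OF cls theta]])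
      (use FlP[OF t] in auto)
  show ?thesis
    unfolding deg_Q jump
    by (intro conjI impI) (subst if_not_P, assumption, rule add_0_right, subst if_P, assumption, rule refl)
qed

end
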